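(* Let $k\geq1$ be an integer and $u_0\in L^{2,k}_{\mathcal{E}}$. Then there exists a unique solution $u\in\mathcal{C}^\infty(\mathbb{R},L^{2,k}_{\mathcal{E}})$ to the Lowest Landau Level equation $$i\partial_tu=\Pi(|u|^2u),\qquad u(0,\cdot)=u_0,$$ and it satisfies, for all $t\in\mathbb{R}$, $$\|\langle z\rangle^ku(t)\|_{L^2(\mathbb{C})}\leq\|\langle z\rangle^ku_0\|_{L^2(\mathbb{C})}\big(1+C_k\|\langle z\rangle u_0\|^2_{L^2(\mathbb{C})}|t|\big)^{\frac{k-1}{4}}\quad\text{if }k\geq3,$$ $$\|\langle z\rangle^2u(t)\|_{L^2(\mathbb{C})}\leq\|\langle z\rangle^2u_0\|_{L^2(\mathbb{C})}\big(1+C\|u_0\|^2_{L^2(\mathbb{C})}|t|\big)^{\frac12}\quad\text{if }k=2.$$ Moreover, if $\langle z\rangle^3u_0\in L^2(\mathbb{C})$, then for all $t\in\mathbb{R}$ $$\|\langle z\rangle^2u(t)\|_{L^2(\mathbb{C})}\leq\|\langle z\rangle^3u_0\|_{L^2(\mathbb{C})}\big(1+C\|\langle z\rangle u_0\|^2_{L^2(\mathbb{C})}|t|\big)^{\frac14}.$$ Here $C>0$ is a universal constant and $C_k>0$ depends only on $k$.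
   Context: $L$ is Lebesgue measure on $\mathbb{C}$ and $\langle z\rangle=(1+|z|^2)^{1/2}$. The Bargmann-Fock space is $\mathcal{E}=\{u(z)=e^{-|z|^2/2}f(z):\ f \text{ entire holomorphic}\}\cap L^2(\mathbb{C})$, and $L^{2,k}_{\mathcal{E}}=\{u\in\mathcal{E}:\ \langle z\rangle^ku\in L^2(\mathbb{C})\}$ with norm $\|\langle z\rangle^ku\|_{L^2(\mathbb{C})}$. $\Pi$ is the orthogonal projection onto $\mathcal{E}$, given by $[\Pi u](z)=\frac1\pi e^{-|z|^2/2}\int_{\mathbb{C}}e^{\overline{w}z-|w|^2/2}u(w)\,dL(w)$. *)

theory Defs
  imports "HOL-Analysis.Analysis" "HOL-Complex_Analysis.Complex_Analysis"
begin

definition jbracket :: "complex \<Rightarrow> real" where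
  "jbracket z = sqrt (1 + (cmod z)\<^sup>2)"

definition square_integrable :: "(complex \<Rightarrow> complex) \<Rightarrow> bool" where
  "square_integrable f \<longleftrightarrow>
     f \<in> borel_measurable lborel \<and> integrable lborel (\<lambda>z. (cmod (f z))\<^sup>2)"

text \<open>Only meaningful for square integrable \<open>f\<close>: the Bochner integral of a non-integrable
  function is \<open>0\<close>.\<close>

definition L2_norm :: "(complex \<Rightarrow> complex) \<Rightarrow> real" where
  "L2_norm f = sqrt (LINT z|lborel. (cmod (f z))\<^sup>2)"

definition weighted :: "nat \<Rightarrow> (complex \<Rightarrow> complex) \<Rightarrow> complex \<Rightarrow> complex" where
  "weighted k u = (\<lambda>z. of_real (jbracket z ^ k) * u z)"

text \<open>The elements of the Bargmann-Fock space are honest functions rather than classes modulo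
  null sets. Nothing is lost: all of them are continuous, so two elements that agree almost
  everywhere are equal.\<close>

definition bargmann_fock :: "(complex \<Rightarrow> complex) set" where
  "bargmann_fock =
     {u. (\<exists>f. f holomorphic_on UNIV \<and> u = (\<lambda>z. of_real (exp (- (cmod z)\<^sup>2 / 2)) * f z))
         \<and> square_integrable u}"

definition weighted_fock :: "nat \<Rightarrow> (complex \<Rightarrow> complex) set" where
  "weighted_fock k = {u \<in> bargmann_fock. square_integrable (weighted k u)}"

definition fock_proj :: "(complex \<Rightarrow> complex) \<Rightarrow> complex \<Rightarrow> complex" where
  "fock_proj u = (\<lambda>z. of_real (1 / pi * exp (- (cmod z)\<^sup>2 / 2)) *
     (LINT w|lborel. exp (cnj w * z - of_real ((cmod w)\<^sup>2 / 2)) * u w))"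

text \<open>\<open>has_fock_derivative k u v t\<close>: the curve \<open>u\<close> in \<open>weighted_fock k\<close> is differentiable at
  time \<open>t\<close> with derivative \<open>v\<close>, in the sense of convergence of the difference quotients in
  the norm \<open>L2_norm (weighted k _)\<close>. As \<open>weighted_fock k\<close> is a vector space whose carrier depends
  on \<open>k\<close>, it is not a type, and the derivative of normed vector space types does not apply.\<close>

definition has_fock_derivative ::
  "nat \<Rightarrow> (real \<Rightarrow> complex \<Rightarrow> complex) \<Rightarrow> (complex \<Rightarrow> complex) \<Rightarrow> real \<Rightarrow> bool" where
  "has_fock_derivative k u v t \<longleftrightarrow>
     (\<forall>s. u s \<in> weighted_fock k) \<and> v \<in> weighted_fock k \<and>
     ((\<lambda>h. L2_norm (weighted k (\<lambda>z. (u (t + h) z - u t z) / of_real h - v z))) \<longlongrightarrow> 0) (at 0)"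

text \<open>\<open>V n\<close> is the \<open>n\<close>-th time derivative of \<open>u\<close>; continuity of each \<open>V n\<close> in the norm
  follows from its differentiability.\<close>

definition smooth_fock_curve :: "nat \<Rightarrow> (real \<Rightarrow> complex \<Rightarrow> complex) \<Rightarrow> bool" where
  "smooth_fock_curve k u \<longleftrightarrow>
     (\<exists>V :: nat \<Rightarrow> real \<Rightarrow> complex \<Rightarrow> complex.
        V 0 = u \<and> (\<forall>n t. has_fock_derivative k (V n) (V (Suc n) t) t))"

definition LLL_solution ::
  "nat \<Rightarrow> (complex \<Rightarrow> complex) \<Rightarrow> (real \<Rightarrow> complex \<Rightarrow> complex) \<Rightarrow> bool" where
  "LLL_solution k u0 u \<longleftrightarrow>
     smooth_fock_curve k u \<and> u 0 = u0 \<and>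
     (\<forall>t. \<exists>v. has_fock_derivative k u v t \<and>
        (\<lambda>z. \<i> * v z) = fock_proj (\<lambda>z. of_real ((cmod (u t z))\<^sup>2) * u t z))"

end

theory Submission
  imports Defs "HOL-Probability.Distributions"
begin

text \<open>
  Everything happens on the coefficients \<open>c n\<close> of a function of the Bargmann-Fock space in the
  orthonormal basis \<open>z ^ n * exp (- \<bar>z\<bar>\<^sup>2 / 2) / sqrt (pi * n!)\<close>. The weighted norm becomes diagonal,
  with squared norm \<open>\<Sum>n. fock_weight k n * \<bar>c n\<bar>\<^sup>2\<close> where \<open>fock_weight k\<close> is a polynomial of degree
  \<open>k\<close>, and the cubic nonlinearity acquires a probabilistic structure. With the binomial
  distribution \<open>binw s i = (s choose i) / 2 ^ s\<close> and
  \<open>S s = (\<Sum>i\<le>s. sqrt (binw s i) * c i * c (s - i))\<close>, the \<open>n\<close>-th coefficient of the projection of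
  \<open>\<bar>u\<bar>\<^sup>2 u\<close> is \<open>(\<Sum>s\<ge>n. sqrt (binw s n) * cnj (c (s - n)) * S s) / (2 * pi)\<close>. The second operation
  is the adjoint of the first (\<open>bconv_bcorr_duality\<close>), and the Cauchy-Schwarz inequality together
  with \<open>(\<Sum>i\<le>s. binw s i) = 1\<close> shows that both are bounded. So the equation is an ordinary differential
  equation with a bounded cubic vector field on a Hilbert space.

  The energy with weights \<open>fock_weight j\<close> changes at a rate that is, up to a constant, the sum over
  \<open>s\<close> of \<open>Im (S s * cnj (D s))\<close>, where \<open>D s\<close> arises from \<open>S s\<close> by inserting
  the factor \<open>fock_weight j i + fock_weight j m\<close>, \<open>i + m = s\<close>, into the sum. Any real function of
  \<open>s\<close> may be subtracted from this factor, because \<open>Im (S s * cnj (S s)) = 0\<close>. For \<open>j < 2\<close> nothing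
  remains, which gives the two conservation laws. For \<open>j \<ge> 2\<close> a remainder of size
  \<open>(1 + s) ^ (j - 2) * (i - m)\<^sup>2\<close> is left (\<open>fock_weight_radial_part\<close>), and since \<open>i - m\<close> has
  standard deviation \<open>sqrt s\<close> under the binomial distribution, one power of \<open>s\<close> is gained over the
  trivial bound. This yields \<open>energy_rate_le_mass\<close>, with right hand side
  \<open>energy 0 * energy (j - 1)\<close>; as the binomial distribution charges very unequal pairs \<open>(i, m)\<close>
  only weakly, it also yields \<open>energy_rate_le_momentum\<close>, with the more balanced right hand side
  \<open>energy 1 * energy (j - 2)\<close> for \<open>j \<ge> 3\<close>. The growth bounds follow by integration, inductively in steps
  of two. The induction starts from the conserved \<open>energy 1\<close> and from \<open>energy 2\<close>, which is
  interpolated between \<open>energy 1\<close> and \<open>energy 3\<close>; this interpolation also gives the last claim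
  of the theorem.

  Global solutions come from Picard iteration for the vector field truncated outside a ball whose
  radius grows exponentially in time. The truncated field is a multiple in \<open>[0, 1]\<close> of the original
  one, so the energy estimates apply to it, and Gronwall's inequality shows that the solution
  never leaves the ball (\<open>lll_flow_exists\<close>).

  The passage between functions and coefficients rests on Parseval's identity for entire functions
  and radial weights (\<open>parseval\<close>). Its quadratic form describes the norms; its polarized form
  with the weight \<open>exp (- 2 * \<bar>z\<bar>\<^sup>2)\<close> evaluates the projection, since \<open>fock_proj (\<bar>u\<bar>\<^sup>2 u)\<close> at \<open>z\<close> is an
  inner product of \<open>f\<^sup>2\<close> with \<open>f\<close> times the entire function \<open>\<lambda>w. exp (cnj z * w)\<close>
  (\<open>fock_proj_cubic\<close>).
\<close>

section \<open>The Hilbert space of square summable sequences\<close>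

text \<open>A type of its own, so that derivatives, completeness and bounded bilinear maps of the
  normed vector space classes apply. All spaces \<open>weighted_fock k\<close> are identified with it.\<close>
typedef ell2 = "{c :: nat \<Rightarrow> complex. summable (\<lambda>n. (cmod (c n))\<^sup>2)}"
  morphisms coord Ell2
  by (rule exI[of _ "\<lambda>_. 0"]) simp

setup_lifting type_definition_ell2

lemma coord_Ell2: "summable (\<lambda>n. (cmod (c n))\<^sup>2) \<Longrightarrow> coord (Ell2 c) = c"
  by (rule Ell2_inverse) simp

lemma summable_coord [simp]: "summable (\<lambda>n. (cmod (coord x n))\<^sup>2)"
  using coord[of x] by simp

lemma cmod_add_sq_le: "(cmod (a + b))\<^sup>2 \<le> 2 * (cmod a)\<^sup>2 + 2 * (cmod b)\<^sup>2"
proof -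
  have "(cmod (a + b))\<^sup>2 \<le> (cmod a + cmod b)\<^sup>2"
    by (simp add: norm_triangle_ineq power_mono)
  also have "\<dots> \<le> 2 * (cmod a)\<^sup>2 + 2 * (cmod b)\<^sup>2"
    using sum_squares_bound[of "cmod a" "cmod b"] by (simp add: power2_sum)
  finally show ?thesis .
qed

lemma summable_sq_add:
  fixes f g :: "nat \<Rightarrow> complex"
  assumes "summable (\<lambda>n. (cmod (f n))\<^sup>2)" "summable (\<lambda>n. (cmod (g n))\<^sup>2)"
  shows "summable (\<lambda>n. (cmod (f n + g n))\<^sup>2)"
proof (rule summable_comparison_test)
  show "\<exists>N. \<forall>n\<ge>N. norm ((cmod (f n + g n))\<^sup>2) \<le> 2 * (cmod (f n))\<^sup>2 + 2 * (cmod (g n))\<^sup>2"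
    using cmod_add_sq_le by auto
  show "summable (\<lambda>n. 2 * (cmod (f n))\<^sup>2 + 2 * (cmod (g n))\<^sup>2)"
    using assms by (intro summable_add summable_mult)
qed

lemma summable_sq_prod:
  fixes f g :: "nat \<Rightarrow> complex"
  assumes "summable (\<lambda>n. (cmod (f n))\<^sup>2)" "summable (\<lambda>n. (cmod (g n))\<^sup>2)"
  shows "summable (\<lambda>n. cmod (f n) * cmod (g n))"
proof (rule summable_comparison_test)
  show "\<exists>N. \<forall>n\<ge>N. norm (cmod (f n) * cmod (g n)) \<le> (cmod (f n))\<^sup>2 + (cmod (g n))\<^sup>2"
  proof (intro exI allI impI)
    fix n :: nat
    have "2 * cmod (f n) * cmod (g n) \<le> (cmod (f n))\<^sup>2 + (cmod (g n))\<^sup>2"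
      by (rule sum_squares_bound)
    moreover have "0 \<le> cmod (f n) * cmod (g n)" by simp
    ultimately show "norm (cmod (f n) * cmod (g n)) \<le> (cmod (f n))\<^sup>2 + (cmod (g n))\<^sup>2"
      unfolding real_norm_def abs_of_nonneg[OF \<open>0 \<le> cmod (f n) * cmod (g n)\<close>] by linarith
  qed
  show "summable (\<lambda>n. (cmod (f n))\<^sup>2 + (cmod (g n))\<^sup>2)"
    using assms by (intro summable_add)
qed

instantiation ell2 :: real_vector
begin
lift_definition zero_ell2 :: ell2 is "\<lambda>_. 0" by simp
lift_definition plus_ell2 :: "ell2 \<Rightarrow> ell2 \<Rightarrow> ell2" is "\<lambda>f g n. f n + g n"
  by (rule summable_sq_add)
lift_definition uminus_ell2 :: "ell2 \<Rightarrow> ell2" is "\<lambda>f n. - f n" by simp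
lift_definition minus_ell2 :: "ell2 \<Rightarrow> ell2 \<Rightarrow> ell2" is "\<lambda>f g n. f n - g n"
  subgoal for f g using summable_sq_add[of f "\<lambda>n. - g n"] by simp
  done
lift_definition scaleR_ell2 :: "real \<Rightarrow> ell2 \<Rightarrow> ell2" is "\<lambda>r f n. of_real r * f n"
  by (simp add: norm_mult power_mult_distrib summable_mult)
instance
  by standard (transfer; simp add: algebra_simps fun_eq_iff)+
end

lemma coord_simps [simp]:
  "coord 0 n = 0" "coord (x + y) n = coord x n + coord y n" "coord (- x) n = - coord x n"
  "coord (x - y) n = coord x n - coord y n" "coord (r *\<^sub>R x) n = of_real r * coord x n"
  by (transfer; simp)+

lemma ell2_eqI: "(\<And>n. coord x n = coord y n) \<Longrightarrow> x = y"
  by (transfer; auto)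

lemma summable_coord_prod: "summable (\<lambda>n. Re (coord x n * cnj (coord y n)))"
proof (rule summable_comparison_test)
  show "\<exists>N. \<forall>n\<ge>N. norm (Re (coord x n * cnj (coord y n))) \<le> cmod (coord x n) * cmod (coord y n)"
    by (intro exI allI impI order_trans[OF abs_Re_le_cmod[folded real_norm_def]]) (simp add: norm_mult)
qed (rule summable_sq_prod; simp)

instantiation ell2 :: real_inner
begin
definition "inner x y = (\<Sum>n. Re (coord x n * cnj (coord y n)))"
definition "norm (x :: ell2) = sqrt (inner x x)"
definition "dist (x :: ell2) y = norm (x - y)"
definition "sgn (x :: ell2) = x /\<^sub>R norm x"
definition "uniformity = (INF e\<in>{0<..}. principal {(x :: ell2, y). dist x y < e})"
definition "open (U :: ell2 set) \<longleftrightarrow> (\<forall>x\<in>U. eventually (\<lambda>(x', y). x' = x \<longrightarrow> y \<in> U) uniformity)"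
instance
proof
  fix x y z :: ell2 and r :: real
  show "inner x y = inner y x"
    unfolding inner_ell2_def by (rule suminf_cong) (simp add: algebra_simps)
  show "inner (x + y) z = inner x z + inner y z"
    unfolding inner_ell2_def
    by (subst suminf_add[OF summable_coord_prod summable_coord_prod]) (simp add: algebra_simps)
  show "inner (r *\<^sub>R x) y = r * inner x y"
    unfolding inner_ell2_def
    by (subst suminf_mult[OF summable_coord_prod, symmetric]) (simp add: algebra_simps)
  have eq: "inner x x = (\<Sum>n. (cmod (coord x n))\<^sup>2)"
    unfolding inner_ell2_def by (simp add: complex_mult_cnj cmod_power2)
  show "0 \<le> inner x x" unfolding eq by (intro suminf_nonneg) auto
  show "inner x x = 0 \<longleftrightarrow> x = 0"
    unfolding eq by (subst suminf_eq_zero_iff) (auto intro: ell2_eqI)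
qed (simp_all add: norm_ell2_def dist_ell2_def sgn_ell2_def uniformity_ell2_def open_ell2_def)
end

lemma norm_ell2_sq: "(norm x)\<^sup>2 = (\<Sum>n. (cmod (coord x n))\<^sup>2)"
proof -
  have "(norm x)\<^sup>2 = inner x x" by (simp add: power2_norm_eq_inner)
  also have "\<dots> = (\<Sum>n. (cmod (coord x n))\<^sup>2)"
    unfolding inner_ell2_def by (simp add: complex_mult_cnj cmod_power2)
  finally show ?thesis .
qed

lemma sum_coord_le_norm: "finite A \<Longrightarrow> (\<Sum>n\<in>A. (cmod (coord x n))\<^sup>2) \<le> (norm x)\<^sup>2"
  unfolding norm_ell2_sq by (rule sum_le_suminf) auto

lemma cmod_coord_le_norm: "cmod (coord x n) \<le> norm x"
  by (rule power2_le_imp_le) (use sum_coord_le_norm[of "{n}" x] in auto)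

lemma bounded_sums_ell2:
  assumes "\<And>N. (\<Sum>n<N. (cmod (c n))\<^sup>2) \<le> M\<^sup>2" "M \<ge> 0"
  shows "summable (\<lambda>n. (cmod (c n))\<^sup>2)" "norm (Ell2 c) \<le> M"
proof -
  show s: "summable (\<lambda>n. (cmod (c n))\<^sup>2)"
    by (rule summableI_nonneg_bounded[of _ "M\<^sup>2"]) (use assms in auto)
  have "(norm (Ell2 c))\<^sup>2 \<le> M\<^sup>2"
    unfolding norm_ell2_sq coord_Ell2[OF s] by (rule suminf_le_const[OF s assms(1)])
  then show "norm (Ell2 c) \<le> M" using assms(2) by (rule power2_le_imp_le)
qed

instance ell2 :: banach
proof
  fix X :: "nat \<Rightarrow> ell2"
  assume X: "Cauchy X"
  have "Cauchy (\<lambda>i. coord (X i) n)" for n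
    unfolding Cauchy_def
  proof (intro allI impI)
    fix e :: real assume "0 < e"
    then obtain M where M: "\<forall>m\<ge>M. \<forall>n\<ge>M. dist (X m) (X n) < e"
      using X unfolding Cauchy_def by blast
    have "dist (coord (X i) n) (coord (X j) n) \<le> dist (X i) (X j)" for i j
      using cmod_coord_le_norm[of "X i - X j" n] by (simp add: dist_norm)
    then show "\<exists>M. \<forall>i\<ge>M. \<forall>j\<ge>M. dist (coord (X i) n) (coord (X j) n) < e"
      using M order.strict_trans1 by blast
  qed
  then have "\<exists>c. (\<lambda>i. coord (X i) n) \<longlonglongrightarrow> c" for n
    using Cauchy_convergent[of "\<lambda>i. coord (X i) n"] unfolding convergent_def by simp
  then obtain c where c: "\<And>n. (\<lambda>i. coord (X i) n) \<longlonglongrightarrow> c n" by metis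
  have key: "\<exists>M. \<forall>i\<ge>M. summable (\<lambda>n. (cmod (c n - coord (X i) n))\<^sup>2) \<and>
      norm (Ell2 (\<lambda>n. c n - coord (X i) n)) \<le> e" if e: "e > 0" for e
  proof -
    obtain M where M: "\<forall>m\<ge>M. \<forall>n\<ge>M. dist (X m) (X n) < e"
      using X e unfolding Cauchy_def by blast
    have "(\<Sum>n<N. (cmod (c n - coord (X i) n))\<^sup>2) \<le> e\<^sup>2" if "i \<ge> M" for i N
    proof (rule LIMSEQ_le_const2)
      show "(\<lambda>j. \<Sum>n<N. (cmod (coord (X j) n - coord (X i) n))\<^sup>2) \<longlonglongrightarrow>
          (\<Sum>n<N. (cmod (c n - coord (X i) n))\<^sup>2)"
        by (intro tendsto_intros c)
      show "\<exists>k. \<forall>j\<ge>k. (\<Sum>n<N. (cmod (coord (X j) n - coord (X i) n))\<^sup>2) \<le> e\<^sup>2"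
      proof (intro exI allI impI)
        fix j assume "j \<ge> M"
        have "(\<Sum>n<N. (cmod (coord (X j) n - coord (X i) n))\<^sup>2) \<le> (norm (X j - X i))\<^sup>2"
          using sum_coord_le_norm[of "{..<N}" "X j - X i"] by simp
        also have "\<dots> \<le> e\<^sup>2"
          using M \<open>i \<ge> M\<close> \<open>j \<ge> M\<close> by (intro power_mono) (auto simp: dist_norm less_imp_le)
        finally show "(\<Sum>n<N. (cmod (coord (X j) n - coord (X i) n))\<^sup>2) \<le> e\<^sup>2" .
      qed
    qed
    then show ?thesis
      by (intro exI[of _ M] allI impI conjI bounded_sums_ell2[where M = e]) (use e in auto)
  qed
  obtain M where M: "summable (\<lambda>n. (cmod (c n - coord (X M) n))\<^sup>2)"
    using key[of 1] by auto
  have sc: "summable (\<lambda>n. (cmod (c n))\<^sup>2)"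
    using summable_sq_add[OF M summable_coord[of "X M"]] by simp
  have eq: "Ell2 c - X i = Ell2 (\<lambda>n. c n - coord (X i) n)" if "summable (\<lambda>n. (cmod (c n - coord (X i) n))\<^sup>2)" for i
    by (rule ell2_eqI) (simp add: coord_Ell2 sc that)
  have "X \<longlonglongrightarrow> Ell2 c"
  proof (rule metric_LIMSEQ_I)
    fix e :: real assume "e > 0"
    then obtain M where M: "\<forall>i\<ge>M. summable (\<lambda>n. (cmod (c n - coord (X i) n))\<^sup>2) \<and>
      norm (Ell2 (\<lambda>n. c n - coord (X i) n)) \<le> e / 2" using key[of "e/2"] by auto
    show "\<exists>no. \<forall>n\<ge>no. dist (X n) (Ell2 c) < e"
    proof (intro exI allI impI)
      fix i assume "i \<ge> M"
      then have "norm (Ell2 c - X i) \<le> e / 2" using M eq by auto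
      then show "dist (X i) (Ell2 c) < e" using \<open>e > 0\<close> by (simp add: dist_norm norm_minus_commute)
    qed
  qed
  then show "convergent X" by (auto simp: convergent_def)
qed

section \<open>Binomial weights and their moments\<close>

definition binw :: "nat \<Rightarrow> nat \<Rightarrow> real" where
  "binw s i = real (s choose i) / 2 ^ s"

lemma binw_nonneg [simp]: "0 \<le> binw s i"
  by (simp add: binw_def)

lemma binw_eq_0 [simp]: "s < i \<Longrightarrow> binw s i = 0"
  by (simp add: binw_def)

lemma binw_symmetric: "i \<le> s \<Longrightarrow> binw s (s - i) = binw s i"
  by (simp add: binw_def binomial_symmetric[symmetric])

lemma sum_binw: "(\<Sum>i\<le>s. binw s i) = 1"
proof -
  have "(\<Sum>i\<le>s. real (s choose i)) = real (2 ^ s)"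
    unfolding choose_row_sum[symmetric] by simp
  then show ?thesis
    by (simp add: binw_def sum_divide_distrib[symmetric])
qed

lemma sum_binw_lessThan_le: "(\<Sum>n<N. binw s n) \<le> 1"
proof -
  have "(\<Sum>n<N. binw s n) = (\<Sum>n\<in>{..<N} \<inter> {..s}. binw s n)"
    by (rule sum.mono_neutral_right) (auto, metis binw_eq_0 not_le)
  also have "\<dots> \<le> (\<Sum>n\<le>s. binw s n)" by (rule sum_mono2) auto
  finally show ?thesis by (simp add: sum_binw)
qed

lemma binw_le_1: "binw s n \<le> 1"
proof -
  have "binw s n \<le> (\<Sum>n<Suc n. binw s n)" by (rule member_le_sum) auto
  then show ?thesis using sum_binw_lessThan_le[of s "Suc n"] by linarith
qed

text \<open>Pascal's rule, read as conditioning a sum of independent coin tosses on the last toss.\<close>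
lemma sum_binomial_Suc:
  fixes h :: "nat \<Rightarrow> real"
  shows "(\<Sum>i\<le>Suc s. real (Suc s choose i) * h i) = (\<Sum>i\<le>s. real (s choose i) * (h i + h (Suc i)))"
proof -
  have "(\<Sum>i\<le>Suc s. real (Suc s choose i) * h i)
      = h 0 + (\<Sum>i\<le>s. real (s choose i) * h (Suc i) + real (s choose Suc i) * h (Suc i))"
    by (subst sum.atMost_Suc_shift) (simp add: algebra_simps)
  also have "\<dots> = (\<Sum>i\<le>s. real (s choose i) * h (Suc i)) + (h 0 + (\<Sum>i\<le>s. real (s choose Suc i) * h (Suc i)))"
    by (simp add: sum.distrib)
  also have "h 0 + (\<Sum>i\<le>s. real (s choose Suc i) * h (Suc i)) = (\<Sum>i\<le>Suc s. real (s choose i) * h i)"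
    by (subst sum.atMost_Suc_shift) simp
  also have "\<dots> = (\<Sum>i\<le>s. real (s choose i) * h i)" by simp
  finally show ?thesis by (simp add: sum.distrib algebra_simps)
qed

text \<open>The expectation of \<open>f\<close> at the position of a simple random walk after \<open>s\<close> steps.\<close>
definition binw_mean :: "nat \<Rightarrow> (real \<Rightarrow> real) \<Rightarrow> real" where
  "binw_mean s f = (\<Sum>i\<le>s. binw s i * f (2 * real i - real s))"

lemma binw_mean_Suc: "binw_mean (Suc s) f = binw_mean s (\<lambda>x. (f (x - 1) + f (x + 1)) / 2)"
proof -
  have "binw_mean (Suc s) f = (\<Sum>i\<le>Suc s. real (Suc s choose i) * (f (2 * real i - real (Suc s)) / 2 ^ Suc s))"
    unfolding binw_mean_def binw_def by simp
  also have "\<dots> = (\<Sum>i\<le>s. real (s choose i) * (f (2 * real i - real (Suc s)) / 2 ^ Suc s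
       + f (2 * real (Suc i) - real (Suc s)) / 2 ^ Suc s))"
    by (rule sum_binomial_Suc)
  also have "\<dots> = binw_mean s (\<lambda>x. (f (x - 1) + f (x + 1)) / 2)"
    unfolding binw_mean_def binw_def
    by (intro sum.cong refl) (simp add: field_simps)
  finally show ?thesis .
qed

lemma binw_mean_lin: "binw_mean s (\<lambda>x. a * f x + b * g x + c) = a * binw_mean s f + b * binw_mean s g + c"
  using sum_binw[of s]
  by (simp add: binw_mean_def sum_distrib_left sum.distrib algebra_simps flip: sum_distrib_left)

lemma binw_mean_sq: "binw_mean s (\<lambda>x. x\<^sup>2) = real s"
proof (induction s)
  case 0 then show ?case by (simp add: binw_mean_def binw_def)
next
  case (Suc s)
  have "(\<lambda>x::real. ((x - 1)\<^sup>2 + (x + 1)\<^sup>2) / 2) = (\<lambda>x. 1 * x\<^sup>2 + 0 * x\<^sup>2 + 1)"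
    by (simp add: power2_eq_square algebra_simps fun_eq_iff)
  then show ?case
    unfolding binw_mean_Suc using binw_mean_lin[of s 1 "\<lambda>x. x\<^sup>2" 0 "\<lambda>x. x\<^sup>2" 1] Suc by simp
qed

lemma binw_mean_pow4: "binw_mean s (\<lambda>x. x ^ 4) = 3 * (real s)\<^sup>2 - 2 * real s"
proof (induction s)
  case 0 then show ?case by (simp add: binw_mean_def binw_def)
next
  case (Suc s)
  have "(\<lambda>x::real. ((x - 1) ^ 4 + (x + 1) ^ 4) / 2) = (\<lambda>x. 1 * x ^ 4 + 6 * x\<^sup>2 + 1)"
    by (simp add: power2_eq_square power4_eq_xxxx algebra_simps fun_eq_iff)
  then show ?case
    unfolding binw_mean_Suc
    using binw_mean_lin[of s 1 "\<lambda>x. x ^ 4" 6 "\<lambda>x. x\<^sup>2" 1] Suc binw_mean_sq[of s]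
    by (simp add: power2_eq_square algebra_simps)
qed

lemma binw_fourth_moment:
  "(\<Sum>i\<le>s. binw s i * (real i - real (s - i)) ^ 4) \<le> 3 * (real s)\<^sup>2"
proof -
  have "(\<Sum>i\<le>s. binw s i * (real i - real (s - i)) ^ 4) = binw_mean s (\<lambda>x. x ^ 4)"
    unfolding binw_mean_def by (intro sum.cong refl) (auto simp: algebra_simps)
  then show ?thesis unfolding binw_mean_pow4 by simp
qed

text \<open>Small values of \<open>i\<close> and of \<open>s - i\<close> are so unlikely that the inverse weight
  \<open>1 / ((i + 1) * (s - i + 1))\<close> has an average of the order \<open>4 / s\<^sup>2\<close>, its value at \<open>i = s / 2\<close>. The
  reason is that it can be absorbed into a binomial coefficient of order \<open>s + 2\<close>.\<close>
lemma binw_shift2: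
  assumes "i \<le> s"
  shows "binw s i / ((real i + 1) * (real (s - i) + 1))
       = 4 * binw (s + 2) (i + 1) / ((real s + 1) * (real s + 2))"
proof -
  define j where "j = s - i"
  have s: "s = i + j" using assms by (simp add: j_def)
  define X where "X = real (i + j + 2 choose (i + 1))"
  define Y where "Y = real (i + j choose i)"
  have X: "X * (fact (i + 1) * fact (j + 1)) = fact (i + j + 2)"
    unfolding X_def by (subst binomial_fact) auto
  have Y: "Y * (fact i * fact j) = fact (i + j)"
    unfolding Y_def by (subst binomial_fact) auto
  have "X * (real i + 1) * (real j + 1) * (fact i * fact j) = X * (fact (i + 1) * fact (j + 1))"
    by (simp add: algebra_simps)
  also have "\<dots> = (real i + real j + 2) * (real i + real j + 1) * fact (i + j)"
    unfolding X by (simp add: numeral_2_eq_2 algebra_simps)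
  also have "\<dots> = (real i + real j + 2) * (real i + real j + 1) * Y * (fact i * fact j)"
    unfolding Y[symmetric] by simp
  finally have eq: "X * ((real i + 1) * (real j + 1)) = Y * ((real s + 1) * (real s + 2))"
    by (subst (asm) mult_right_cancel) (auto simp: s algebra_simps)
  have pos: "(real i + 1) * (real j + 1) \<noteq> 0" "(real s + 1) * (real s + 2) \<noteq> 0"
    by (simp_all add: add_nonneg_eq_0_iff)
  have "Y / ((real i + 1) * (real j + 1)) = X / ((real s + 1) * (real s + 2))"
    by (subst frac_eq_eq[OF pos]) (rule eq[symmetric])
  note main = this
  have eqs: "binw s i = Y / 2 ^ s" "binw (s + 2) (i + 1) = X / (4 * 2 ^ s)"
    by (simp_all add: binw_def X_def Y_def s)
  have "binw s i / ((real i + 1) * (real j + 1)) = Y / ((real i + 1) * (real j + 1)) / 2 ^ s"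
    unfolding eqs by (simp add: mult.commute)
  also have "\<dots> = 4 * binw (s + 2) (i + 1) / ((real s + 1) * (real s + 2))"
    unfolding eqs main by (simp add: mult.commute)
  finally show ?thesis unfolding j_def .
qed

lemma binw_damped_moments:
  fixes s :: nat
  shows "(\<Sum>i\<le>s. binw s i / ((real i + 1) * (real (s - i) + 1))) \<le> 4 / (real s + 1)\<^sup>2"
    and "(\<Sum>i\<le>s. binw s i * (real i - real (s - i)) ^ 4 / ((real i + 1) * (real (s - i) + 1))) \<le> 24"
proof -
  have shift: "(\<Sum>i\<le>s. f (Suc i)) \<le> (\<Sum>i\<le>s+2. f i)" if "\<And>i. f i \<ge> 0" for f :: "nat \<Rightarrow> real"
  proof -
    have "(\<Sum>i\<le>s. f (Suc i)) = (\<Sum>i\<in>Suc ` {..s}. f i)" by (simp add: sum.reindex)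
    also have "\<dots> \<le> (\<Sum>i\<le>s+2. f i)" using that by (intro sum_mono2) auto
    finally show ?thesis .
  qed
  have "(\<Sum>i\<le>s. binw s i / ((real i + 1) * (real (s - i) + 1)))
      = 4 / ((real s + 1) * (real s + 2)) * (\<Sum>i\<le>s. binw (s + 2) (Suc i))"
    unfolding sum_distrib_left by (intro sum.cong refl) (simp add: binw_shift2 del: of_nat_diff)
  also have "\<dots> \<le> 4 / ((real s + 1) * (real s + 2)) * 1"
    using shift[of "binw (s + 2)"] sum_binw[of "s + 2"] by (intro mult_left_mono) auto
  also have "\<dots> \<le> 4 / (real s + 1)\<^sup>2"
    by (simp add: power2_eq_square frac_le)
  finally show "(\<Sum>i\<le>s. binw s i / ((real i + 1) * (real (s - i) + 1))) \<le> 4 / (real s + 1)\<^sup>2" .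
  have "(\<Sum>i\<le>s. binw s i * (real i - real (s - i)) ^ 4 / ((real i + 1) * (real (s - i) + 1)))
      = 4 / ((real s + 1) * (real s + 2)) * (\<Sum>i\<le>s. binw (s + 2) (Suc i) * (real (Suc i) - real (s + 2 - Suc i)) ^ 4)"
    unfolding sum_distrib_left
  proof (intro sum.cong refl)
    fix i assume "i \<in> {..s}"
    then have i: "i \<le> s" by simp
    have d: "real (Suc i) - real (s + 2 - Suc i) = real i - real (s - i)" using i by simp
    have "binw s i * (real i - real (s - i)) ^ 4 / ((real i + 1) * (real (s - i) + 1))
       = (binw s i / ((real i + 1) * (real (s - i) + 1))) * (real i - real (s - i)) ^ 4" by simp
    then show "binw s i * (real i - real (s - i)) ^ 4 / ((real i + 1) * (real (s - i) + 1))
       = 4 / ((real s + 1) * (real s + 2)) * (binw (s + 2) (Suc i) * (real (Suc i) - real (s + 2 - Suc i)) ^ 4)"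
      unfolding binw_shift2[OF i] d by simp
  qed
  also have "\<dots> \<le> 4 / ((real s + 1) * (real s + 2)) * (3 * (real (s + 2))\<^sup>2)"
    using shift[of "\<lambda>i. binw (s + 2) i * (real i - real (s + 2 - i)) ^ 4"] binw_fourth_moment[of "s + 2"]
    by (intro mult_left_mono) (auto intro: order_trans)
  also have "\<dots> = 12 * ((real s + 2) / (real s + 1))"
    by (simp add: divide_simps power2_eq_square) (simp add: algebra_simps)
  also have "\<dots> \<le> 24" by (simp add: divide_simps)
  finally show "(\<Sum>i\<le>s. binw s i * (real i - real (s - i)) ^ 4 / ((real i + 1) * (real (s - i) + 1))) \<le> 24" .
qed

section \<open>Bilinear maps on sequences with binomial kernels\<close>

lemma cmod_weighted_sum_sq_le:
  fixes u :: "'a \<Rightarrow> real" and z :: "'a \<Rightarrow> complex"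
  shows "(cmod (\<Sum>n\<in>A. of_real (u n) * z n))\<^sup>2 \<le> (\<Sum>n\<in>A. (u n)\<^sup>2) * (\<Sum>n\<in>A. (cmod (z n))\<^sup>2)"
proof -
  have "cmod (\<Sum>n\<in>A. of_real (u n) * z n) \<le> (\<Sum>n\<in>A. \<bar>u n\<bar> * cmod (z n))"
    by (rule order_trans[OF norm_sum]) (simp add: norm_mult)
  then have "(cmod (\<Sum>n\<in>A. of_real (u n) * z n))\<^sup>2 \<le> (\<Sum>n\<in>A. \<bar>u n\<bar> * cmod (z n))\<^sup>2"
    by (rule power_mono) simp
  also have "\<dots> \<le> (\<Sum>n\<in>A. \<bar>u n\<bar>\<^sup>2) * (\<Sum>n\<in>A. (cmod (z n))\<^sup>2)"
    by (rule Cauchy_Schwarz_ineq_sum)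
  finally show ?thesis by simp
qed

text \<open>For \<open>\<kappa> = 1\<close> this is the product of entire functions: if \<open>a\<close> and \<open>b\<close> are coefficients with
  respect to \<open>z ^ n / sqrt (n!)\<close>, then \<open>bconv \<kappa> a b\<close> are the coefficients of the product with respect to
  \<open>sqrt (2 ^ s / s!) * z ^ s\<close>. A real kernel \<open>\<kappa>\<close> absorbs the changes of norm and the multipliers in the energy estimates.\<close>
definition bconv :: "(nat \<Rightarrow> nat \<Rightarrow> real) \<Rightarrow> (nat \<Rightarrow> complex) \<Rightarrow> (nat \<Rightarrow> complex) \<Rightarrow> nat \<Rightarrow> complex" where
  "bconv \<kappa> a b s = (\<Sum>n\<le>s. of_real (\<kappa> n (s - n) * sqrt (binw s n)) * (a n * b (s - n)))"

text \<open>The adjoint of convolution with \<open>b\<close>. As \<open>binw s n = 0\<close> for \<open>s < n\<close>, the truncated subtraction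
  in \<open>s - n\<close> does not matter.\<close>
definition bcorr :: "(nat \<Rightarrow> nat \<Rightarrow> real) \<Rightarrow> (nat \<Rightarrow> complex) \<Rightarrow> (nat \<Rightarrow> complex) \<Rightarrow> nat \<Rightarrow> complex" where
  "bcorr \<kappa> b \<sigma> n = (\<Sum>s. of_real (\<kappa> n (s - n) * sqrt (binw s n)) * (cnj (b (s - n)) * \<sigma> s))"

text \<open>Cauchy-Schwarz with a free weight \<open>w\<close>: a decaying kernel is bounded by its moments, while \<open>w\<close> can
  distribute powers of the indices evenly over \<open>a\<close> and \<open>b\<close>.\<close>
lemma cmod_bconv_sq_le:
  "(cmod (bconv \<kappa> a b s))\<^sup>2 \<le>
     (\<Sum>n\<le>s. (\<kappa> n (s - n))\<^sup>2 * binw s n / w n) * (\<Sum>n\<le>s. w n * ((cmod (a n))\<^sup>2 * (cmod (b (s - n)))\<^sup>2))"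
  if w: "\<And>n. w n > 0" for w :: "nat \<Rightarrow> real"
proof -
  have "bconv \<kappa> a b s = (\<Sum>n\<le>s. of_real (\<kappa> n (s - n) * sqrt (binw s n) / sqrt (w n)) *
      (of_real (sqrt (w n)) * (a n * b (s - n))))"
    unfolding bconv_def using w by (intro sum.cong refl) (simp add: less_imp_neq[symmetric])
  then have "(cmod (bconv \<kappa> a b s))\<^sup>2 \<le> (\<Sum>n\<le>s. (\<kappa> n (s - n) * sqrt (binw s n) / sqrt (w n))\<^sup>2)
      * (\<Sum>n\<le>s. (cmod (of_real (sqrt (w n)) * (a n * b (s - n))))\<^sup>2)"
    using cmod_weighted_sum_sq_le[of "\<lambda>n. \<kappa> n (s - n) * sqrt (binw s n) / sqrt (w n)"
       "\<lambda>n. of_real (sqrt (w n)) * (a n * b (s - n))" "{..s}"] by simp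
  also have "\<dots> = (\<Sum>n\<le>s. (\<kappa> n (s - n))\<^sup>2 * binw s n / w n) * (\<Sum>n\<le>s. w n * ((cmod (a n))\<^sup>2 * (cmod (b (s - n)))\<^sup>2))"
    using w by (intro arg_cong2[where f = "(*)"] sum.cong refl)
      (auto simp: power_mult_distrib power_divide norm_mult less_imp_le)
  finally show ?thesis .
qed

lemma cauchy_product_nonneg:
  fixes p q :: "nat \<Rightarrow> real"
  assumes "summable p" "summable q" "\<And>n. p n \<ge> 0" "\<And>n. q n \<ge> 0"
  shows "(\<lambda>s. \<Sum>n\<le>s. p n * q (s - n)) sums ((\<Sum>n. p n) * (\<Sum>n. q n))"
  using Cauchy_product_sums[of p q] assms by (simp add: summable_rabs_cancel)

locale bounded_kernel =
  fixes \<kappa> :: "nat \<Rightarrow> nat \<Rightarrow> real" and K :: real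
  assumes kernel_bound: "\<bar>\<kappa> i j\<bar> \<le> K"
begin

lemma K_nonneg: "0 \<le> K"
  using kernel_bound[of 0 0] by linarith

lemma kernel_sq_le: "(\<kappa> i j)\<^sup>2 \<le> K\<^sup>2"
  using kernel_bound[of i j] by (metis abs_ge_zero power2_abs power_mono)

lemma cmod_bconv_le: "(cmod (bconv \<kappa> a b s))\<^sup>2 \<le> K\<^sup>2 * (\<Sum>n\<le>s. (cmod (a n))\<^sup>2 * (cmod (b (s - n)))\<^sup>2)"
proof -
  have "(\<Sum>n\<le>s. (\<kappa> n (s - n))\<^sup>2 * binw s n) \<le> (\<Sum>n\<le>s. K\<^sup>2 * binw s n)"
    by (intro sum_mono mult_right_mono kernel_sq_le) simp
  then have le: "(\<Sum>n\<le>s. (\<kappa> n (s - n))\<^sup>2 * binw s n) \<le> K\<^sup>2"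
    by (simp add: sum_binw flip: sum_distrib_left)
  show ?thesis
    by (rule order_trans[OF cmod_bconv_sq_le[of "\<lambda>_. 1" \<kappa> a b s]])
       (use le in \<open>auto intro!: mult_right_mono sum_nonneg\<close>)
qed

lemma bconv_bounded_sums:
  "(\<Sum>s<N. (cmod (bconv \<kappa> (coord x) (coord y) s))\<^sup>2) \<le> (K * (norm x * norm y))\<^sup>2"
proof -
  let ?q = "\<lambda>s. \<Sum>n\<le>s. (cmod (coord x n))\<^sup>2 * (cmod (coord y (s - n)))\<^sup>2"
  have q: "?q sums ((norm x)\<^sup>2 * (norm y)\<^sup>2)"
    unfolding norm_ell2_sq by (rule cauchy_product_nonneg) auto
  have "(\<Sum>s<N. (cmod (bconv \<kappa> (coord x) (coord y) s))\<^sup>2) \<le> (\<Sum>s<N. K\<^sup>2 * ?q s)"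
    by (intro sum_mono cmod_bconv_le)
  also have "\<dots> = K\<^sup>2 * (\<Sum>s<N. ?q s)" by (simp add: sum_distrib_left)
  also have "\<dots> \<le> K\<^sup>2 * ((norm x)\<^sup>2 * (norm y)\<^sup>2)"
    unfolding sums_unique[OF q]
    by (intro mult_left_mono sum_le_suminf sums_summable[OF q]) (auto intro!: sum_nonneg)
  finally show ?thesis by (simp add: power_mult_distrib)
qed

definition "Bconv x y = Ell2 (bconv \<kappa> (coord x) (coord y))"

lemma coord_Bconv: "coord (Bconv x y) = bconv \<kappa> (coord x) (coord y)"
  unfolding Bconv_def
  by (rule coord_Ell2) (rule bounded_sums_ell2(1)[OF bconv_bounded_sums], simp add: K_nonneg)

lemma norm_Bconv_le: "norm (Bconv x y) \<le> K * (norm x * norm y)"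
  unfolding Bconv_def by (rule bounded_sums_ell2(2)[OF bconv_bounded_sums]) (simp add: K_nonneg)

lemma bounded_bilinear_Bconv: "bounded_bilinear Bconv"
proof
  fix x x' y y' :: ell2 and r :: real
  show "Bconv (x + x') y = Bconv x y + Bconv x' y"
    by (rule ell2_eqI) (simp add: coord_Bconv bconv_def algebra_simps sum.distrib)
  show "Bconv x (y + y') = Bconv x y + Bconv x y'"
    by (rule ell2_eqI) (simp add: coord_Bconv bconv_def algebra_simps sum.distrib)
  show "Bconv (r *\<^sub>R x) y = r *\<^sub>R Bconv x y"
    by (rule ell2_eqI) (simp add: coord_Bconv bconv_def algebra_simps sum_distrib_left)
  show "Bconv x (r *\<^sub>R y) = r *\<^sub>R Bconv x y"
    by (rule ell2_eqI) (simp add: coord_Bconv bconv_def algebra_simps sum_distrib_left)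
  show "\<exists>C. \<forall>x y. norm (Bconv x y) \<le> norm x * norm y * C"
    using norm_Bconv_le by (intro exI[of _ K]) (simp add: mult_ac)
qed

abbreviation "corr_term b \<sigma> n s \<equiv> of_real (\<kappa> n (s - n) * sqrt (binw s n)) * (cnj (b (s - n)) * \<sigma> s) :: complex"

lemma summable_binw_weight: "summable (\<lambda>s. binw s n * (cmod (coord \<sigma> s))\<^sup>2)"
  by (rule summable_comparison_test'[OF summable_coord[of \<sigma>], of 0])
     (auto intro!: mult_left_le_one_le binw_le_1)

text \<open>The Cauchy-Schwarz inequality in \<open>s\<close> keeps the factor \<open>binw s n\<close> with \<open>\<sigma>\<close>. It is essential
  later, where the sum over \<open>n\<close> is bounded by \<open>(\<Sum>n. binw s n) \<le> 1\<close>.\<close>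
lemma corr_term_partial_sums:
  "(\<Sum>s<M. cmod (corr_term (coord y) (coord \<sigma>) n s))
     \<le> K * norm y * sqrt (\<Sum>s. binw s n * (cmod (coord \<sigma> s))\<^sup>2)"
proof -
  let ?u = "\<lambda>s. sqrt (binw s n) * cmod (coord \<sigma> s)"
  let ?v = "\<lambda>s. if n \<le> s then cmod (coord y (s - n)) else 0"
  have "(\<Sum>s<M. cmod (corr_term (coord y) (coord \<sigma>) n s)) \<le> (\<Sum>s<M. K * (?u s * ?v s))"
  proof (rule sum_mono)
    fix s
    show "cmod (corr_term (coord y) (coord \<sigma>) n s) \<le> K * (?u s * ?v s)"
    proof (cases "n \<le> s")
      case True
      have "cmod (corr_term (coord y) (coord \<sigma>) n s) = \<bar>\<kappa> n (s - n)\<bar> * (?u s * ?v s)"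
        using True by (simp add: norm_mult abs_mult)
      also have "\<dots> \<le> K * (?u s * ?v s)" by (intro mult_right_mono kernel_bound) auto
      finally show ?thesis .
    qed simp
  qed
  also have "\<dots> = K * (\<Sum>s<M. ?u s * ?v s)" by (simp add: sum_distrib_left)
  also have "\<dots> \<le> K * (sqrt (\<Sum>s. binw s n * (cmod (coord \<sigma> s))\<^sup>2) * norm y)"
  proof (intro mult_left_mono K_nonneg)
    have "(\<Sum>s<M. ?v s ^ 2) = (\<Sum>s\<in>{n..<M}. (cmod (coord y (s - n)))\<^sup>2)"
      by (intro sum.mono_neutral_cong_right) auto
    also have "\<dots> = (\<Sum>j<M - n. (cmod (coord y j))\<^sup>2)"
      by (rule sum.reindex_bij_witness[of _ "\<lambda>j. j + n" "\<lambda>s. s - n"]) auto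
    also have "\<dots> \<le> (norm y)\<^sup>2" by (rule sum_coord_le_norm) simp
    finally have v: "(\<Sum>s<M. ?v s ^ 2) \<le> (norm y)\<^sup>2" .
    have u: "(\<Sum>s<M. ?u s ^ 2) \<le> (\<Sum>s. binw s n * (cmod (coord \<sigma> s))\<^sup>2)"
      unfolding power_mult_distrib by (simp, rule sum_le_suminf[OF summable_binw_weight]) auto
    have "(\<Sum>s<M. ?u s * ?v s)\<^sup>2 \<le> (\<Sum>s<M. ?u s ^ 2) * (\<Sum>s<M. ?v s ^ 2)"
      by (rule Cauchy_Schwarz_ineq_sum)
    also have "\<dots> \<le> (\<Sum>s. binw s n * (cmod (coord \<sigma> s))\<^sup>2) * (norm y)\<^sup>2"
      by (rule mult_mono[OF u v]) (auto intro!: suminf_nonneg summable_binw_weight sum_nonneg)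
    finally have "(\<Sum>s<M. ?u s * ?v s) \<le> sqrt ((\<Sum>s. binw s n * (cmod (coord \<sigma> s))\<^sup>2) * (norm y)\<^sup>2)"
      by (rule real_le_rsqrt)
    then show "(\<Sum>s<M. ?u s * ?v s) \<le> sqrt (\<Sum>s. binw s n * (cmod (coord \<sigma> s))\<^sup>2) * norm y"
      by (simp add: real_sqrt_mult)
  qed
  finally show ?thesis by (simp add: mult_ac)
qed

lemma summable_corr_term: "summable (\<lambda>s. cmod (corr_term (coord y) (coord \<sigma>) n s))"
  by (rule summableI_nonneg_bounded[OF _ corr_term_partial_sums]) simp

lemma cmod_bcorr_sq_le:
  "(cmod (bcorr \<kappa> (coord y) (coord \<sigma>) n))\<^sup>2 \<le> (K * norm y)\<^sup>2 * (\<Sum>s. binw s n * (cmod (coord \<sigma> s))\<^sup>2)"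
proof -
  have "cmod (bcorr \<kappa> (coord y) (coord \<sigma>) n) \<le> (\<Sum>s. cmod (corr_term (coord y) (coord \<sigma>) n s))"
    unfolding bcorr_def by (rule summable_norm[OF summable_corr_term])
  also have "\<dots> \<le> K * norm y * sqrt (\<Sum>s. binw s n * (cmod (coord \<sigma> s))\<^sup>2)"
    by (rule suminf_le_const[OF summable_corr_term corr_term_partial_sums])
  finally have "(cmod (bcorr \<kappa> (coord y) (coord \<sigma>) n))\<^sup>2 \<le>
      (K * norm y * sqrt (\<Sum>s. binw s n * (cmod (coord \<sigma> s))\<^sup>2))\<^sup>2"
    by (rule power_mono) simp
  then show ?thesis
    by (simp add: power_mult_distrib suminf_nonneg[OF summable_binw_weight])
qed

lemma bcorr_bounded_sums:
  "(\<Sum>n<N. (cmod (bcorr \<kappa> (coord y) (coord \<sigma>) n))\<^sup>2) \<le> (K * (norm y * norm \<sigma>))\<^sup>2"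
proof -
  have "(\<Sum>n<N. (cmod (bcorr \<kappa> (coord y) (coord \<sigma>) n))\<^sup>2)
     \<le> (\<Sum>n<N. (K * norm y)\<^sup>2 * (\<Sum>s. binw s n * (cmod (coord \<sigma> s))\<^sup>2))"
    by (intro sum_mono cmod_bcorr_sq_le)
  also have "\<dots> = (K * norm y)\<^sup>2 * (\<Sum>s. \<Sum>n<N. binw s n * (cmod (coord \<sigma> s))\<^sup>2)"
    by (subst suminf_sum) (auto intro: summable_binw_weight simp: sum_distrib_left)
  also have "\<dots> \<le> (K * norm y)\<^sup>2 * (\<Sum>s. (cmod (coord \<sigma> s))\<^sup>2)"
    by (intro mult_left_mono suminf_le summable_sum summable_binw_weight)
       (auto simp flip: sum_distrib_right intro!: mult_left_le_one_le sum_binw_lessThan_le sum_nonneg)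
  finally show ?thesis by (simp add: norm_ell2_sq[of \<sigma>] power_mult_distrib mult_ac)
qed

definition "Bcorr y \<sigma> = Ell2 (bcorr \<kappa> (coord y) (coord \<sigma>))"

lemma coord_Bcorr: "coord (Bcorr y \<sigma>) = bcorr \<kappa> (coord y) (coord \<sigma>)"
  unfolding Bcorr_def
  by (rule coord_Ell2) (rule bounded_sums_ell2(1)[OF bcorr_bounded_sums], simp add: K_nonneg)

lemma norm_Bcorr_le: "norm (Bcorr y \<sigma>) \<le> K * (norm y * norm \<sigma>)"
  unfolding Bcorr_def by (rule bounded_sums_ell2(2)[OF bcorr_bounded_sums]) (simp add: K_nonneg)

lemmas summable_corr_term' = summable_norm_cancel[OF summable_corr_term]

lemma bounded_bilinear_Bcorr: "bounded_bilinear Bcorr"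
proof
  fix x x' y y' :: ell2 and r :: real
  have add: "(\<Sum>s. f s + g s) = (\<Sum>s. f s) + (\<Sum>s. g s)" if "summable f" "summable g" for f g :: "nat \<Rightarrow> complex"
    using suminf_add[OF that] by simp
  show "Bcorr (x + x') y = Bcorr x y + Bcorr x' y"
    by (rule ell2_eqI, simp add: coord_Bcorr bcorr_def, subst add[symmetric])
       (use summable_corr_term' in \<open>auto simp: algebra_simps\<close>)
  show "Bcorr x (y + y') = Bcorr x y + Bcorr x y'"
    by (rule ell2_eqI, simp add: coord_Bcorr bcorr_def, subst add[symmetric])
       (use summable_corr_term' in \<open>auto simp: algebra_simps\<close>)
  show "Bcorr (r *\<^sub>R x) y = r *\<^sub>R Bcorr x y"
    by (rule ell2_eqI, simp add: coord_Bcorr bcorr_def, subst suminf_mult[symmetric])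
       (use summable_corr_term' in \<open>auto simp: algebra_simps\<close>)
  show "Bcorr x (r *\<^sub>R y) = r *\<^sub>R Bcorr x y"
    by (rule ell2_eqI, simp add: coord_Bcorr bcorr_def, subst suminf_mult[symmetric])
       (use summable_corr_term' in \<open>auto simp: algebra_simps\<close>)
  show "\<exists>C. \<forall>x y. norm (Bcorr x y) \<le> norm x * norm y * C"
    using norm_Bcorr_le by (intro exI[of _ K]) (simp add: mult_ac)
qed

end

context bounded_kernel
begin

lemma summable_bconv:
  assumes "summable (\<lambda>n. (cmod (a n))\<^sup>2)" "summable (\<lambda>n. (cmod (b n))\<^sup>2)"
  shows "summable (\<lambda>s. (cmod (bconv \<kappa> a b s))\<^sup>2)"
  using summable_coord[of "Bconv (Ell2 a) (Ell2 b)"] unfolding coord_Bconv coord_Ell2[OF assms(1)] coord_Ell2[OF assms(2)] .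

text \<open>The two iterated sums of the same double series over \<open>n \<le> s\<close>. The interchange is justified by
  dominated convergence for series, where the majorant is the convolution of the absolute values.\<close>
lemma bconv_bcorr_duality:
  "summable (\<lambda>s. cmod (coord \<sigma> s * cnj (bconv \<kappa> (coord d) (coord y) s)))"
  "(\<lambda>n. cnj (coord d n) * bcorr \<kappa> (coord y) (coord \<sigma>) n) sums
     (\<Sum>s. coord \<sigma> s * cnj (bconv \<kappa> (coord d) (coord y) s))"
proof -
  let ?t = "\<lambda>n s. cnj (coord d n) * corr_term (coord y) (coord \<sigma>) n s"
  let ?a = "\<lambda>s N. \<Sum>n<N. ?t n s"
  let ?b = "\<lambda>s. coord \<sigma> s * cnj (bconv \<kappa> (coord d) (coord y) s)"
  let ?M = "\<lambda>s. cmod (coord \<sigma> s) * cmod (bconv (\<lambda>i j. \<bar>\<kappa> i j\<bar>)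
      (\<lambda>n. of_real (cmod (coord d n))) (\<lambda>n. of_real (cmod (coord y n))) s)"
  interpret abs: bounded_kernel "\<lambda>i j. \<bar>\<kappa> i j\<bar>" K
    by standard (use kernel_bound in auto)
  have sM: "summable ?M"
    by (intro summable_sq_prod abs.summable_bconv) auto
  have zero: "?t n s = 0" if "s < n" for n s using that by simp
  have Meq: "?M s = (\<Sum>n\<le>s. cmod (?t n s))" for s
  proof -
    have "bconv (\<lambda>i j. \<bar>\<kappa> i j\<bar>) (\<lambda>n. of_real (cmod (coord d n))) (\<lambda>n. of_real (cmod (coord y n))) s
       = of_real (\<Sum>n\<le>s. \<bar>\<kappa> n (s - n)\<bar> * sqrt (binw s n) * (cmod (coord d n) * cmod (coord y (s - n))))"
      by (simp add: bconv_def)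
    then have "cmod (bconv (\<lambda>i j. \<bar>\<kappa> i j\<bar>) (\<lambda>n. of_real (cmod (coord d n))) (\<lambda>n. of_real (cmod (coord y n))) s)
       = (\<Sum>n\<le>s. \<bar>\<kappa> n (s - n)\<bar> * sqrt (binw s n) * (cmod (coord d n) * cmod (coord y (s - n))))"
      by (simp only: norm_of_real) (intro abs_of_nonneg sum_nonneg mult_nonneg_nonneg; simp)
    then show ?thesis
      by (simp add: sum_distrib_left norm_mult abs_mult mult_ac)
  qed
  have lim: "((\<lambda>N. ?a s N) \<longlongrightarrow> ?b s) sequentially" for s
  proof (rule tendsto_eventually)
    show "\<forall>\<^sub>F N in sequentially. ?a s N = ?b s"
      using eventually_gt_at_top[of s]
    proof eventually_elim
      case (elim N)
      have "?a s N = (\<Sum>n\<le>s. ?t n s)"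
        using elim by (intro sum.mono_neutral_right) auto
      also have "\<dots> = ?b s" by (simp add: bconv_def sum_distrib_left mult_ac)
      finally show ?case .
    qed
  qed
  have bound: "cmod (?a s N) \<le> ?M s" for s N
  proof -
    have "cmod (?a s N) \<le> (\<Sum>n<N. cmod (?t n s))" by (rule norm_sum)
    also have "\<dots> = (\<Sum>n\<in>{..<N} \<inter> {..s}. cmod (?t n s))"
      by (intro sum.mono_neutral_right) (auto simp: not_le)
    also have "\<dots> \<le> ?M s" unfolding Meq by (rule sum_mono2) auto
    finally show ?thesis .
  qed
  have T: "summable (\<lambda>s. norm (?b s))" "(\<lambda>N. \<Sum>s. ?a s N) \<longlonglongrightarrow> (\<Sum>s. ?b s)"
    using tannerys_theorem[where F = sequentially and a = ?a and b = ?b and M = ?M, OF lim _ sM] bound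
    by (auto intro: always_eventually)
  show "summable (\<lambda>s. cmod (?b s))" by (rule T(1))
  have "(\<Sum>s. ?a s N) = (\<Sum>n<N. cnj (coord d n) * bcorr \<kappa> (coord y) (coord \<sigma>) n)" for N
  proof -
    have "(\<Sum>s. ?a s N) = (\<Sum>n<N. \<Sum>s. ?t n s)"
      by (rule suminf_sum) (rule summable_mult, rule summable_corr_term')
    also have "\<dots> = (\<Sum>n<N. cnj (coord d n) * bcorr \<kappa> (coord y) (coord \<sigma>) n)"
      unfolding bcorr_def by (intro sum.cong refl suminf_mult summable_corr_term')
    finally show ?thesis .
  qed
  then show "(\<lambda>n. cnj (coord d n) * bcorr \<kappa> (coord y) (coord \<sigma>) n) sums (\<Sum>s. ?b s)"
    using T(2) unfolding sums_def by simp
qed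

end

section \<open>Squared norms of the monomials\<close>

text \<open>\<open>pi * n! * fock_weight k n\<close> is the squared norm of \<open>z ^ n * exp (- \<bar>z\<bar>\<^sup>2 / 2)\<close> with the weight
  \<open>(1 + \<bar>z\<bar>\<^sup>2) ^ k\<close>; the recursion splits off one factor \<open>1 + \<bar>z\<bar>\<^sup>2\<close>
  (see \<open>weighted_gaussian_moment\<close>).\<close>
fun fock_weight :: "nat \<Rightarrow> nat \<Rightarrow> real" where
  "fock_weight 0 n = 1"
| "fock_weight (Suc k) n = fock_weight k n + (real n + 1) * fock_weight k (Suc n)"

lemma fock_weight_ge: "(real n + 1) ^ k \<le> fock_weight k n"
proof (induction k arbitrary: n)
  case (Suc k)
  have "(real n + 1) ^ k \<le> (real (Suc n) + 1) ^ k" by (rule power_mono) auto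
  also have "\<dots> \<le> fock_weight k (Suc n)" by (rule Suc)
  finally have "(real n + 1) * (real n + 1) ^ k \<le> (real n + 1) * fock_weight k (Suc n)"
    by (intro mult_left_mono) auto
  moreover have "0 \<le> fock_weight k n" using Suc[of n] by (meson order_trans zero_le_power of_nat_0_le_iff add_nonneg_nonneg zero_le_one)
  ultimately show ?case unfolding fock_weight.simps power_Suc by linarith
qed simp

lemma fock_weight_ge_1: "1 \<le> fock_weight k n"
  using fock_weight_ge[of n k] one_le_power[of "real n + 1" k] by linarith

lemma fock_weight_pos [simp]: "0 < fock_weight k n"
  using fock_weight_ge_1[of k n] by linarith

lemma fock_weight_nonneg [simp]: "0 \<le> fock_weight k n"
  using fock_weight_pos[of k n] by linarith

lemma fock_weight_neq_0 [simp]: "fock_weight k n \<noteq> 0"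
  using fock_weight_pos[of k n] by linarith

lemma fock_weight_mono: "n \<le> m \<Longrightarrow> fock_weight k n \<le> fock_weight k m"
proof (induction k arbitrary: n m)
  case (Suc k)
  then show ?case by (auto intro!: add_mono mult_mono)
qed simp

lemma fock_weight_Suc_ge: "fock_weight k n \<le> fock_weight (Suc k) n"
  by simp

lemma fock_weight_mono_exponent: "j \<le> k \<Longrightarrow> fock_weight j n \<le> fock_weight k n"
  by (rule lift_Suc_mono_le[of "\<lambda>k. fock_weight k n", OF fock_weight_Suc_ge])

lemma fock_weight_le: "fock_weight k n \<le> 3 ^ (k * k) * (real n + 1) ^ k"
proof (induction k arbitrary: n)
  case (Suc k)
  let ?C = "3 ^ (k * k) :: real" and ?x = "real n + 1"
  have x: "?x \<ge> 1" by simp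
  have "fock_weight k (Suc n) \<le> ?C * (real (Suc n) + 1) ^ k" by (rule Suc)
  also have "\<dots> \<le> ?C * (2 * ?x) ^ k" by (intro mult_left_mono power_mono) auto
  also have "\<dots> = ?C * 2 ^ k * ?x ^ k" by (simp only: power_mult_distrib mult.assoc)
  finally have 1: "fock_weight k (Suc n) \<le> ?C * 2 ^ k * ?x ^ k" .
  have "fock_weight (Suc k) n \<le> ?C * ?x ^ k + ?x * (?C * 2 ^ k * ?x ^ k)"
    using Suc[of n] 1 by (auto intro!: add_mono mult_left_mono)
  also have "\<dots> \<le> ?C * 2 ^ k * ?x ^ Suc k + ?x * (?C * 2 ^ k * ?x ^ k)"
  proof (rule add_right_mono)
    have "?x ^ k \<le> ?x ^ Suc k" using x by (intro power_increasing) auto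
    moreover have "(1 :: real) \<le> 2 ^ k" by simp
    ultimately have "1 * ?x ^ k \<le> 2 ^ k * ?x ^ Suc k" by (intro mult_mono) auto
    then show "?C * ?x ^ k \<le> ?C * 2 ^ k * ?x ^ Suc k" by simp
  qed
  also have "\<dots> = ?C * (2 * 2 ^ k) * ?x ^ Suc k" by simp
  also have "\<dots> \<le> ?C * (3 * 3 ^ (2 * k)) * ?x ^ Suc k"
  proof -
    have "(2::real) ^ k \<le> 3 ^ k" by (rule power_mono) auto
    also have "\<dots> \<le> 3 ^ (2 * k)" by (rule power_increasing) auto
    finally show ?thesis by (intro mult_mono mult_left_mono) auto
  qed
  also have "\<dots> = 3 ^ (Suc k * Suc k) * ?x ^ Suc k"
  proof -
    have "Suc k * Suc k = k * k + Suc (2 * k)" by simp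
    then show ?thesis by (simp only: power_add power_Suc mult_ac)
  qed
  finally show ?case .
qed simp

lemma fock_weight_add_le: "fock_weight k (i + j) \<le> 3 ^ (k * k) * (fock_weight k i * fock_weight k j)"
proof -
  have "(real (i + j) + 1) ^ k \<le> ((real i + 1) * (real j + 1)) ^ k"
    by (rule power_mono) (auto simp: algebra_simps)
  also have "\<dots> \<le> fock_weight k i * fock_weight k j"
    unfolding power_mult_distrib by (intro mult_mono fock_weight_ge) auto
  finally have "3 ^ (k * k) * (real (i + j) + 1) ^ k \<le> 3 ^ (k * k) * (fock_weight k i * fock_weight k j)"
    by simp
  then show ?thesis using fock_weight_le[of k "i + j"] by linarith
qed

lemma fock_weight_poly: "\<exists>p :: real poly. degree p \<le> k \<and> (\<forall>n. fock_weight k n = poly p (real n))"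
proof (induction k)
  case 0 show ?case by (rule exI[of _ "[:1:]"]) simp
next
  case (Suc k)
  then obtain p :: "real poly" where p: "degree p \<le> k" "\<forall>n. fock_weight k n = poly p (real n)" by blast
  let ?q = "p + [:1, 1:] * pcompose p [:1, 1:]"
  have "degree ([:1, 1:] * pcompose p [:1, 1:]) \<le> 1 + degree (pcompose p [:1, 1:] :: real poly)"
    by (rule order_trans[OF degree_mult_le]) simp
  then have "degree ?q \<le> Suc k" using p(1) by (intro degree_add_le) (auto simp: degree_pcompose)
  moreover have "fock_weight (Suc k) n = poly ?q (real n)" for n
    using p(2) by (simp add: poly_pcompose algebra_simps)
  ultimately show ?case by blast
qed

text \<open>The power sums satisfy the recursion \<open>p (q + 2) = s * p (q + 1) - i * j * p q\<close> with \<open>s = i + j\<close> and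
  \<open>4 * i * j = s\<^sup>2 - (i - j)\<^sup>2\<close>. Dropping the last square in this recursion produces the function \<open>g\<close>
  of \<open>s\<close>, and what is dropped is of second order in \<open>i - j\<close>.\<close>
lemma power_sum_radial_part:
  "\<exists>g C. C \<ge> 0 \<and> (\<forall>i j :: nat. \<bar>real i ^ p + real j ^ p - g (i + j)\<bar>
      \<le> (if p < 2 then 0 else C * (real (i + j) + 1) ^ (p - 2) * (real i - real j)\<^sup>2))"
proof (induction p rule: less_induct)
  case (less p)
  consider "p = 0" | "p = 1" | q where "p = q + 2"
    by (metis One_nat_def add_2_eq_Suc' not0_implies_Suc)
  then show ?case
  proof cases
    case 1 then show ?thesis by (intro exI[of _ "\<lambda>_. 2"] exI[of _ 0]) simp
  next
    case 2 then show ?thesis by (intro exI[of _ real] exI[of _ 0]) simp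
  next
    case 3
    obtain g C where g: "C \<ge> 0" "\<And>i j :: nat. \<bar>real i ^ q + real j ^ q - g (i + j)\<bar>
      \<le> (if q < 2 then 0 else C * (real (i + j) + 1) ^ (q - 2) * (real i - real j)\<^sup>2)"
      using less[of q] 3 by auto
    obtain h D where h: "D \<ge> 0" "\<And>i j :: nat. \<bar>real i ^ (q + 1) + real j ^ (q + 1) - h (i + j)\<bar>
      \<le> (if q + 1 < 2 then 0 else D * (real (i + j) + 1) ^ (q + 1 - 2) * (real i - real j)\<^sup>2)"
      using less[of "q + 1"] 3 by auto
    \<comment> \<open>the recursion of the power sums with \<open>i * j\<close> replaced by \<open>s\<^sup>2 / 4\<close>\<close>
    define f :: "nat \<Rightarrow> real" where "f s = real s * h s - (real s)\<^sup>2 / 4 * g s" for s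
    have "\<bar>real i ^ p + real j ^ p - f (i + j)\<bar> \<le> (C + D + 1) * (real (i + j) + 1) ^ q * (real i - real j)\<^sup>2" for i j :: nat
    proof -
      define s where "s = real i + real j"
      define x2 where "x2 = (real i - real j)\<^sup>2"
      have s0: "s \<ge> 0" and x0: "x2 \<ge> 0" by (simp_all add: s_def x2_def)
      have sp: "(s + 1) ^ q \<ge> 0" using s0 by simp
      have id: "real i ^ p + real j ^ p - f (i + j) = s * (real i ^ (q + 1) + real j ^ (q + 1) - h (i + j))
         - s\<^sup>2 / 4 * (real i ^ q + real j ^ q - g (i + j)) + x2 / 4 * (real i ^ q + real j ^ q)"
        unfolding f_def s_def x2_def 3 by (simp add: power2_eq_square field_simps power_add)
      have 1: "\<bar>s * (real i ^ (q + 1) + real j ^ (q + 1) - h (i + j))\<bar> \<le> D * (s + 1) ^ q * x2"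
      proof (cases "q = 0")
        case True
        then have "real i ^ (q + 1) + real j ^ (q + 1) - h (i + j) = 0" using h(2)[of i j] by simp
        then show ?thesis using h(1) sp x0 by simp
      next
        case False
        then obtain r where r: "q = Suc r" by (cases q) auto
        have "\<bar>s * (real i ^ (q + 1) + real j ^ (q + 1) - h (i + j))\<bar> \<le> s * (D * (s + 1) ^ r * x2)"
          unfolding abs_mult using h(2)[of i j] s0 r by (intro mult_mono) (auto simp: s_def x2_def)
        also have "\<dots> \<le> (s + 1) * (D * (s + 1) ^ r * x2)"
          using h(1) s0 x0 by (intro mult_right_mono) auto
        finally show ?thesis using r by (simp add: mult_ac)
      qed
      have 2: "\<bar>s\<^sup>2 / 4 * (real i ^ q + real j ^ q - g (i + j))\<bar> \<le> C * (s + 1) ^ q * x2"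
      proof (cases "q < 2")
        case True
        then have "real i ^ q + real j ^ q - g (i + j) = 0" using g(2)[of i j] by simp
        then show ?thesis using g(1) sp x0 by simp
      next
        case False
        then obtain r where r: "q = r + 2" by (metis add.commute le_Suc_ex not_less)
        have "\<bar>s\<^sup>2 / 4 * (real i ^ q + real j ^ q - g (i + j))\<bar> \<le> s\<^sup>2 / 4 * (C * (s + 1) ^ r * x2)"
          unfolding abs_mult using g(2)[of i j] s0 r by (intro mult_mono) (auto simp: s_def x2_def)
        also have "\<dots> \<le> (s + 1)\<^sup>2 * (C * (s + 1) ^ r * x2)"
          using g(1) s0 x0 by (intro mult_right_mono) (auto simp: power2_eq_square algebra_simps)
        finally show ?thesis using r by (simp add: mult_ac power_add power2_eq_square)
      qed
      have "real i ^ q \<le> (s + 1) ^ q" "real j ^ q \<le> (s + 1) ^ q"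
        by (intro power_mono; simp add: s_def)+
      then have "\<bar>x2 / 4 * (real i ^ q + real j ^ q)\<bar> \<le> x2 / 4 * (4 * (s + 1) ^ q)"
        unfolding abs_mult using x0 sp by (intro mult_mono) (auto simp: abs_le_iff)
      then have 3: "\<bar>x2 / 4 * (real i ^ q + real j ^ q)\<bar> \<le> (s + 1) ^ q * x2" by (simp add: mult_ac)
      have "\<bar>real i ^ p + real j ^ p - f (i + j)\<bar> \<le> D * (s + 1) ^ q * x2 + C * (s + 1) ^ q * x2 + (s + 1) ^ q * x2"
        unfolding id using 1 2 3 by linarith
      then show ?thesis by (simp add: s_def x2_def algebra_simps)
    qed
    then show ?thesis using 3 g(1) h(1) by (intro exI[of _ f] exI[of _ "C + D + 1"]) auto
  qed
qed

text \<open>The cancellation behind all growth bounds: up to a function of \<open>i + j\<close>, which does not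
  contribute to the evolution of the energies, \<open>fock_weight k i + fock_weight k j\<close> is of second order
  in \<open>i - j\<close>, and vanishes for \<open>k < 2\<close>.\<close>
lemma fock_weight_radial_part:
  "\<exists>g C. C \<ge> 0 \<and> (\<forall>i j :: nat. \<bar>fock_weight k i + fock_weight k j - g (i + j)\<bar>
      \<le> (if k < 2 then 0 else C * (real (i + j) + 1) ^ (k - 2) * (real i - real j)\<^sup>2))"
proof -
  obtain p :: "real poly" where p: "degree p \<le> k" "\<And>n. fock_weight k n = poly p (real n)"
    using fock_weight_poly by blast
  have pe: "poly p x = (\<Sum>q\<le>k. coeff p q * x ^ q)" for x
    unfolding poly_altdef using p(1) by (intro sum.mono_neutral_left) (auto simp: coeff_eq_0)
  obtain g C where g: "\<And>q. C q \<ge> 0" "\<And>q i j. \<bar>real i ^ q + real j ^ q - g q (i + j)\<bar>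
      \<le> (if q < 2 then 0 else C q * (real (i + j) + 1) ^ (q - 2) * (real i - real j)\<^sup>2)"
    using power_sum_radial_part by metis
  define f where "f s = (\<Sum>q\<le>k. coeff p q * g q s)" for s
  define D where "D = (\<Sum>q\<le>k. \<bar>coeff p q\<bar> * C q)"
  have "\<bar>fock_weight k i + fock_weight k j - f (i + j)\<bar>
      \<le> (if k < 2 then 0 else D * (real (i + j) + 1) ^ (k - 2) * (real i - real j)\<^sup>2)" for i j
  proof -
    have "fock_weight k i + fock_weight k j - f (i + j)
        = (\<Sum>q\<le>k. coeff p q * (real i ^ q + real j ^ q - g q (i + j)))"
      unfolding p(2) pe f_def by (simp add: sum.distrib[symmetric] sum_subtractf[symmetric] algebra_simps)
    also have "\<bar>\<dots>\<bar> \<le> (\<Sum>q\<le>k. \<bar>coeff p q\<bar> * \<bar>real i ^ q + real j ^ q - g q (i + j)\<bar>)"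
      unfolding abs_mult[symmetric] by (rule sum_abs)
    also have "\<dots> \<le> (\<Sum>q\<le>k. \<bar>coeff p q\<bar> *
        (if k < 2 then 0 else C q * (real (i + j) + 1) ^ (k - 2) * (real i - real j)\<^sup>2))"
    proof (intro sum_mono mult_left_mono)
      fix q assume q: "q \<in> {..k}"
      have "(real (i + j) + 1) ^ (q - 2) \<le> (real (i + j) + 1) ^ (k - 2)"
        using q by (intro power_increasing) auto
      then have "C q * (real (i + j) + 1) ^ (q - 2) * (real i - real j)\<^sup>2
           \<le> C q * (real (i + j) + 1) ^ (k - 2) * (real i - real j)\<^sup>2"
        using g(1) by (intro mult_right_mono mult_left_mono) auto
      moreover have "0 \<le> C q * (real (i + j) + 1) ^ (k - 2) * (real i - real j)\<^sup>2"
        using g(1) by simp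
      ultimately show "\<bar>real i ^ q + real j ^ q - g q (i + j)\<bar>
        \<le> (if k < 2 then 0 else C q * (real (i + j) + 1) ^ (k - 2) * (real i - real j)\<^sup>2)"
        using g(2)[of i q j] q by (auto split: if_splits)
    qed auto
    also have "\<dots> = (if k < 2 then 0 else D * (real (i + j) + 1) ^ (k - 2) * (real i - real j)\<^sup>2)"
      by (simp add: D_def sum_distrib_right sum_distrib_left mult_ac)
    finally show ?thesis .
  qed
  moreover have "D \<ge> 0" unfolding D_def using g(1) by (intro sum_nonneg) auto
  ultimately show ?thesis by blast
qed

lemma power_add_le_two_power:
  "(real (n + m) + 1) ^ p \<le> 2 ^ p * ((real n + 1) ^ p + (real m + 1) ^ p)"
proof -
  have "(real (n + m) + 1) ^ p \<le> (2 * max (real n + 1) (real m + 1)) ^ p"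
    by (rule power_mono) (auto simp: max_def)
  also have "\<dots> = 2 ^ p * max (real n + 1) (real m + 1) ^ p" by (simp add: power_mult_distrib)
  also have "\<dots> \<le> 2 ^ p * ((real n + 1) ^ p + (real m + 1) ^ p)"
    by (intro mult_left_mono) (auto simp: max_def)
  finally show ?thesis .
qed

section \<open>The equation in coefficients and the evolution of its energies\<close>

text \<open>The kernels that express \<open>bconv\<close> and \<open>bcorr\<close> in the coordinates
  \<open>sqrt (fock_weight k n) * c n\<close>, in which the norm of \<open>weighted_fock k\<close> is the norm of \<open>ell2\<close>.\<close>
definition S_kernel :: "nat \<Rightarrow> nat \<Rightarrow> nat \<Rightarrow> real" where
  "S_kernel k i j = sqrt (fock_weight k (i + j) / (fock_weight k i * fock_weight k j))"

definition R_kernel :: "nat \<Rightarrow> nat \<Rightarrow> nat \<Rightarrow> real" where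
  "R_kernel k n m = sqrt (fock_weight k n / (fock_weight k m * fock_weight k (n + m))) / (2 * pi)"

interpretation S: bounded_kernel "S_kernel k" "sqrt (3 ^ (k * k))" for k
proof
  fix i j
  have "fock_weight k (i + j) / (fock_weight k i * fock_weight k j) \<le> 3 ^ (k * k)"
    using fock_weight_add_le[of k i j] by (simp add: pos_divide_le_eq)
  then show "\<bar>S_kernel k i j\<bar> \<le> sqrt (3 ^ (k * k))"
    unfolding S_kernel_def by simp
qed

interpretation R: bounded_kernel "R_kernel k" 1 for k
proof
  fix n m
  have "fock_weight k n \<le> 1 * fock_weight k (n + m)" by (simp add: fock_weight_mono)
  also have "\<dots> \<le> fock_weight k m * fock_weight k (n + m)"
    by (intro mult_right_mono fock_weight_ge_1) simp
  finally have "sqrt (fock_weight k n / (fock_weight k m * fock_weight k (n + m))) \<le> 1"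
    by simp
  moreover have "1 \<le> 2 * pi" using pi_gt3 by linarith
  ultimately have "sqrt (fock_weight k n / (fock_weight k m * fock_weight k (n + m))) / (2 * pi) \<le> 1 / 1"
    by (intro frac_le) auto
  then show "\<bar>R_kernel k n m\<bar> \<le> 1"
    unfolding R_kernel_def by simp
qed

lift_definition mult_neg_i :: "ell2 \<Rightarrow> ell2" is "\<lambda>c n. - \<i> * c n"
  by (simp add: norm_mult)

lemma coord_mult_neg_i [simp]: "coord (mult_neg_i x) n = - \<i> * coord x n"
  by transfer simp

lemma norm_mult_neg_i [simp]: "norm (mult_neg_i x) = norm x"
proof -
  have "(norm (mult_neg_i x))\<^sup>2 = (norm x)\<^sup>2" unfolding norm_ell2_sq by (simp add: norm_mult)
  then show ?thesis by simp
qed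

lemma bounded_linear_mult_neg_i: "bounded_linear mult_neg_i"
  by standard (auto intro!: ell2_eqI exI[of _ 1] simp: algebra_simps)

definition lll_field :: "nat \<Rightarrow> ell2 \<Rightarrow> ell2" where
  "lll_field k x = mult_neg_i (R.Bcorr k x (S.Bconv k x x))"

definition fock_coeff :: "nat \<Rightarrow> ell2 \<Rightarrow> nat \<Rightarrow> complex" where
  "fock_coeff k x n = coord x n / of_real (sqrt (fock_weight k n))"

abbreviation "bsquare \<equiv> bconv (\<lambda>_ _. 1)"

lemma coord_S: "coord (S.Bconv k x y) s = of_real (sqrt (fock_weight k s)) * bsquare (fock_coeff k x) (fock_coeff k y) s"
  unfolding S.coord_Bconv bconv_def sum_distrib_left
proof (rule sum.cong)
  fix n assume "n \<in> {..s}"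
  then show "of_real (S_kernel k n (s - n) * sqrt (binw s n)) * (coord x n * coord y (s - n)) =
      of_real (sqrt (fock_weight k s)) *
         (of_real (1 * sqrt (binw s n)) * (fock_coeff k x n * fock_coeff k y (s - n)))"
    by (simp add: S_kernel_def fock_coeff_def real_sqrt_divide real_sqrt_mult)
qed simp

definition energy_op :: "nat \<Rightarrow> nat \<Rightarrow> ell2 \<Rightarrow> ell2" where
  "energy_op j k x = Ell2 (\<lambda>n. of_real (fock_weight j n / fock_weight k n) * coord x n)"

text \<open>The squared norm with weight of order \<open>j\<close>, for an element that is given by its coordinates in the space of order
  \<open>k\<close>.\<close>
definition energy :: "nat \<Rightarrow> nat \<Rightarrow> ell2 \<Rightarrow> real" where
  "energy j k x = inner (energy_op j k x) x"

lemma energy_ratio_le: "j \<le> k \<Longrightarrow> fock_weight j n / fock_weight k n \<le> 1"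
  using fock_weight_mono_exponent[of j k n] by simp

lemma energy_op_bounded_sums:
  assumes "j \<le> k"
  shows "(\<Sum>n<N. (cmod (of_real (fock_weight j n / fock_weight k n) * coord x n))\<^sup>2) \<le> (norm x)\<^sup>2"
proof -
  have "(\<Sum>n<N. (cmod (of_real (fock_weight j n / fock_weight k n) * coord x n))\<^sup>2) \<le> (\<Sum>n<N. (cmod (coord x n))\<^sup>2)"
  proof (intro sum_mono power_mono)
    fix n
    have "cmod (of_real (fock_weight j n / fock_weight k n) * coord x n) = fock_weight j n / fock_weight k n * cmod (coord x n)"
      by (simp add: norm_mult norm_divide)
    also have "\<dots> \<le> cmod (coord x n)"
      using energy_ratio_le[OF assms, of n] by (intro mult_left_le_one_le) auto
    finally show "cmod (of_real (fock_weight j n / fock_weight k n) * coord x n) \<le> cmod (coord x n)" .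
  qed simp
  also have "\<dots> \<le> (norm x)\<^sup>2" by (rule sum_coord_le_norm) simp
  finally show ?thesis .
qed

lemma coord_energy_op: "j \<le> k \<Longrightarrow> coord (energy_op j k x) n = of_real (fock_weight j n / fock_weight k n) * coord x n"
  unfolding energy_op_def using coord_Ell2[OF bounded_sums_ell2(1)[OF energy_op_bounded_sums]] by simp

lemma norm_energy_op_le: "j \<le> k \<Longrightarrow> norm (energy_op j k x) \<le> norm x"
  unfolding energy_op_def by (rule bounded_sums_ell2(2)[OF energy_op_bounded_sums]) auto

lemma bounded_linear_energy_op: "j \<le> k \<Longrightarrow> bounded_linear (energy_op j k)"
  by standard (auto intro!: ell2_eqI exI[of _ 1] simp: coord_energy_op norm_energy_op_le algebra_simps add_divide_distrib)

lemma energy_op_symmetric: "j \<le> k \<Longrightarrow> inner (energy_op j k x) y = inner x (energy_op j k y)"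
  unfolding inner_ell2_def by (rule suminf_cong) (simp add: coord_energy_op algebra_simps)

lemma energy_sums:
  assumes "j \<le> k"
  shows "(\<lambda>n. fock_weight j n * (cmod (fock_coeff k x n))\<^sup>2) sums energy j k x"
proof -
  have "Re (coord (energy_op j k x) n * cnj (coord x n)) = fock_weight j n * (cmod (fock_coeff k x n))\<^sup>2" for n
  proof -
    have "coord (energy_op j k x) n * cnj (coord x n)
        = of_real (fock_weight j n / fock_weight k n) * (coord x n * cnj (coord x n))"
      by (simp add: coord_energy_op[OF assms])
    also have "\<dots> = of_real (fock_weight j n / fock_weight k n * (cmod (coord x n))\<^sup>2)"
      by (simp only: of_real_mult complex_norm_square)
    finally show ?thesis by (simp add: fock_coeff_def norm_divide power_divide)
  qed
  then show ?thesis
    using summable_sums[OF summable_coord_prod[of "energy_op j k x" x]]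
    by (simp add: energy_def inner_ell2_def)
qed

lemma energy_nonneg: "j \<le> k \<Longrightarrow> 0 \<le> energy j k x"
  using sums_le[OF _ sums_zero energy_sums[of j k x]] by simp

lemma energy_mono: "i \<le> j \<Longrightarrow> j \<le> k \<Longrightarrow> energy i k x \<le> energy j k x"
  by (rule sums_le[OF _ energy_sums energy_sums]) (auto intro!: mult_right_mono fock_weight_mono_exponent)

lemma energy_op_same: "energy_op k k x = x"
  by (rule ell2_eqI) (simp add: coord_energy_op)

lemma energy_same: "energy k k x = (norm x)\<^sup>2"
  by (simp add: energy_def energy_op_same power2_norm_eq_inner)

lemma bconv_symmetrize: "bconv (\<lambda>i j. w i + w j) c c s = 2 * bconv (\<lambda>i j. w i) c c s"
proof -
  have "bconv (\<lambda>i j. w j) c c s = bconv (\<lambda>i j. w i) c c s"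
    unfolding bconv_def
    by (rule sum.reindex_bij_witness[of _ "\<lambda>n. s - n" "\<lambda>n. s - n"]) (auto simp: binw_symmetric mult_ac)
  then show ?thesis unfolding bconv_def by (simp add: algebra_simps sum.distrib)
qed

lemma bconv_minus_radial:
  "bconv (\<lambda>i j. w i j - g (i + j)) c c s = bconv w c c s - of_real (g s) * bsquare c c s"
  unfolding bconv_def by (simp add: sum_distrib_left algebra_simps sum_subtractf)

text \<open>The time derivative of the energy, up to the factor 2. By duality it is the imaginary part of a
  sum of products of two convolutions, one of them with the multiplier \<open>fock_weight j i\<close>. This multiplier may be
  symmetrized in its two indices, since both convolution factors are \<open>c\<close>. After that a function \<open>g\<close> of
  the sum of the indices may be subtracted, since it only changes a real quantity.\<close>
lemma energy_rate:
  fixes x :: ell2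
  assumes "j \<le> k"
  defines "c \<equiv> fock_coeff k x"
  shows "summable (\<lambda>s. Im (bsquare c c s * cnj (bconv (\<lambda>i m. fock_weight j i + fock_weight j m - g (i + m)) c c s)))"
    "inner (energy_op j k x) (lll_field k x)
      = (\<Sum>s. Im (bsquare c c s * cnj (bconv (\<lambda>i m. fock_weight j i + fock_weight j m - g (i + m)) c c s))) / (4 * pi)"
proof -
  let ?A = "energy_op j k x" and ?\<sigma> = "S.Bconv k x x"
  let ?D = "\<lambda>s. bconv (\<lambda>i m. fock_weight j i + fock_weight j m - g (i + m)) c c s"
  have R: "bconv (R_kernel k) (coord ?A) (coord x) s
      = of_real (1 / (2 * pi * sqrt (fock_weight k s))) * bconv (\<lambda>i m. fock_weight j i) c c s" for s
    unfolding bconv_def sum_distrib_left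
  proof (rule sum.cong)
    fix n assume n: "n \<in> {..s}"
    have sq: "complex_of_real (fock_weight k n) = of_real (sqrt (fock_weight k n)) * of_real (sqrt (fock_weight k n))"
      by (simp flip: of_real_mult)
    show "of_real (R_kernel k n (s - n) * sqrt (binw s n)) * (coord ?A n * coord x (s - n)) =
        of_real (1 / (2 * pi * sqrt (fock_weight k s))) *
         (of_real (fock_weight j n * sqrt (binw s n)) * (c n * c (s - n)))"
      using n by (simp add: R_kernel_def coord_energy_op[OF assms(1)] c_def fock_coeff_def real_sqrt_divide real_sqrt_mult sq mult_ac)
  qed simp
  have term_eq: "Im (coord ?\<sigma> s * cnj (bconv (R_kernel k) (coord ?A) (coord x) s))
      = Im (bsquare c c s * cnj (?D s)) / (4 * pi)" for s
  proof -
    have "coord ?\<sigma> s * cnj (bconv (R_kernel k) (coord ?A) (coord x) s)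
       = of_real (1 / (2 * pi)) * (bsquare c c s * cnj (bconv (\<lambda>i m. fock_weight j i) c c s))"
      unfolding R coord_S c_def[symmetric] by simp
    also have "\<dots> = of_real (1 / (4 * pi)) * (bsquare c c s * cnj (bconv (\<lambda>i m. fock_weight j i + fock_weight j m) c c s))"
      unfolding bconv_symmetrize by simp
    also have "bconv (\<lambda>i m. fock_weight j i + fock_weight j m) c c s = ?D s + of_real (g s) * bsquare c c s"
      using bconv_minus_radial[of "\<lambda>i m. fock_weight j i + fock_weight j m" g c s] by simp
    finally have "coord ?\<sigma> s * cnj (bconv (R_kernel k) (coord ?A) (coord x) s)
      = of_real (1 / (4 * pi)) * (bsquare c c s * cnj (?D s) + of_real (g s) * (bsquare c c s * cnj (bsquare c c s)))"
      by (simp add: algebra_simps)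
    also have "bsquare c c s * cnj (bsquare c c s) = of_real ((cmod (bsquare c c s))\<^sup>2)"
      by (simp only: complex_norm_square)
    finally show ?thesis by simp
  qed
  note dual = R.bconv_bcorr_duality[where \<sigma> = ?\<sigma> and k = k and d = ?A and y = x]
  have sum: "summable (\<lambda>s. coord ?\<sigma> s * cnj (bconv (R_kernel k) (coord ?A) (coord x) s))"
    by (rule summable_norm_cancel[OF dual(1)])
  have "summable (\<lambda>s. Im (coord ?\<sigma> s * cnj (bconv (R_kernel k) (coord ?A) (coord x) s)))"
    by (rule summable_Im[OF sum])
  then have "summable (\<lambda>s. 4 * pi * (Im (bsquare c c s * cnj (?D s)) / (4 * pi)))"
    unfolding term_eq by (rule summable_mult)
  then show sD: "summable (\<lambda>s. Im (bsquare c c s * cnj (?D s)))"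
    by (simp only: nonzero_mult_div_cancel_left times_divide_eq_right mult_eq_0_iff pi_neq_zero
        zero_neq_numeral[symmetric] simp_thms not_False_eq_True)
  have "Re (coord ?A n * cnj (coord (lll_field k x) n))
      = Im (cnj (coord ?A n) * bcorr (R_kernel k) (coord x) (coord ?\<sigma>) n)" for n
    unfolding lll_field_def by (simp add: R.coord_Bcorr algebra_simps)
  then have "inner ?A (lll_field k x) = (\<Sum>n. Im (cnj (coord ?A n) * bcorr (R_kernel k) (coord x) (coord ?\<sigma>) n))"
    unfolding inner_ell2_def by simp
  also have "\<dots> = Im (\<Sum>s. coord ?\<sigma> s * cnj (bconv (R_kernel k) (coord ?A) (coord x) s))"
    by (rule sums_unique[symmetric]) (rule bounded_linear.sums[OF bounded_linear_Im dual(2)])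
  also have "\<dots> = (\<Sum>s. Im (coord ?\<sigma> s * cnj (bconv (R_kernel k) (coord ?A) (coord x) s)))"
    by (rule bounded_linear.suminf[OF bounded_linear_Im sum])
  also have "\<dots> = (\<Sum>s. Im (bsquare c c s * cnj (?D s))) / (4 * pi)"
    unfolding term_eq by (rule suminf_divide[OF sD])
  finally show "inner ?A (lll_field k x) = (\<Sum>s. Im (bsquare c c s * cnj (?D s))) / (4 * pi)" .
qed

lemma energy_rate_le:
  fixes x :: ell2
  assumes "j \<le> k"
  defines "c \<equiv> fock_coeff k x"
  assumes b: "\<And>s. cmod (bsquare c c s) * cmod (bconv (\<lambda>i m. fock_weight j i + fock_weight j m - g (i + m)) c c s) \<le> b s"
    and B: "b sums B"
  shows "\<bar>inner (energy_op j k x) (lll_field k x)\<bar> \<le> B"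
proof -
  let ?t = "\<lambda>s. Im (bsquare c c s * cnj (bconv (\<lambda>i m. fock_weight j i + fock_weight j m - g (i + m)) c c s))"
  have tb: "\<bar>?t s\<bar> \<le> b s" for s
    by (rule order_trans[OF abs_Im_le_cmod]) (use b[of s] in \<open>simp add: norm_mult\<close>)
  have st: "summable (\<lambda>s. \<bar>?t s\<bar>)"
    by (rule summable_comparison_test'[OF sums_summable[OF B], of 0]) (use tb in auto)
  have "\<bar>\<Sum>s. ?t s\<bar> \<le> (\<Sum>s. \<bar>?t s\<bar>)" by (rule summable_rabs[OF st])
  also have "\<dots> \<le> (\<Sum>s. b s)" by (rule suminf_le[OF tb st sums_summable[OF B]])
  finally have "\<bar>\<Sum>s. ?t s\<bar> \<le> (\<Sum>s. b s)" .
  then have "\<bar>\<Sum>s. ?t s\<bar> \<le> B" using sums_unique[OF B] by simp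
  moreover have "\<bar>(\<Sum>s. ?t s) / (4 * pi)\<bar> \<le> \<bar>\<Sum>s. ?t s\<bar> / 1"
    unfolding abs_divide using pi_gt3 by (intro frac_le) auto
  ultimately show ?thesis
    unfolding energy_rate(2)[OF assms(1), of x g, folded c_def] by linarith
qed

text \<open>Conservation of mass (\<open>j = 0\<close>) and of angular momentum (\<open>j = 1\<close>).\<close>
lemma energy_conserved:
  assumes "j \<le> k" "j < 2"
  shows "inner (energy_op j k x) (lll_field k x) = 0"
proof -
  obtain g C where g: "\<And>i m. \<bar>fock_weight j i + fock_weight j m - g (i + m)\<bar>
      \<le> (if j < 2 then 0 else C * (real (i + m) + 1) ^ (j - 2) * (real i - real m)\<^sup>2)"
    using fock_weight_radial_part[of j] by blast
  have "(\<lambda>i m. fock_weight j i + fock_weight j m - g (i + m)) = (\<lambda>i m. 0)"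
    using g assms(2) by (intro ext) auto
  then have "\<bar>inner (energy_op j k x) (lll_field k x)\<bar> \<le> 0"
    by (intro energy_rate_le[OF assms(1), where g = g and b = "\<lambda>_. 0"]) (auto simp: bconv_def)
  then show ?thesis by simp
qed

lemma cauchy_energy_sums:
  fixes x :: ell2
  assumes "i \<le> k" "j \<le> k"
  defines "c \<equiv> fock_coeff k x"
  shows "(\<lambda>s. \<Sum>n\<le>s. fock_weight i n * (cmod (c n))\<^sup>2 * (fock_weight j (s - n) * (cmod (c (s - n)))\<^sup>2)
       + fock_weight j n * (cmod (c n))\<^sup>2 * (fock_weight i (s - n) * (cmod (c (s - n)))\<^sup>2))
     sums (2 * (energy i k x * energy j k x))"
proof -
  note e = energy_sums[OF assms(1), of x, folded c_def] energy_sums[OF assms(2), of x, folded c_def]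
  note p = cauchy_product_nonneg[OF sums_summable[OF e(1)] sums_summable[OF e(2)], folded sums_unique[OF e(1)] sums_unique[OF e(2)]]
  note q = cauchy_product_nonneg[OF sums_summable[OF e(2)] sums_summable[OF e(1)], folded sums_unique[OF e(1)] sums_unique[OF e(2)]]
  have "(\<lambda>s. (\<Sum>n\<le>s. fock_weight i n * (cmod (c n))\<^sup>2 * (fock_weight j (s - n) * (cmod (c (s - n)))\<^sup>2))
       + (\<Sum>n\<le>s. fock_weight j n * (cmod (c n))\<^sup>2 * (fock_weight i (s - n) * (cmod (c (s - n)))\<^sup>2)))
     sums (energy i k x * energy j k x + energy j k x * energy i k x)"
    by (intro sums_add p q) auto
  then show ?thesis by (simp add: sum.distrib mult_ac)
qed

text \<open>The Cauchy-Schwarz inequality for both factors, with the same weight \<open>v\<close>. The quadratic multiplier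
  enters squared, hence the fourth moment of the binomial distribution.\<close>
lemma bsquare_times_defect_le:
  fixes v :: "nat \<Rightarrow> real"
  assumes v: "\<And>n. v n > 0" and nonneg: "P \<ge> 0" "\<alpha> \<ge> 0" "\<beta> \<ge> 0"
    and w: "\<And>n. n \<le> s \<Longrightarrow> \<bar>w n (s - n)\<bar> \<le> P * (real n - real (s - n))\<^sup>2"
    and a: "(\<Sum>n\<le>s. binw s n / v n) \<le> \<alpha>\<^sup>2"
    and b: "(\<Sum>n\<le>s. binw s n * (real n - real (s - n)) ^ 4 / v n) \<le> \<beta>\<^sup>2"
  shows "cmod (bsquare c c s) * cmod (bconv w c c s)
    \<le> \<alpha> * \<beta> * P * (\<Sum>n\<le>s. v n * ((cmod (c n))\<^sup>2 * (cmod (c (s - n)))\<^sup>2))" (is "_ \<le> _ * ?q")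
proof -
  have q: "?q \<ge> 0" using v by (intro sum_nonneg mult_nonneg_nonneg) (auto simp: less_imp_le)
  have "(cmod (bsquare c c s))\<^sup>2 \<le> (\<Sum>n\<le>s. binw s n / v n) * ?q"
    using cmod_bconv_sq_le[of v "\<lambda>_ _. 1" c c s, OF v] by simp
  also have "\<dots> \<le> \<alpha>\<^sup>2 * ?q" by (intro mult_right_mono a q)
  finally have S: "(cmod (bsquare c c s))\<^sup>2 \<le> \<alpha>\<^sup>2 * ?q" .
  have "(\<Sum>n\<le>s. (w n (s - n))\<^sup>2 * binw s n / v n)
      \<le> (\<Sum>n\<le>s. P\<^sup>2 * (binw s n * (real n - real (s - n)) ^ 4 / v n))"
  proof (rule sum_mono)
    fix n assume n: "n \<in> {..s}"
    have "\<bar>w n (s - n)\<bar>\<^sup>2 \<le> (P * (real n - real (s - n))\<^sup>2)\<^sup>2"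
      using w[of n] n by (intro power_mono) auto
    also have "\<dots> = P\<^sup>2 * (real n - real (s - n)) ^ 4"
      unfolding power_mult_distrib by (simp del: of_nat_diff flip: power_mult)
    finally have "(w n (s - n))\<^sup>2 * (binw s n / v n) \<le> P\<^sup>2 * (real n - real (s - n)) ^ 4 * (binw s n / v n)"
      using v[of n] by (intro mult_right_mono) (auto simp del: of_nat_diff)
    then show "(w n (s - n))\<^sup>2 * binw s n / v n \<le> P\<^sup>2 * (binw s n * (real n - real (s - n)) ^ 4 / v n)"
      by (simp add: mult_ac del: of_nat_diff)
  qed
  also have "\<dots> \<le> P\<^sup>2 * \<beta>\<^sup>2" unfolding sum_distrib_left[symmetric] by (intro mult_left_mono b) simp
  finally have "(\<Sum>n\<le>s. (w n (s - n))\<^sup>2 * binw s n / v n) * ?q \<le> P\<^sup>2 * \<beta>\<^sup>2 * ?q"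
    by (rule mult_right_mono[OF _ q])
  then have D: "(cmod (bconv w c c s))\<^sup>2 \<le> P\<^sup>2 * \<beta>\<^sup>2 * ?q"
    using cmod_bconv_sq_le[of v w c c s, OF v] by linarith
  have "(cmod (bsquare c c s) * cmod (bconv w c c s))\<^sup>2 \<le> (\<alpha>\<^sup>2 * ?q) * (P\<^sup>2 * \<beta>\<^sup>2 * ?q)"
    unfolding power_mult_distrib[of "cmod (bsquare c c s)"] by (intro mult_mono S D mult_nonneg_nonneg q) auto
  also have "\<dots> = (\<alpha> * \<beta> * P * ?q)\<^sup>2" by (simp add: power2_eq_square mult_ac)
  finally show ?thesis by (rule power2_le_imp_le) (use nonneg q in simp)
qed

text \<open>The remainder \<open>(1 + s) ^ (j - 2) * (i - m)\<^sup>2\<close> has mean square \<open>3 * (1 + s) ^ (2 * j - 2)\<close>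
  at most, so that the convolution with it costs \<open>(1 + s) ^ (j - 1)\<close>. This power is then moved
  to the larger one of the two indices.\<close>
lemma energy_rate_le_mass:
  assumes "j \<ge> 2"
  shows "\<exists>C\<ge>0. \<forall>k x. j \<le> k \<longrightarrow>
    \<bar>inner (energy_op j k x) (lll_field k x)\<bar> \<le> C * (energy 0 k x * energy (j - 1) k x)"
proof -
  obtain g C where C: "C \<ge> 0" and g: "\<And>i m. \<bar>fock_weight j i + fock_weight j m - g (i + m)\<bar>
      \<le> C * (real (i + m) + 1) ^ (j - 2) * (real i - real m)\<^sup>2"
    using fock_weight_radial_part[of j] assms by (auto split: if_splits)
  let ?C = "2 * C * 2 ^ (j - 1)"
  show ?thesis
  proof (intro exI[of _ "2 * ?C"] conjI allI impI)
    fix k x assume k: "j \<le> k"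
    define c where "c = fock_coeff k x"
    let ?w = "\<lambda>i m. fock_weight j i + fock_weight j m - g (i + m)"
    let ?cc = "\<lambda>s n. (cmod (c n))\<^sup>2 * (cmod (c (s - n)))\<^sup>2"
    let ?b = "\<lambda>s. \<Sum>n\<le>s. fock_weight 0 n * (cmod (c n))\<^sup>2 * (fock_weight (j - 1) (s - n) * (cmod (c (s - n)))\<^sup>2)
       + fock_weight (j - 1) n * (cmod (c n))\<^sup>2 * (fock_weight 0 (s - n) * (cmod (c (s - n)))\<^sup>2)"
    have "cmod (bsquare c c s) * cmod (bconv ?w c c s) \<le> ?C * ?b s" for s
    proof -
      have "cmod (bsquare c c s) * cmod (bconv ?w c c s)
          \<le> 1 * (2 * (real s + 1)) * (C * (real s + 1) ^ (j - 2)) * (\<Sum>n\<le>s. 1 * ?cc s n)"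
      proof (rule bsquare_times_defect_le)
        show "\<bar>?w n (s - n)\<bar> \<le> C * (real s + 1) ^ (j - 2) * (real n - real (s - n))\<^sup>2" if "n \<le> s" for n
          using g[of n "s - n"] that by simp
        have "3 * (real s)\<^sup>2 \<le> (2 * (real s + 1))\<^sup>2" by (simp add: power2_eq_square algebra_simps)
        then show "(\<Sum>n\<le>s. binw s n * (real n - real (s - n)) ^ 4 / 1) \<le> (2 * (real s + 1))\<^sup>2"
          using binw_fourth_moment[of s] by simp
      qed (use C in \<open>auto simp: sum_binw\<close>)
      also have "\<dots> = 2 * C * ((real s + 1) ^ (j - 1) * (\<Sum>n\<le>s. ?cc s n))"
      proof -
        have "j - 1 = Suc (j - 2)" using assms by simp
        then show ?thesis by simp
      qed
      also have "\<dots> \<le> 2 * C * (2 ^ (j - 1) * ?b s)"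
      proof (intro mult_left_mono)
        show "(real s + 1) ^ (j - 1) * (\<Sum>n\<le>s. ?cc s n) \<le> 2 ^ (j - 1) * ?b s"
          unfolding sum_distrib_left
        proof (rule sum_mono)
          fix n assume n: "n \<in> {..s}"
          have "(real s + 1) ^ (j - 1) \<le> 2 ^ (j - 1) * ((real n + 1) ^ (j - 1) + (real (s - n) + 1) ^ (j - 1))"
            using power_add_le_two_power[of n "s - n" "j - 1"] n by simp
          also have "\<dots> \<le> 2 ^ (j - 1) * (fock_weight (j - 1) n + fock_weight (j - 1) (s - n))"
            by (intro mult_left_mono add_mono fock_weight_ge) auto
          finally have "(real s + 1) ^ (j - 1) * ?cc s n
              \<le> 2 ^ (j - 1) * (fock_weight (j - 1) n + fock_weight (j - 1) (s - n)) * ?cc s n"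
            by (rule mult_right_mono) simp
          then show "(real s + 1) ^ (j - 1) * ?cc s n \<le> 2 ^ (j - 1) *
            (fock_weight 0 n * (cmod (c n))\<^sup>2 * (fock_weight (j - 1) (s - n) * (cmod (c (s - n)))\<^sup>2)
            + fock_weight (j - 1) n * (cmod (c n))\<^sup>2 * (fock_weight 0 (s - n) * (cmod (c (s - n)))\<^sup>2))"
            by (simp add: algebra_simps)
        qed
      qed (use C in auto)
      finally show ?thesis by simp
    qed
    moreover have "(\<lambda>s. ?C * ?b s) sums (?C * (2 * (energy 0 k x * energy (j - 1) k x)))"
      unfolding c_def using k by (intro sums_mult cauchy_energy_sums) auto
    ultimately have "\<bar>inner (energy_op j k x) (lll_field k x)\<bar> \<le> ?C * (2 * (energy 0 k x * energy (j - 1) k x))"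
      unfolding c_def by (rule energy_rate_le[OF k])
    then show "\<bar>inner (energy_op j k x) (lll_field k x)\<bar> \<le> 2 * ?C * (energy 0 k x * energy (j - 1) k x)"
      by simp
  qed (use C in auto)
qed

text \<open>As in the previous estimate, but with the weight \<open>(i + 1) * (m + 1)\<close> in the Cauchy-Schwarz inequality. The
  binomial moments with the inverse of this weight are smaller by \<open>s\<^sup>2\<close>, so both factors gain
  \<open>1 / s\<close>, and each of the two coefficients receives a weight of order at least one.\<close>
lemma energy_rate_le_momentum:
  assumes "j \<ge> 3"
  shows "\<exists>C\<ge>0. \<forall>k x. j \<le> k \<longrightarrow>
    \<bar>inner (energy_op j k x) (lll_field k x)\<bar> \<le> C * (energy 1 k x * energy (j - 2) k x)"
proof -
  obtain g C where C: "C \<ge> 0" and g: "\<And>i m. \<bar>fock_weight j i + fock_weight j m - g (i + m)\<bar>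
      \<le> C * (real (i + m) + 1) ^ (j - 2) * (real i - real m)\<^sup>2"
    using fock_weight_radial_part[of j] assms by (auto split: if_splits)
  let ?C = "10 * C * 2 ^ (j - 3)"
  have j: "j - 2 = Suc (j - 3)" using assms by simp
  show ?thesis
  proof (intro exI[of _ "2 * ?C"] conjI allI impI)
    fix k x assume k: "j \<le> k"
    define c where "c = fock_coeff k x"
    let ?w = "\<lambda>i m. fock_weight j i + fock_weight j m - g (i + m)"
    let ?cc = "\<lambda>s n. (cmod (c n))\<^sup>2 * (cmod (c (s - n)))\<^sup>2"
    let ?v = "\<lambda>s n. (real n + 1) * (real (s - n) + 1)"
    let ?b = "\<lambda>s. \<Sum>n\<le>s. fock_weight 1 n * (cmod (c n))\<^sup>2 * (fock_weight (j - 2) (s - n) * (cmod (c (s - n)))\<^sup>2)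
       + fock_weight (j - 2) n * (cmod (c n))\<^sup>2 * (fock_weight 1 (s - n) * (cmod (c (s - n)))\<^sup>2)"
    have "cmod (bsquare c c s) * cmod (bconv ?w c c s) \<le> ?C * ?b s" for s
    proof -
      have "cmod (bsquare c c s) * cmod (bconv ?w c c s)
          \<le> 2 / (real s + 1) * 5 * (C * (real s + 1) ^ (j - 2)) * (\<Sum>n\<le>s. ?v s n * ?cc s n)"
      proof (rule bsquare_times_defect_le)
        show "?v s n > 0" for n by (simp add: add_nonneg_pos)
        show "\<bar>?w n (s - n)\<bar> \<le> C * (real s + 1) ^ (j - 2) * (real n - real (s - n))\<^sup>2" if "n \<le> s" for n
          using g[of n "s - n"] that by simp
        show "(\<Sum>n\<le>s. binw s n / ?v s n) \<le> (2 / (real s + 1))\<^sup>2"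
          using binw_damped_moments(1)[of s] by (simp add: power_divide)
        show "(\<Sum>n\<le>s. binw s n * (real n - real (s - n)) ^ 4 / ?v s n) \<le> 5\<^sup>2"
          using binw_damped_moments(2)[of s] by simp
      qed (use C in auto)
      also have "\<dots> = 10 * C * ((real s + 1) ^ (j - 3) * (\<Sum>n\<le>s. ?v s n * ?cc s n))"
        unfolding j by simp
      also have "\<dots> \<le> 10 * C * (2 ^ (j - 3) * ?b s)"
      proof (intro mult_left_mono)
        show "(real s + 1) ^ (j - 3) * (\<Sum>n\<le>s. ?v s n * ?cc s n) \<le> 2 ^ (j - 3) * ?b s"
          unfolding sum_distrib_left
        proof (rule sum_mono)
          fix n assume n: "n \<in> {..s}"
          define a b where "a = real n + 1" and "b = real (s - n) + 1"
          have ab: "a \<ge> 0" "b \<ge> 0" by (simp_all add: a_def b_def)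
          have "(real s + 1) ^ (j - 3) \<le> 2 ^ (j - 3) * (a ^ (j - 3) + b ^ (j - 3))"
            using power_add_le_two_power[of n "s - n" "j - 3"] n by (simp add: a_def b_def)
          then have "(real s + 1) ^ (j - 3) * (a * b) \<le> 2 ^ (j - 3) * (a ^ (j - 3) + b ^ (j - 3)) * (a * b)"
            using ab by (intro mult_right_mono) auto
          also have "\<dots> = 2 ^ (j - 3) * (a ^ (j - 2) * b ^ 1 + a ^ 1 * b ^ (j - 2))"
            unfolding j by (simp add: algebra_simps)
          also have "\<dots> \<le> 2 ^ (j - 3) * (fock_weight (j - 2) n * fock_weight 1 (s - n)
               + fock_weight 1 n * fock_weight (j - 2) (s - n))"
            unfolding a_def b_def by (intro mult_left_mono add_mono mult_mono fock_weight_ge) auto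
          finally have "(real s + 1) ^ (j - 3) * (a * b) * ?cc s n
              \<le> 2 ^ (j - 3) * (fock_weight (j - 2) n * fock_weight 1 (s - n)
               + fock_weight 1 n * fock_weight (j - 2) (s - n)) * ?cc s n"
            by (rule mult_right_mono) simp
          then show "(real s + 1) ^ (j - 3) * (?v s n * ?cc s n) \<le> 2 ^ (j - 3) *
            (fock_weight 1 n * (cmod (c n))\<^sup>2 * (fock_weight (j - 2) (s - n) * (cmod (c (s - n)))\<^sup>2)
            + fock_weight (j - 2) n * (cmod (c n))\<^sup>2 * (fock_weight 1 (s - n) * (cmod (c (s - n)))\<^sup>2))"
            unfolding a_def b_def by (simp add: algebra_simps del: of_nat_diff fock_weight.simps)
        qed
      qed (use C in auto)
      finally show ?thesis by (simp del: fock_weight.simps)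
    qed
    moreover have "(\<lambda>s. ?C * ?b s) sums (?C * (2 * (energy 1 k x * energy (j - 2) k x)))"
      unfolding c_def using k assms by (intro sums_mult cauchy_energy_sums) auto
    ultimately have "\<bar>inner (energy_op j k x) (lll_field k x)\<bar> \<le> ?C * (2 * (energy 1 k x * energy (j - 2) k x))"
      unfolding c_def by (rule energy_rate_le[OF k])
    then show "\<bar>inner (energy_op j k x) (lll_field k x)\<bar> \<le> 2 * ?C * (energy 1 k x * energy (j - 2) k x)"
      by simp
  qed (use C in auto)
qed

section \<open>Differential inequalities and ordinary differential equations\<close>

lemma growth_le_forward:
  fixes q \<psi> :: "real \<Rightarrow> real"
  assumes q: "\<And>t. (q has_real_derivative q' t) (at t)"
    and psi: "\<And>t. t \<ge> 0 \<Longrightarrow> (\<psi> has_real_derivative \<psi>' t) (at t)"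
    and le: "\<And>t. t \<ge> 0 \<Longrightarrow> q' t \<le> \<psi>' t" and "t \<ge> 0"
  shows "q t \<le> q 0 + (\<psi> t - \<psi> 0)"
proof -
  have "\<psi> 0 - q 0 \<le> \<psi> t - q t"
  proof (rule DERIV_nonneg_imp_nondecreasing[OF \<open>t \<ge> 0\<close>])
    fix s assume "0 \<le> s" "s \<le> t"
    then show "\<exists>y. ((\<lambda>s. \<psi> s - q s) has_real_derivative y) (at s) \<and> 0 \<le> y"
      using le[of s] by (intro exI[of _ "\<psi>' s - q' s"] conjI DERIV_diff psi q) auto
  qed
  then show ?thesis by simp
qed

text \<open>Two-sided in time, because the hypothesis does not change under time reversal.\<close>
lemma growth_le:
  fixes q \<psi> :: "real \<Rightarrow> real"
  assumes q: "\<And>t. (q has_real_derivative q' t) (at t)"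
    and psi: "\<And>t. t \<ge> 0 \<Longrightarrow> (\<psi> has_real_derivative \<psi>' t) (at t)"
    and le: "\<And>t. \<bar>q' t\<bar> \<le> \<psi>' \<bar>t\<bar>"
  shows "q t \<le> q 0 + (\<psi> \<bar>t\<bar> - \<psi> 0)"
proof (cases "t \<ge> 0")
  case True
  show ?thesis
    using growth_le_forward[OF q psi _ True] le True by (smt (verit))
next
  case False
  have d: "((\<lambda>s. q (- s)) has_real_derivative - q' (- s)) (at s)" for s
    using q[of "- s"] by (simp add: DERIV_mirror)
  have "q (- (- t)) \<le> q (- 0) + (\<psi> (- t) - \<psi> 0)"
  proof (rule growth_le_forward[OF d psi])
    show "- q' (- s) \<le> \<psi>' s" if "s \<ge> 0" for s using le[of "- s"] that by (simp add: abs_le_iff)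
  qed (use False in auto)
  then show ?thesis using False by simp
qed

lemma gronwall_forward:
  fixes q :: "real \<Rightarrow> real"
  assumes q: "\<And>t. 0 \<le> t \<Longrightarrow> t \<le> T \<Longrightarrow> (q has_real_derivative q' t) (at t)"
    and le: "\<And>t. 0 \<le> t \<Longrightarrow> t \<le> T \<Longrightarrow> q' t \<le> K * q t" and t: "0 \<le> t" "t \<le> T"
  shows "q t \<le> q 0 * exp (K * t)"
proof -
  have "q t * exp (- K * t) \<le> q 0 * exp (- K * 0)"
  proof (rule DERIV_nonpos_imp_nonincreasing[OF t(1)])
    fix s assume s: "0 \<le> s" "s \<le> t"
    show "\<exists>y. ((\<lambda>s. q s * exp (- K * s)) has_real_derivative y) (at s) \<and> y \<le> 0"
    proof (intro exI conjI)
      show "((\<lambda>s. q s * exp (- K * s)) has_real_derivative (q' s - K * q s) * exp (- K * s)) (at s)"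
        using s t by (auto intro!: derivative_eq_intros q simp: algebra_simps)
      show "(q' s - K * q s) * exp (- K * s) \<le> 0"
        using le[of s] s t by (intro mult_nonpos_nonneg) auto
    qed
  qed
  then have "q t * exp (- K * t) * exp (K * t) \<le> q 0 * exp (K * t)" by (intro mult_right_mono) auto
  then show ?thesis by (simp add: mult.assoc flip: exp_add)
qed

lemma gronwall:
  fixes q :: "real \<Rightarrow> real"
  assumes q: "\<And>t. (q has_real_derivative q' t) (at t)"
    and le: "\<And>t. \<bar>t\<bar> \<le> T \<Longrightarrow> \<bar>q' t\<bar> \<le> K * q t" and t: "\<bar>t\<bar> \<le> T"
  shows "q t \<le> q 0 * exp (K * \<bar>t\<bar>)"
proof (cases "t \<ge> 0")
  case True
  have "q' s \<le> K * q s" if "0 \<le> s" "s \<le> T" for s using le[of s] that by auto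
  then show ?thesis
    using gronwall_forward[where q = q and q' = q' and K = K and T = T and t = t, OF q] True t by auto
next
  case False
  have d: "((\<lambda>s. q (- s)) has_real_derivative - q' (- s)) (at s)" for s
    using q[of "- s"] by (simp add: DERIV_mirror)
  have le': "- q' (- s) \<le> K * q (- s)" if "0 \<le> s" "s \<le> T" for s using le[of "- s"] that by auto
  show ?thesis
    using gronwall_forward[where q = "\<lambda>s. q (- s)" and t = "- t", OF d le'] False t by auto
qed

lemma ex_primitive:
  fixes g :: "real \<Rightarrow> 'a::banach"
  assumes g: "continuous_on UNIV g"
  shows "\<exists>P. P 0 = 0 \<and> (\<forall>t. (P has_vector_derivative g t) (at t))"
proof -
  define P where "P t = (if t \<ge> 0 then integral {0..t} g else - integral {t..0} g)" for t
  have int: "g integrable_on {a..b}" for a b :: real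
    by (rule integrable_continuous_real) (rule continuous_on_subset[OF g], simp)
  have P: "P s = integral {-N..s} g - integral {-N..0} g" if "-N \<le> s" "-N \<le> 0" for N s
  proof (cases "s \<ge> 0")
    case True
    then show ?thesis using Henstock_Kurzweil_Integration.integral_combine[OF that(2) True int] True
      by (simp add: P_def eq_diff_eq add.commute)
  next
    case False
    then have "integral {-N..s} g + integral {s..0} g = integral {-N..0} g"
      using that by (intro Henstock_Kurzweil_Integration.integral_combine int) auto
    then show ?thesis using False by (auto simp: P_def algebra_simps)
  qed
  have "(P has_vector_derivative g t) (at t)" for t
  proof -
    define N where "N = \<bar>t\<bar> + 1"
    have N: "-N < t" "t < N" "-N \<le> 0" by (auto simp: N_def)
    have "((\<lambda>s. integral {-N..s} g) has_vector_derivative g t) (at t within {-N..N})"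
      by (rule integral_has_vector_derivative[OF continuous_on_subset[OF g]]) (use N in auto)
    then have "((\<lambda>s. integral {-N..s} g) has_vector_derivative g t) (at t)"
      by (simp only: at_within_Icc_at[OF N(1,2)])
    from has_vector_derivative_diff[OF this has_vector_derivative_const]
    have "((\<lambda>s. integral {-N..s} g - integral {-N..0} g) has_vector_derivative g t) (at t)"
      by simp
    then show ?thesis
      by (rule has_vector_derivative_transform_within_open[where S = "{-N<..<N}"]) (use N P[of N] in auto)
  qed
  moreover have "P 0 = 0" by (simp add: P_def)
  ultimately show ?thesis by blast
qed

lemma primitive_bound:
  fixes D :: "real \<Rightarrow> 'a::banach"
  assumes D: "\<And>t. (D has_vector_derivative D' t) (at t)" "D 0 = 0"
    and phi: "\<And>t. (\<phi> has_real_derivative \<phi>' t) (at t)" "\<phi> 0 = 0"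
    and le: "\<And>t. \<bar>t\<bar> \<le> T \<Longrightarrow> norm (D' t) \<le> \<phi>' \<bar>t\<bar>" and t: "\<bar>t\<bar> \<le> T"
  shows "norm (D t) \<le> \<phi> \<bar>t\<bar>"
proof -
  have fw: "norm (E t - E 0) \<le> \<phi> t - \<phi> 0"
    if E: "\<And>t. (E has_vector_derivative E' t) (at t)" and "\<And>s. 0 < s \<Longrightarrow> s < t \<Longrightarrow> norm (E' s) \<le> \<phi>' s" "0 < t"
    for E :: "real \<Rightarrow> 'a" and E' t
  proof (rule differentiable_bound_general[OF \<open>0 < t\<close>])
    show "continuous_on {0..t} E"
      by (rule continuous_at_imp_continuous_on) (use E has_vector_derivative_continuous in blast)
    show "continuous_on {0..t} \<phi>"
      by (rule continuous_at_imp_continuous_on) (use phi DERIV_isCont in blast)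
  qed (use that phi in \<open>auto simp: has_real_derivative_iff_has_vector_derivative\<close>)
  consider "t = 0" | "t > 0" | "t < 0" by linarith
  then show ?thesis
  proof cases
    case 1 then show ?thesis using D phi by simp
  next
    case 2
    have "norm (D' s) \<le> \<phi>' s" if "0 < s" "s < t" for s using le[of s] that t by auto
    then show ?thesis using fw[OF D(1) _ 2] D phi 2 by simp
  next
    case 3
    have d: "((\<lambda>s. D (- s)) has_vector_derivative (- 1) *\<^sub>R D' (- s)) (at s)" for s
    proof -
      have "((\<lambda>s. - s) has_vector_derivative - 1) (at s)" by (auto intro!: derivative_eq_intros)
      then show ?thesis
        using vector_diff_chain_at[of "\<lambda>s. - s" "- 1" s D "D' (- s)"] D(1)[of "- s"] by (simp add: o_def)
    qed
    have "norm ((- 1) *\<^sub>R D' (- s)) \<le> \<phi>' s" if "0 < s" "s < - t" for s using le[of "- s"] that t by auto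
    then show ?thesis using fw[OF d, of "- t"] D phi 3 by simp
  qed
qed

text \<open>Lipschitz continuity is only required locally uniformly in time. On \<open>[-T, T]\<close> the increments of
  the Picard iterates are bounded by the terms of an exponential series, so the iterates converge
  locally uniformly on the whole line, without a continuation argument.\<close>
theorem picard_global:
  fixes G :: "real \<Rightarrow> 'a::banach \<Rightarrow> 'a"
  assumes cont: "\<And>x. continuous_on UNIV x \<Longrightarrow> continuous_on UNIV (\<lambda>t. G t (x t))"
    and lip: "\<And>T. \<exists>L\<ge>0. \<forall>t x y. \<bar>t\<bar> \<le> T \<longrightarrow> norm (G t x - G t y) \<le> L * norm (x - y)"
  shows "\<exists>x. x 0 = x0 \<and> (\<forall>t. (x has_vector_derivative G t (x t)) (at t))"
proof -
  obtain I :: "(real \<Rightarrow> 'a) \<Rightarrow> real \<Rightarrow> 'a" where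
    I: "\<And>g. continuous_on UNIV g \<Longrightarrow> I g 0 = 0" "\<And>g t. continuous_on UNIV g \<Longrightarrow> (I g has_vector_derivative g t) (at t)"
    using ex_primitive by metis
  define X where "X = rec_nat (\<lambda>_. x0) (\<lambda>n x t. x0 + I (\<lambda>s. G s (x s)) t)"
  have X0: "X 0 t = x0" and XSuc: "X (Suc n) t = x0 + I (\<lambda>s. G s (X n s)) t" for n t
    by (simp_all add: X_def)
  have contX: "continuous_on UNIV (X n)" for n
  proof (induction n)
    case 0 show ?case using X0 by (simp add: X_def)
  next
    case (Suc n)
    have "continuous_on UNIV (I (\<lambda>s. G s (X n s)))"
      by (rule continuous_at_imp_continuous_on) (use I(2)[OF cont[OF Suc]] has_vector_derivative_continuous in blast)
    then show ?case unfolding XSuc[abs_def] by (intro continuous_intros)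
  qed
  have X_at_0: "X n 0 = x0" for n by (cases n) (simp_all add: X0 XSuc I(1)[OF cont[OF contX]])
  have dX: "(X (Suc n) has_vector_derivative G t (X n t)) (at t)" for n t
    unfolding XSuc[abs_def] using has_vector_derivative_add[OF has_vector_derivative_const I(2)[OF cont[OF contX]]] by simp
  have unif: "\<exists>l. uniform_limit {-T..T} X l sequentially" for T
  proof -
    obtain L where L: "L \<ge> 0" "\<And>t x y. \<bar>t\<bar> \<le> T \<Longrightarrow> norm (G t x - G t y) \<le> L * norm (x - y)"
      using lip by blast
    have "compact ((\<lambda>t. G t x0) ` {-T..T})"
      by (intro compact_continuous_image continuous_on_subset[OF cont[of "\<lambda>_. x0"]]) auto
    from compact_imp_bounded[OF this] obtain M where M': "\<forall>y\<in>(\<lambda>t. G t x0) ` {-T..T}. norm y \<le> M"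
      unfolding bounded_iff by blast
    have M: "norm (G t x0) \<le> M" if "\<bar>t\<bar> \<le> T" for t
    proof -
      have "t \<in> {-T..T}" using that by auto
      then show ?thesis using M' by blast
    qed
    have step: "norm (X (Suc n) t - X n t) \<le> M * L ^ n * \<bar>t\<bar> ^ Suc n / fact (Suc n)" if "\<bar>t\<bar> \<le> T" for n t
      using that
    proof (induction n arbitrary: t)
      case 0
      have "norm (X (Suc 0) t - X 0 t) \<le> M * \<bar>t\<bar>"
      proof (rule primitive_bound[where T = T])
        show "((\<lambda>t. X (Suc 0) t - X 0 t) has_vector_derivative G t x0) (at t)" for t
          using has_vector_derivative_diff[OF dX[of 0 t] has_vector_derivative_const[of x0]] by (simp add: X0)
        show "((\<lambda>t. M * t) has_real_derivative M) (at t)" for t by (auto intro!: derivative_eq_intros)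
      qed (use M 0 X_at_0 in auto)
      then show ?case by simp
    next
      case (Suc n)
      show ?case
      proof (rule primitive_bound[where T = T and \<phi>' = "\<lambda>t. M * L ^ Suc n * t ^ Suc n / fact (Suc n)"])
        show "((\<lambda>t. X (Suc (Suc n)) t - X (Suc n) t) has_vector_derivative G t (X (Suc n) t) - G t (X n t)) (at t)" for t
          by (intro has_vector_derivative_diff dX)
        show "((\<lambda>t. M * L ^ Suc n * t ^ Suc (Suc n) / fact (Suc (Suc n))) has_real_derivative
            M * L ^ Suc n * t ^ Suc n / fact (Suc n)) (at t)" for t
        proof -
          have f: "fact (Suc (Suc n)) = real (Suc (Suc n)) * fact (Suc n)" by simp
          show ?thesis
            unfolding f by (rule derivative_eq_intros refl | simp del: fact_Suc of_nat_Suc power_Suc)+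
        qed
        fix s assume s: "\<bar>s\<bar> \<le> T"
        have "norm (G s (X (Suc n) s) - G s (X n s)) \<le> L * norm (X (Suc n) s - X n s)" by (rule L(2)[OF s])
        also have "\<dots> \<le> L * (M * L ^ n * \<bar>s\<bar> ^ Suc n / fact (Suc n))" by (intro mult_left_mono Suc.IH s L)
        finally show "norm (G s (X (Suc n) s) - G s (X n s)) \<le> M * L ^ Suc n * \<bar>s\<bar> ^ Suc n / fact (Suc n)"
          by (simp add: mult_ac)
      qed (use X_at_0 Suc.prems in auto)
    qed
    have "uniform_limit {-T..T} (\<lambda>n t. \<Sum>i<n. X (Suc i) t - X i t) (\<lambda>t. \<Sum>i. X (Suc i) t - X i t) sequentially"
    proof (rule Weierstrass_m_test[where M = "\<lambda>n. M * T * (inverse (fact n) * (L * T) ^ n)"])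
      fix n t assume "t \<in> {-T..T}"
      then have t: "\<bar>t\<bar> \<le> T" by auto
      have M0: "M \<ge> 0" using M[OF t] norm_ge_zero order_trans by blast
      have "norm (X (Suc n) t - X n t) \<le> M * L ^ n * \<bar>t\<bar> ^ Suc n / fact (Suc n)" by (rule step[OF t])
      also have "\<dots> \<le> M * L ^ n * T ^ Suc n / fact n"
        using t M0 L by (intro frac_le mult_left_mono power_mono mult_nonneg_nonneg zero_le_power fact_mono) auto
      also have "\<dots> = M * T * (inverse (fact n) * (L * T) ^ n)" by (simp add: field_simps power_mult_distrib)
      finally show "norm (X (Suc n) t - X n t) \<le> M * T * (inverse (fact n) * (L * T) ^ n)" .
    next
      show "summable (\<lambda>n. M * T * (inverse (fact n) * (L * T) ^ n))"
        by (intro summable_mult summable_exp)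
    qed
    then have "uniform_limit {-T..T} (\<lambda>n t. x0 + (\<Sum>i<n. X (Suc i) t - X i t)) (\<lambda>t. x0 + (\<Sum>i. X (Suc i) t - X i t)) sequentially"
      by (intro uniform_limit_intros)
    moreover have "x0 + (\<Sum>i<n. X (Suc i) t - X i t) = X n t" for n t
      using sum_lessThan_telescope[of "\<lambda>i. X i t" n] by (simp add: X0)
    ultimately show ?thesis by auto
  qed
  define x where "x t = lim (\<lambda>n. X n t)" for t
  have ul: "uniform_limit {-T..T} X x sequentially" for T
  proof -
    obtain l where l: "uniform_limit {-T..T} X l sequentially" using unif by blast
    have "x t = l t" if "t \<in> {-T..T}" for t
      unfolding x_def using tendsto_uniform_limitI[OF l that] by (rule limI)
    then show ?thesis using l unfolding uniform_limit_iff by simp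
  qed
  have cx: "continuous_on UNIV x"
  proof (rule continuous_at_imp_continuous_on, rule)
    fix t :: real
    have "continuous_on {-(\<bar>t\<bar>+1)..\<bar>t\<bar>+1} x"
      by (rule uniform_limit_theorem[OF always_eventually ul]) (auto intro: continuous_on_subset[OF contX])
    then show "isCont x t"
      by (rule continuous_on_interior) auto
  qed
  have lim: "(\<lambda>n. X n t) \<longlonglongrightarrow> x t" for t
    by (rule tendsto_uniform_limitI[OF ul[of "\<bar>t\<bar>"]]) auto
  have fixpt: "x t = x0 + I (\<lambda>s. G s (x s)) t" for t
  proof -
    define T where "T = \<bar>t\<bar> + 1"
    obtain L where L: "L \<ge> 0" "\<And>t x y. \<bar>t\<bar> \<le> T \<Longrightarrow> norm (G t x - G t y) \<le> L * norm (x - y)"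
      using lip by blast
    have "(\<lambda>n. X (Suc n) t) \<longlonglongrightarrow> x0 + I (\<lambda>s. G s (x s)) t"
    proof (rule LIMSEQ_I)
      fix e :: real assume e: "e > 0"
      \<comment> \<open>\<open>L + 1\<close> instead of \<open>L\<close>, which may be zero\<close>
      define d where "d = e / ((L + 1) * T * 2)"
      have T: "T > 0" by (simp add: T_def)
      have d: "d > 0" using e L T by (simp add: d_def)
      obtain N where N: "\<And>n s. n \<ge> N \<Longrightarrow> s \<in> {-T..T} \<Longrightarrow> dist (X n s) (x s) < d"
        using uniform_limitD[OF ul d] unfolding eventually_sequentially by meson
      have "norm (X (Suc n) t - (x0 + I (\<lambda>s. G s (x s)) t)) < e" if n: "n \<ge> N" for n
      proof -
        have "norm (X (Suc n) t - (x0 + I (\<lambda>s. G s (x s)) t)) \<le> L * d * \<bar>t\<bar>"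
        proof (rule primitive_bound[where T = T])
          show "((\<lambda>t. X (Suc n) t - (x0 + I (\<lambda>s. G s (x s)) t)) has_vector_derivative
              G t (X n t) - (0 + G t (x t))) (at t)" for t
            by (intro has_vector_derivative_diff dX has_vector_derivative_add has_vector_derivative_const I(2) cont cx)
          show "((\<lambda>t. L * d * t) has_real_derivative L * d) (at t)" for t by (auto intro!: derivative_eq_intros)
          fix s assume s: "\<bar>s\<bar> \<le> T"
          have "norm (G s (X n s) - G s (x s)) \<le> L * norm (X n s - x s)" by (rule L(2)[OF s])
          also have "\<dots> \<le> L * d" using N[OF n, of s] s L
            by (intro mult_left_mono) (auto simp: dist_norm abs_le_iff)
          finally show "norm (G s (X n s) - (0 + G s (x s))) \<le> L * d" by simp
        qed (auto simp: X_at_0 I(1)[OF cont[OF cx]] T_def)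
        also have "\<dots> \<le> (L + 1) * d * T" using L d T by (intro mult_mono) (auto simp: T_def)
        also have "\<dots> = e / 2" using L T by (simp add: d_def)
        also have "\<dots> < e" using e by simp
        finally show ?thesis .
      qed
      then show "\<exists>no. \<forall>n\<ge>no. norm (X (Suc n) t - (x0 + I (\<lambda>s. G s (x s)) t)) < e" by blast
    qed
    then show ?thesis using LIMSEQ_unique[OF LIMSEQ_Suc[OF lim[of t]]] by blast
  qed
  have "(x has_vector_derivative G t (x t)) (at t)" for t
  proof -
    have "((\<lambda>t. x0 + I (\<lambda>s. G s (x s)) t) has_vector_derivative 0 + G t (x t)) (at t)"
      by (intro has_vector_derivative_add has_vector_derivative_const I(2) cont cx)
    then show ?thesis by (simp flip: fixpt)
  qed
  moreover have "x 0 = x0" using fixpt[of 0] I(1)[OF cont[OF cx]] by simp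
  ultimately show ?thesis by blast
qed

section \<open>The flow on sequences\<close>

lemma has_vector_derivative_continuous_on:
  "(\<And>t. (x has_vector_derivative x' t) (at t)) \<Longrightarrow> continuous_on UNIV x"
  by (rule continuous_at_imp_continuous_on) (use has_vector_derivative_continuous in blast)

lemma lll_field_scale: "lll_field k (r *\<^sub>R x) = r ^ 3 *\<^sub>R lll_field k x"
proof -
  interpret S': bounded_bilinear "S.Bconv k" by (rule S.bounded_bilinear_Bconv)
  interpret R': bounded_bilinear "R.Bcorr k" by (rule R.bounded_bilinear_Bcorr)
  interpret J: bounded_linear mult_neg_i by (rule bounded_linear_mult_neg_i)
  show ?thesis
    by (simp add: lll_field_def S'.scaleR_left S'.scaleR_right R'.scaleR_left R'.scaleR_right J.scaleR
        power3_eq_cube mult.assoc)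
qed

lemma continuous_on_lll_field: "continuous_on A x \<Longrightarrow> continuous_on A (\<lambda>t. lll_field k (x t))"
  unfolding lll_field_def
  by (intro bounded_linear.continuous_on[OF bounded_linear_mult_neg_i]
      bounded_bilinear.continuous_on[OF R.bounded_bilinear_Bcorr]
      bounded_bilinear.continuous_on[OF S.bounded_bilinear_Bconv])

lemma lll_field_lipschitz:
  assumes "norm x \<le> r" "norm y \<le> r"
  shows "norm (lll_field k x - lll_field k y) \<le> 3 * sqrt (3 ^ (k * k)) * r\<^sup>2 * norm (x - y)"
proof -
  interpret S': bounded_bilinear "S.Bconv k" by (rule S.bounded_bilinear_Bconv)
  interpret R': bounded_bilinear "R.Bcorr k" by (rule R.bounded_bilinear_Bcorr)
  interpret J: bounded_linear mult_neg_i by (rule bounded_linear_mult_neg_i)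
  let ?S = "S.Bconv k" and ?R = "R.Bcorr k" and ?c = "sqrt (3 ^ (k * k)) :: real" and ?d = "norm (x - y)"
  have r: "r \<ge> 0" using assms norm_ge_zero order_trans by blast
  have RS: "norm (?R a (?S b c)) \<le> ?c * (norm a * norm b * norm c)" for a b c
  proof -
    have "norm (?R a (?S b c)) \<le> norm a * norm (?S b c)" using R.norm_Bcorr_le[of k a "?S b c"] by simp
    also have "\<dots> \<le> norm a * (?c * (norm b * norm c))" by (intro mult_left_mono S.norm_Bconv_le) auto
    finally show ?thesis by (simp add: mult_ac)
  qed
  have eq: "lll_field k x - lll_field k y = mult_neg_i (?R (x - y) (?S x x) + ?R y (?S (x - y) x) + ?R y (?S y (x - y)))"
    unfolding lll_field_def J.diff[symmetric]
    by (simp add: S'.diff_left S'.diff_right R'.diff_left R'.diff_right)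
  have "norm (lll_field k x - lll_field k y)
      \<le> norm (?R (x - y) (?S x x)) + norm (?R y (?S (x - y) x)) + norm (?R y (?S y (x - y)))"
    unfolding eq norm_mult_neg_i
    using norm_triangle_ineq[of "?R (x - y) (?S x x) + ?R y (?S (x - y) x)" "?R y (?S y (x - y))"]
      norm_triangle_ineq[of "?R (x - y) (?S x x)" "?R y (?S (x - y) x)"] by linarith
  also have "\<dots> \<le> ?c * (?d * norm x * norm x) + ?c * (norm y * ?d * norm x) + ?c * (norm y * norm y * ?d)"
    by (intro add_mono RS)
  also have "\<dots> \<le> ?c * (?d * r * r) + ?c * (r * ?d * r) + ?c * (r * r * ?d)"
    using assms r by (intro add_mono mult_left_mono mult_mono mult_nonneg_nonneg) auto
  also have "\<dots> = 3 * ?c * r\<^sup>2 * ?d" by (simp add: power2_eq_square algebra_simps)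
  finally show ?thesis .
qed

text \<open>Truncation to the ball of radius \<open>r\<close> by a real factor. As the vector field is homogeneous, this
  only changes its length.\<close>
definition retract :: "real \<Rightarrow> 'a::real_normed_vector \<Rightarrow> 'a" where
  "retract r x = (r / max r (norm x)) *\<^sub>R x"

lemma retract_id: "r > 0 \<Longrightarrow> norm x \<le> r \<Longrightarrow> retract r x = x"
  by (simp add: retract_def max_def)

lemma retract_outside: "norm x > r \<Longrightarrow> retract r x = (r / norm x) *\<^sub>R x"
  by (simp add: retract_def max_def)

lemma norm_retract_le: "r > 0 \<Longrightarrow> norm (retract r x) \<le> r"
  by (cases "norm x \<le> r") (auto simp: retract_id retract_outside)

lemma retract_lipschitz:
  fixes x y :: "'a::real_normed_vector"
  assumes r: "r > 0"
  shows "norm (retract r x - retract r y) \<le> 2 * norm (x - y)"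
proof -
  have mixed: "norm (retract r x - retract r y) \<le> 2 * norm (x - y)" if "norm x > r" "norm y \<le> r" for x y :: 'a
  proof -
    have eq: "retract r x - retract r y = (x - y) - (1 - r / norm x) *\<^sub>R x"
      using that r by (simp add: retract_id retract_outside algebra_simps)
    have "norm (retract r x - retract r y) \<le> norm (x - y) + norm ((1 - r / norm x) *\<^sub>R x)"
      unfolding eq by (rule norm_triangle_ineq4)
    also have "norm ((1 - r / norm x) *\<^sub>R x) = norm x - r"
    proof -
      have pos: "norm x > 0" "0 \<le> 1 - r / norm x" using that r by (auto simp: divide_le_eq)
      show ?thesis
        unfolding norm_scaleR abs_of_nonneg[OF pos(2)] left_diff_distrib using pos(1) by simp
    qed
    also have "norm x - r \<le> norm (x - y)" using that norm_triangle_ineq2[of x y] by linarith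
    finally show ?thesis by simp
  qed
  consider "norm x \<le> r" "norm y \<le> r" | "norm x > r" "norm y \<le> r" | "norm x \<le> r" "norm y > r" | "norm x > r" "norm y > r"
    by linarith
  then show ?thesis
  proof cases
    case 1 then show ?thesis using r by (simp add: retract_id)
  next
    case 2 then show ?thesis by (rule mixed)
  next
    case 3 then show ?thesis using mixed[of y x] by (simp add: norm_minus_commute)
  next
    case 4
    have pos: "norm x > 0" "norm y > 0" using 4 r by linarith+
    have "retract r x - retract r y = (r / norm x) *\<^sub>R (x - y) + (r / norm x - r / norm y) *\<^sub>R y"
      using 4 by (simp add: retract_outside algebra_simps)
    then have "norm (retract r x - retract r y) \<le> \<bar>r / norm x\<bar> * norm (x - y) + \<bar>r / norm x - r / norm y\<bar> * norm y"
      by (metis norm_triangle_ineq norm_scaleR)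
    also have "\<bar>r / norm x - r / norm y\<bar> * norm y = r / norm x * \<bar>norm y - norm x\<bar>"
    proof -
      have "r / norm x - r / norm y = r * (norm y - norm x) / (norm x * norm y)"
        using pos by (simp add: field_simps)
      then show ?thesis using pos r by (simp add: abs_mult)
    qed
    also have "\<bar>r / norm x\<bar> * norm (x - y) + r / norm x * \<bar>norm y - norm x\<bar> \<le> 1 * norm (x - y) + 1 * norm (x - y)"
      using 4 r pos norm_triangle_ineq3[of y x]
      by (intro add_mono mult_mono) (auto simp: norm_minus_commute)
    finally show ?thesis by simp
  qed
qed

lemma energy_has_derivative:
  assumes "j \<le> k" "(x has_vector_derivative x') (at t)"
  shows "((\<lambda>t. energy j k (x t)) has_real_derivative 2 * inner (energy_op j k (x t)) x') (at t)"
proof -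
  have "((\<lambda>t. energy_op j k (x t)) has_vector_derivative energy_op j k x') (at t)"
    by (rule bounded_linear.has_vector_derivative[OF bounded_linear_energy_op[OF assms(1)] assms(2)])
  from bounded_bilinear.has_vector_derivative[OF bounded_bilinear_inner this assms(2)]
  have "((\<lambda>t. energy j k (x t)) has_vector_derivative
      inner (energy_op j k (x t)) x' + inner (energy_op j k x') (x t)) (at t)"
    unfolding energy_def .
  moreover have "inner (energy_op j k x') (x t) = inner (energy_op j k (x t)) x'"
    by (simp only: energy_op_symmetric[OF assms(1), of x' "x t"] inner_commute[of x'])
  ultimately show ?thesis
    by (simp add: has_real_derivative_iff_has_vector_derivative)
qed

lemma derivative_zero_const:
  fixes q :: "real \<Rightarrow> real"
  assumes "\<And>t. (q has_real_derivative 0) (at t)"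
  shows "q t = q 0"
  using DERIV_isconst_all assms by blast

text \<open>The rate relative to the squared norm is a multiple of the conserved mass. Along a solution, the
  norm of order \<open>k\<close> therefore grows at most exponentially.\<close>
lemma norm_rate_le:
  "\<exists>C\<ge>0. \<forall>x. \<bar>inner x (lll_field k x)\<bar> \<le> C * energy 0 k x * (norm x)\<^sup>2"
proof (cases "k \<ge> 2")
  case True
  obtain C where C: "C \<ge> 0" "\<And>x. \<bar>inner (energy_op k k x) (lll_field k x)\<bar> \<le> C * (energy 0 k x * energy (k - 1) k x)"
    using energy_rate_le_mass[OF True] by blast
  have "\<bar>inner x (lll_field k x)\<bar> \<le> C * energy 0 k x * (norm x)\<^sup>2" for x
  proof -
    have "\<bar>inner x (lll_field k x)\<bar> \<le> C * (energy 0 k x * energy (k - 1) k x)" using C(2)[of x] by (simp add: energy_op_same)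
    also have "\<dots> \<le> C * (energy 0 k x * energy k k x)"
      by (intro mult_left_mono energy_mono energy_nonneg C) auto
    finally show ?thesis by (simp add: energy_same)
  qed
  then show ?thesis using C(1) by blast
next
  case False
  have "inner x (lll_field k x) = 0" for x using energy_conserved[of k k x] False by (simp add: energy_op_same)
  then show ?thesis by (intro exI[of _ 0]) simp
qed

text \<open>The truncation radius grows in time exactly as fast as the a priori bound. The truncated
  equation conserves mass as well, because its vector field is a real multiple of the original one,
  and the a priori bound holds for it for the same reason. Hence its solution is never truncated.\<close>
theorem lll_flow_exists:
  "\<exists>x. x 0 = x0 \<and> (\<forall>t. (x has_vector_derivative lll_field k (x t)) (at t))"
proof -
  obtain C where C: "C \<ge> 0" "\<And>x. \<bar>inner x (lll_field k x)\<bar> \<le> C * energy 0 k x * (norm x)\<^sup>2"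
    using norm_rate_le by blast
  define K where "K = C * energy 0 k x0"
  have K: "K \<ge> 0" using C energy_nonneg[of 0 k x0] by (simp add: K_def)
  \<comment> \<open>the summand 1 keeps the radius positive for \<open>x0 = 0\<close>\<close>
  define r where "r t = (norm x0 + 1) * exp (K * \<bar>t\<bar>)" for t
  have r: "r t > 0" for t by (simp add: r_def add_nonneg_pos)
  define G where "G t x = lll_field k (retract (r t) x)" for t x
  have "\<exists>x. x 0 = x0 \<and> (\<forall>t. (x has_vector_derivative G t (x t)) (at t))"
  proof (rule picard_global)
    fix x :: "real \<Rightarrow> ell2" assume x: "continuous_on UNIV x"
    have "max (r t) (norm (x t)) \<noteq> 0" for t using r[of t] by linarith
    then show "continuous_on UNIV (\<lambda>t. G t (x t))"
      unfolding G_def retract_def r_def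
      by (intro continuous_on_lll_field continuous_intros x) (auto simp: r_def)
  next
    fix T :: real
    define M where "M = (norm x0 + 1) * exp (K * T)"
    show "\<exists>L\<ge>0. \<forall>t x y. \<bar>t\<bar> \<le> T \<longrightarrow> norm (G t x - G t y) \<le> L * norm (x - y)"
    proof (intro exI[of _ "3 * sqrt (3 ^ (k * k)) * M\<^sup>2 * 2"] conjI allI impI)
      fix t and x y :: ell2 assume t: "\<bar>t\<bar> \<le> T"
      have rM: "r t \<le> M" unfolding r_def M_def using t K by (intro mult_left_mono) (auto intro: mult_left_mono)
      have "norm (G t x - G t y) \<le> 3 * sqrt (3 ^ (k * k)) * M\<^sup>2 * norm (retract (r t) x - retract (r t) y)"
        unfolding G_def using order_trans[OF norm_retract_le[OF r] rM] by (intro lll_field_lipschitz)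
      also have "\<dots> \<le> 3 * sqrt (3 ^ (k * k)) * M\<^sup>2 * (2 * norm (x - y))"
        by (intro mult_left_mono retract_lipschitz r) simp
      finally show "norm (G t x - G t y) \<le> 3 * sqrt (3 ^ (k * k)) * M\<^sup>2 * 2 * norm (x - y)" by simp
    qed simp
  qed
  then obtain x where x: "x 0 = x0" "\<And>t. (x has_vector_derivative G t (x t)) (at t)" by blast
  define l where "l t = (r t / max (r t) (norm (x t))) ^ 3" for t
  have G: "G t (x t) = l t *\<^sub>R lll_field k (x t)" for t
    by (simp add: G_def retract_def lll_field_scale l_def)
  have l: "0 \<le> l t" "l t \<le> 1" for t
    using r[of t] by (auto simp: l_def intro!: power_le_one)
  have E0: "energy 0 k (x t) = energy 0 k x0" for t
    using derivative_zero_const[of "\<lambda>t. energy 0 k (x t)" t] energy_has_derivative[OF _ x(2), of 0 k]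
    by (simp add: G energy_conserved x(1))
  have "energy k k (x t) \<le> energy k k (x 0) * exp (2 * K * \<bar>t\<bar>)" for t
  proof (rule gronwall[where T = "\<bar>t\<bar>"])
    show "((\<lambda>t. energy k k (x t)) has_real_derivative 2 * inner (energy_op k k (x t)) (G t (x t))) (at t)" for t
      by (rule energy_has_derivative[OF _ x(2)]) simp
    fix t
    have "\<bar>2 * inner (energy_op k k (x t)) (G t (x t))\<bar> = l t * (2 * \<bar>inner (x t) (lll_field k (x t))\<bar>)"
      using l by (simp add: energy_op_same G abs_mult)
    also have "\<dots> \<le> 1 * (2 * (C * energy 0 k (x t) * (norm (x t))\<^sup>2))"
      using l C by (intro mult_mono) auto
    also have "\<dots> = 2 * K * energy k k (x t)" by (simp add: E0 K_def energy_same)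
    finally show "\<bar>2 * inner (energy_op k k (x t)) (G t (x t))\<bar> \<le> 2 * K * energy k k (x t)" .
  qed simp
  then have "(norm (x t))\<^sup>2 \<le> (norm x0 * exp (K * \<bar>t\<bar>))\<^sup>2" for t
    unfolding energy_same x(1) power_mult_distrib by (simp add: exp_double[symmetric] mult_ac)
  then have "norm (x t) \<le> norm x0 * exp (K * \<bar>t\<bar>)" for t
    by (rule power2_le_imp_le) simp
  then have "norm (x t) \<le> r t" for t
    unfolding r_def by (rule order_trans) (intro mult_right_mono, auto)
  then have "G t (x t) = lll_field k (x t)" for t
    unfolding G_def using r by (simp add: retract_id)
  then show ?thesis using x by auto
qed

theorem lll_flow_unique:
  assumes x: "\<And>t. (x has_vector_derivative lll_field k (x t)) (at t)"
    and y: "\<And>t. (y has_vector_derivative lll_field k (y t)) (at t)" and "x 0 = y 0"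
  shows "x t = y t"
proof -
  let ?T = "\<bar>t\<bar>"
  have "compact (z ` {-?T..?T})" if "\<And>t. (z has_vector_derivative lll_field k (z t)) (at t)" for z
    by (intro compact_continuous_image continuous_on_subset[OF has_vector_derivative_continuous_on[OF that]]) auto
  then have "compact (x ` {-?T..?T})" "compact (y ` {-?T..?T})" using x y by blast+
  then have "bounded (x ` {-?T..?T} \<union> y ` {-?T..?T})" by (simp add: compact_imp_bounded)
  then obtain M where M: "\<forall>z \<in> x ` {-?T..?T} \<union> y ` {-?T..?T}. norm z \<le> M" unfolding bounded_iff by blast
  define L where "L = 3 * sqrt (3 ^ (k * k)) * M\<^sup>2"
  define q where "q t = inner (x t - y t) (x t - y t)" for t
  have "q t \<le> q 0 * exp (2 * L * \<bar>t\<bar>)"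
  proof (rule gronwall[where T = ?T])
    fix s
    have d: "((\<lambda>t. x t - y t) has_vector_derivative lll_field k (x s) - lll_field k (y s)) (at s)"
      by (intro has_vector_derivative_diff x y)
    show "(q has_real_derivative 2 * inner (x s - y s) (lll_field k (x s) - lll_field k (y s))) (at s)"
      using bounded_bilinear.has_vector_derivative[OF bounded_bilinear_inner d d]
      unfolding q_def[abs_def] has_real_derivative_iff_has_vector_derivative by (simp add: inner_commute)
    assume s: "\<bar>s\<bar> \<le> ?T"
    then have s': "s \<in> {-?T..?T}" by auto
    have "\<bar>inner (x s - y s) (lll_field k (x s) - lll_field k (y s))\<bar>
        \<le> norm (x s - y s) * norm (lll_field k (x s) - lll_field k (y s))" by (rule Cauchy_Schwarz_ineq2)
    also have "\<dots> \<le> norm (x s - y s) * (L * norm (x s - y s))"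
      unfolding L_def using M s' by (intro mult_left_mono lll_field_lipschitz) auto
    also have "\<dots> = L * q s" by (simp add: q_def power2_norm_eq_inner[symmetric] power2_eq_square)
    finally show "\<bar>2 * inner (x s - y s) (lll_field k (x s) - lll_field k (y s))\<bar> \<le> 2 * L * q s" by simp
  qed simp
  then have "q t \<le> 0" using assms(3) by (simp add: q_def)
  then show ?thesis using inner_ge_zero[of "x t - y t"] by (simp add: q_def)
qed

text \<open>Differentiability of finite order, in a form that is inherited by products without writing out the
  Leibniz formula. It suits bootstrapping: if the right hand side of \<open>x' = F x\<close> is differentiable to
  order \<open>n\<close>, then \<open>x\<close> is to order \<open>n + 1\<close>.\<close>
primrec differentiable_order :: "nat \<Rightarrow> (real \<Rightarrow> 'a::real_normed_vector) \<Rightarrow> bool" where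
  "differentiable_order 0 x \<longleftrightarrow> True"
| "differentiable_order (Suc n) x \<longleftrightarrow>
     (\<exists>x'. (\<forall>t. (x has_vector_derivative x' t) (at t)) \<and> differentiable_order n x')"

lemma differentiable_order_Suc_D: "differentiable_order (Suc n) x \<Longrightarrow> differentiable_order n x"
proof (induction n arbitrary: x)
  case (Suc n)
  then obtain x' where "\<forall>t. (x has_vector_derivative x' t) (at t)" "differentiable_order (Suc n) x'" by auto
  with Suc.IH[of x'] show ?case by auto
qed simp

lemma differentiable_order_add:
  "differentiable_order n x \<Longrightarrow> differentiable_order n y \<Longrightarrow> differentiable_order n (\<lambda>t. x t + y t)"
proof (induction n arbitrary: x y)
  case (Suc n)
  then obtain x' y' where "\<forall>t. (x has_vector_derivative x' t) (at t)" "differentiable_order n x'"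
    "\<forall>t. (y has_vector_derivative y' t) (at t)" "differentiable_order n y'" by auto
  with Suc.IH[of x' y'] show ?case
    by (auto intro!: exI[of _ "\<lambda>t. x' t + y' t"] has_vector_derivative_add)
qed simp

lemma (in bounded_bilinear) differentiable_order_prod:
  "differentiable_order n x \<Longrightarrow> differentiable_order n y \<Longrightarrow> differentiable_order n (\<lambda>t. prod (x t) (y t))"
proof (induction n arbitrary: x y)
  case (Suc n)
  then obtain x' y' where d: "\<forall>t. (x has_vector_derivative x' t) (at t)" "differentiable_order n x'"
    "\<forall>t. (y has_vector_derivative y' t) (at t)" "differentiable_order n y'" by auto
  have "differentiable_order n (\<lambda>t. prod (x t) (y' t) + prod (x' t) (y t))"
    using d differentiable_order_Suc_D[OF Suc.prems(1)] differentiable_order_Suc_D[OF Suc.prems(2)]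
    by (intro differentiable_order_add Suc.IH) auto
  moreover have "((\<lambda>t. prod (x t) (y t)) has_vector_derivative prod (x t) (y' t) + prod (x' t) (y t)) (at t)" for t
    using d by (intro has_vector_derivative) auto
  ultimately show ?case
    by (auto intro!: exI[of _ "\<lambda>t. prod (x t) (y' t) + prod (x' t) (y t)"])
qed simp

lemma (in bounded_linear) differentiable_order_comp:
  "differentiable_order n x \<Longrightarrow> differentiable_order n (\<lambda>t. f (x t))"
proof (induction n arbitrary: x)
  case (Suc n)
  then obtain x' where "\<forall>t. (x has_vector_derivative x' t) (at t)" "differentiable_order n x'" by auto
  with Suc.IH[of x'] show ?case
    by (auto intro!: exI[of _ "\<lambda>t. f (x' t)"] has_vector_derivative)
qed simp

lemma derivative_tower:
  assumes "\<And>n. differentiable_order n x"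
  shows "\<exists>V. V 0 = x \<and> (\<forall>n t. (V n has_vector_derivative V (Suc n) t) (at t))"
proof -
  define V where "V n = ((\<lambda>u t. vector_derivative u (at t)) ^^ n) x" for n
  have step: "(u has_vector_derivative vector_derivative u (at t)) (at t)"
      "differentiable_order n (\<lambda>t. vector_derivative u (at t))"
    if u: "differentiable_order (Suc n) u" for n and u :: "real \<Rightarrow> 'a" and t
  proof -
    obtain u' where u': "\<forall>t. (u has_vector_derivative u' t) (at t)" "differentiable_order n u'" using u by auto
    then have "(\<lambda>t. vector_derivative u (at t)) = u'" by (auto intro: vector_derivative_at)
    then show "(u has_vector_derivative vector_derivative u (at t)) (at t)"
      "differentiable_order n (\<lambda>t. vector_derivative u (at t))" using u' by (auto simp: fun_eq_iff)
  qed
  have "differentiable_order m (V n)" for n m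
  proof (induction n arbitrary: m)
    case (Suc n)
    show ?case using step(2)[OF Suc.IH[of "Suc m"]] by (simp add: V_def)
  qed (simp add: V_def assms)
  then have "(V n has_vector_derivative V (Suc n) t) (at t)" for n t
    using step(1)[of 0 "V n" t] by (simp add: V_def)
  moreover have "V 0 = x" by (simp add: V_def)
  ultimately show ?thesis by blast
qed

lemma lll_flow_smooth:
  assumes x: "\<And>t. (x has_vector_derivative lll_field k (x t)) (at t)"
  shows "\<exists>V. V 0 = x \<and> (\<forall>n t. (V n has_vector_derivative V (Suc n) t) (at t))"
proof (rule derivative_tower)
  fix n show "differentiable_order n x"
  proof (induction n)
    case (Suc n)
    then have "differentiable_order n (\<lambda>t. lll_field k (x t))"
      unfolding lll_field_def
      by (intro bounded_linear.differentiable_order_comp[OF bounded_linear_mult_neg_i]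
        bounded_bilinear.differentiable_order_prod[OF R.bounded_bilinear_Bcorr]
        bounded_bilinear.differentiable_order_prod[OF S.bounded_bilinear_Bconv])
    then show ?case
      unfolding differentiable_order.simps using x by (intro exI[of _ "\<lambda>t. lll_field k (x t)"]) blast
  qed simp
qed

section \<open>Growth of the energies along the flow\<close>

definition lll_flow :: "nat \<Rightarrow> (real \<Rightarrow> ell2) \<Rightarrow> bool" where
  "lll_flow k x \<longleftrightarrow> (\<forall>t. (x has_vector_derivative lll_field k (x t)) (at t))"

lemma lll_flow_energy_derivative:
  "lll_flow k x \<Longrightarrow> j \<le> k \<Longrightarrow>
    ((\<lambda>t. energy j k (x t)) has_real_derivative 2 * inner (energy_op j k (x t)) (lll_field k (x t))) (at t)"
  unfolding lll_flow_def by (intro energy_has_derivative) auto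

lemma lll_flow_energy_const:
  assumes "lll_flow k x" "j \<le> k" "j < 2"
  shows "energy j k (x t) = energy j k (x 0)"
proof (rule derivative_zero_const[of "\<lambda>t. energy j k (x t)"])
  show "((\<lambda>t. energy j k (x t)) has_real_derivative 0) (at t)" for t
    using lll_flow_energy_derivative[OF assms(1,2), of t] energy_conserved[OF assms(2,3), of "x t"] by simp
qed

lemma energy_interpolation:
  assumes "3 \<le> k"
  shows "(energy 2 k x)\<^sup>2 \<le> energy 1 k x * energy 3 k x"
proof -
  define c where "c n = cmod (fock_coeff k x n)" for n
  have s: "(\<lambda>n. fock_weight j n * (c n)\<^sup>2) sums energy j k x" if "j \<le> k" for j
    unfolding c_def by (rule energy_sums[OF that])
  have w: "(fock_weight 2 n)\<^sup>2 \<le> fock_weight 1 n * fock_weight 3 n" for n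
    by (simp add: numeral_2_eq_2 numeral_3_eq_3 power2_eq_square algebra_simps)
  have part: "(\<Sum>n<N. fock_weight j n * (c n)\<^sup>2) \<le> energy j k x" if "j \<le> k" for j N
    using s[OF that] by (metis (no_types, lifting) fock_weight_nonneg mult_nonneg_nonneg sum_le_suminf finite_lessThan
      sums_iff zero_le_power2)
  have "(\<Sum>n<N. fock_weight 2 n * (c n)\<^sup>2) \<le> sqrt (energy 1 k x * energy 3 k x)" for N
  proof -
    have "(\<Sum>n<N. fock_weight 2 n * (c n)\<^sup>2) \<le> (\<Sum>n<N. (sqrt (fock_weight 1 n) * c n) * (sqrt (fock_weight 3 n) * c n))"
    proof (rule sum_mono)
      fix n
      have "fock_weight 2 n \<le> sqrt (fock_weight 1 n * fock_weight 3 n)" by (rule real_le_rsqrt[OF w])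
      then have "fock_weight 2 n * (c n)\<^sup>2 \<le> sqrt (fock_weight 1 n * fock_weight 3 n) * (c n)\<^sup>2"
        by (rule mult_right_mono) simp
      then show "fock_weight 2 n * (c n)\<^sup>2 \<le> (sqrt (fock_weight 1 n) * c n) * (sqrt (fock_weight 3 n) * c n)"
        by (simp only: real_sqrt_mult power2_eq_square mult_ac)
    qed
    also have "\<dots> \<le> sqrt ((\<Sum>n<N. (sqrt (fock_weight 1 n) * c n)\<^sup>2) * (\<Sum>n<N. (sqrt (fock_weight 3 n) * c n)\<^sup>2))"
      by (rule real_le_rsqrt[OF Cauchy_Schwarz_ineq_sum])
    also have "\<dots> \<le> sqrt (energy 1 k x * energy 3 k x)"
      unfolding power_mult_distrib real_sqrt_pow2[OF fock_weight_nonneg]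
      using assms energy_nonneg by (intro real_sqrt_le_mono mult_mono part) (auto intro!: sum_nonneg simp del: fock_weight.simps)
    finally show ?thesis .
  qed
  then have "energy 2 k x \<le> sqrt (energy 1 k x * energy 3 k x)"
    using s[of 2] assms by (intro LIMSEQ_le_const2[of "\<lambda>N. \<Sum>n<N. fock_weight 2 n * (c n)\<^sup>2"]) (auto simp: sums_def)
  then have "(energy 2 k x)\<^sup>2 \<le> (sqrt (energy 1 k x * energy 3 k x))\<^sup>2"
    using energy_nonneg[of 2 k x] assms by (intro power_mono) auto
  then show ?thesis using energy_nonneg[of 1 k x] energy_nonneg[of 3 k x] assms by simp
qed

lemma le_mult_powr_from_square:
  fixes a b B q :: real
  assumes "a\<^sup>2 \<le> b\<^sup>2 * B powr (2 * q)" "b \<ge> 0"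
  shows "a \<le> b * B powr q"
proof (rule power2_le_imp_le)
  have "(b * B powr q)\<^sup>2 = b\<^sup>2 * B powr (2 * q)"
    by (simp add: power_mult_distrib power2_eq_square powr_add[symmetric])
  then show "a\<^sup>2 \<le> (b * B powr q)\<^sup>2" using assms(1) by simp
qed (use assms(2) in simp)

lemma growth_weight_two:
  "\<exists>C\<ge>0. \<forall>k x t. 2 \<le> k \<longrightarrow> lll_flow k x \<longrightarrow>
     energy 2 k (x t) \<le> energy 2 k (x 0) * (1 + C * energy 0 k (x 0) * \<bar>t\<bar>)"
proof -
  obtain C where C: "C \<ge> 0" "\<And>k x. 2 \<le> k \<Longrightarrow>
    \<bar>inner (energy_op 2 k x) (lll_field k x)\<bar> \<le> C * (energy 0 k x * energy 1 k x)"
    using energy_rate_le_mass[of 2] by auto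
  have "energy 2 k (x t) \<le> energy 2 k (x 0) * (1 + 2 * C * energy 0 k (x 0) * \<bar>t\<bar>)"
    if k: "2 \<le> k" and x: "lll_flow k x" for k x t
  proof -
    let ?r = "2 * C * (energy 0 k (x 0) * energy 1 k (x 0))"
    have "energy 2 k (x t) \<le> energy 2 k (x 0) + (?r * \<bar>t\<bar> - ?r * 0)"
    proof (rule growth_le[where \<psi>' = "\<lambda>_. ?r"])
      show "((\<lambda>t. energy 2 k (x t)) has_real_derivative 2 * inner (energy_op 2 k (x t)) (lll_field k (x t))) (at t)" for t
        by (rule lll_flow_energy_derivative[OF x k])
      show "((\<lambda>t. ?r * t) has_real_derivative ?r) (at t)" for t by (auto intro!: derivative_eq_intros)
      show "\<bar>2 * inner (energy_op 2 k (x t)) (lll_field k (x t))\<bar> \<le> ?r" for t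
        using C(2)[OF k, of "x t"] lll_flow_energy_const[OF x, of 0 t] lll_flow_energy_const[OF x, of 1 t] k
        by (simp add: abs_mult)
    qed
    also have "?r * \<bar>t\<bar> \<le> 2 * C * (energy 0 k (x 0) * energy 2 k (x 0)) * \<bar>t\<bar>"
      using k C(1) by (intro mult_right_mono mult_left_mono energy_mono energy_nonneg) auto
    finally show ?thesis by (simp add: algebra_simps)
  qed
  then show ?thesis using C(1) by (intro exI[of _ "2 * C"]) auto
qed

text \<open>Since \<open>energy 1\<close> is conserved, the rate of change of \<open>energy j\<close> is controlled by \<open>energy (j - 2)\<close>,
  whose bound has the exponent \<open>(j - 3) / 2\<close>, and integration raises this exponent by one. The induction
  starts with \<open>energy 1\<close> for odd \<open>j\<close>; for \<open>j = 4\<close> the bound on \<open>energy 2\<close> comes from interpolation with the case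
  \<open>j = 3\<close>.\<close>
lemma growth_weight_ge_three:
  assumes "3 \<le> j"
  shows "\<exists>C\<ge>0. \<forall>k x t. j \<le> k \<longrightarrow> lll_flow k x \<longrightarrow>
     energy j k (x t) \<le> energy j k (x 0) * (1 + C * energy 1 k (x 0) * \<bar>t\<bar>) powr ((real j - 1) / 2)"
  using assms
proof (induction j rule: less_induct)
  case (less j)
  obtain C where C: "C \<ge> 0" "\<And>k x. j \<le> k \<Longrightarrow>
    \<bar>inner (energy_op j k x) (lll_field k x)\<bar> \<le> C * (energy 1 k x * energy (j - 2) k x)"
    using energy_rate_le_momentum[OF less.prems] by blast
  have "\<exists>D\<ge>0. \<forall>k x t. j \<le> k \<longrightarrow> lll_flow k x \<longrightarrow>
     energy (j - 2) k (x t) \<le> energy j k (x 0) * (1 + D * energy 1 k (x 0) * \<bar>t\<bar>) powr ((real j - 3) / 2)"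
  proof -
    consider "j = 3" | "j = 4" | "j \<ge> 5" using less.prems by linarith
    then show ?thesis
    proof cases
      case 1
      have "energy 1 k (x t) \<le> energy 3 k (x 0)" if "3 \<le> k" "lll_flow k x" for k x t
        using lll_flow_energy_const[OF that(2), of 1 t] energy_mono[of 1 3 k "x 0"] that by simp
      then show ?thesis using 1 by (intro exI[of _ 0]) auto
    next
      case 2
      obtain D where D: "D \<ge> 0" "\<And>k x t. 3 \<le> k \<Longrightarrow> lll_flow k x \<Longrightarrow>
         energy 3 k (x t) \<le> energy 3 k (x 0) * (1 + D * energy 1 k (x 0) * \<bar>t\<bar>) powr 1"
        using less.IH[of 3] 2 by auto
      have "energy 2 k (x t) \<le> energy 4 k (x 0) * (1 + D * energy 1 k (x 0) * \<bar>t\<bar>) powr (1 / 2)"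
        if k: "4 \<le> k" and x: "lll_flow k x" for k x t
      proof (rule le_mult_powr_from_square)
        let ?B = "1 + D * energy 1 k (x 0) * \<bar>t\<bar>"
        have "(energy 2 k (x t))\<^sup>2 \<le> energy 1 k (x t) * energy 3 k (x t)"
          using k by (intro energy_interpolation) auto
        also have "\<dots> \<le> energy 4 k (x 0) * (energy 4 k (x 0) * ?B powr 1)"
        proof (intro mult_mono)
          show "energy 1 k (x t) \<le> energy 4 k (x 0)"
            using lll_flow_energy_const[OF x, of 1 t] energy_mono[of 1 4 k "x 0"] k by simp
          show "energy 3 k (x t) \<le> energy 4 k (x 0) * ?B powr 1"
          proof -
            have "energy 3 k (x t) \<le> energy 3 k (x 0) * ?B powr 1" by (rule D(2)[OF _ x]) (use k in simp)
            also have "\<dots> \<le> energy 4 k (x 0) * ?B powr 1" using k by (intro mult_right_mono energy_mono) auto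
            finally show ?thesis .
          qed
        qed (use k energy_nonneg in auto)
        finally show "(energy 2 k (x t))\<^sup>2 \<le> (energy 4 k (x 0))\<^sup>2 * ?B powr (2 * (1 / 2))"
          by (simp add: power2_eq_square)
        show "0 \<le> energy 4 k (x 0)" using k by (intro energy_nonneg)
      qed
      then show ?thesis using 2 D(1) by (intro exI[of _ D]) auto
    next
      case 3
      then have j2: "real (j - 2) - 1 = real j - 3" and j_less: "j - 2 < j" "3 \<le> j - 2" by auto
      obtain D where D: "D \<ge> 0" "\<And>k x t. j - 2 \<le> k \<Longrightarrow> lll_flow k x \<Longrightarrow>
         energy (j - 2) k (x t) \<le> energy (j - 2) k (x 0) * (1 + D * energy 1 k (x 0) * \<bar>t\<bar>) powr ((real (j - 2) - 1) / 2)"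
        using less.IH[of "j - 2", OF j_less] by blast
      have "energy (j - 2) k (x t) \<le> energy j k (x 0) * (1 + D * energy 1 k (x 0) * \<bar>t\<bar>) powr ((real j - 3) / 2)"
        if k: "j \<le> k" and x: "lll_flow k x" for k x t
      proof -
        have "energy (j - 2) k (x t) \<le> energy (j - 2) k (x 0) * (1 + D * energy 1 k (x 0) * \<bar>t\<bar>) powr ((real j - 3) / 2)"
          using D(2)[OF _ x, of t] k unfolding j2 by simp
        also have "\<dots> \<le> energy j k (x 0) * (1 + D * energy 1 k (x 0) * \<bar>t\<bar>) powr ((real j - 3) / 2)"
          using k by (intro mult_right_mono energy_mono) auto
        finally show ?thesis .
      qed
      then show ?thesis using D(1) by blast
    qed
  qed
  then obtain D where D: "D \<ge> 0" "\<And>k x t. j \<le> k \<Longrightarrow> lll_flow k x \<Longrightarrow>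
     energy (j - 2) k (x t) \<le> energy j k (x 0) * (1 + D * energy 1 k (x 0) * \<bar>t\<bar>) powr ((real j - 3) / 2)"
    by blast
  define A where "A = D + 2 * C"
  have A: "A \<ge> 0" "D \<le> A" "2 * C \<le> A" using C(1) D(1) by (auto simp: A_def)
  have "energy j k (x t) \<le> energy j k (x 0) * (1 + A * energy 1 k (x 0) * \<bar>t\<bar>) powr ((real j - 1) / 2)"
    if k: "j \<le> k" and x: "lll_flow k x" for k x t
  proof -
    define e E p where "e = energy 1 k (x 0)" and "E = energy j k (x 0)" and "p = (real j - 1) / 2"
    have e: "e \<ge> 0" and E: "E \<ge> 0" unfolding e_def E_def using k less.prems by (auto intro!: energy_nonneg)
    have p: "p \<ge> 1" "p - 1 = (real j - 3) / 2" using less.prems by (auto simp: p_def field_simps)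
    define \<psi> where "\<psi> t = E * (1 + A * e * t) powr p" for t
    have "energy j k (x t) \<le> energy j k (x 0) + (\<psi> \<bar>t\<bar> - \<psi> 0)"
    proof (rule growth_le[where \<psi>' = "\<lambda>t. E * (p * (1 + A * e * t) powr (p - 1) * (A * e))"])
      show "((\<lambda>t. energy j k (x t)) has_real_derivative 2 * inner (energy_op j k (x t)) (lll_field k (x t))) (at t)" for t
        by (rule lll_flow_energy_derivative[OF x k])
      show "(\<psi> has_real_derivative E * (p * (1 + A * e * t) powr (p - 1) * (A * e))) (at t)" if "t \<ge> 0" for t
      proof -
        have pos: "1 + A * e * t > 0" using A e that by (intro add_pos_nonneg mult_nonneg_nonneg) auto
        have "((\<lambda>t. 1 + A * e * t) has_real_derivative A * e) (at t)" by (auto intro!: derivative_eq_intros)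
        from DERIV_cmult[OF DERIV_chain2[OF has_real_derivative_powr[OF pos] this]]
        show ?thesis unfolding \<psi>_def[abs_def] .
      qed
      fix t
      have "\<bar>2 * inner (energy_op j k (x t)) (lll_field k (x t))\<bar> \<le> 2 * (C * (energy 1 k (x t) * energy (j - 2) k (x t)))"
        using C(2)[OF k, of "x t"] by (simp add: abs_mult)
      also have "energy 1 k (x t) = e" unfolding e_def using k less.prems by (intro lll_flow_energy_const[OF x]) auto
      also have "2 * (C * (e * energy (j - 2) k (x t))) \<le> 2 * (C * (e * (E * (1 + A * e * \<bar>t\<bar>) powr (p - 1))))"
      proof -
        have "energy (j - 2) k (x t) \<le> E * (1 + D * e * \<bar>t\<bar>) powr (p - 1)"
          unfolding p(2) e_def E_def by (rule D(2)[OF k x])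
        also have "\<dots> \<le> E * (1 + A * e * \<bar>t\<bar>) powr (p - 1)"
          using A e p D(1) by (intro mult_left_mono E powr_mono2 add_left_mono mult_right_mono add_nonneg_nonneg mult_nonneg_nonneg) auto
        finally show ?thesis using C(1) e by (intro mult_left_mono) auto
      qed
      also have "\<dots> = (2 * C) * (E * e * (1 + A * e * \<bar>t\<bar>) powr (p - 1))" by simp
      also have "\<dots> \<le> (p * A) * (E * e * (1 + A * e * \<bar>t\<bar>) powr (p - 1))"
      proof (rule mult_right_mono)
        have "1 * A \<le> p * A" using A p by (intro mult_right_mono) auto
        then show "2 * C \<le> p * A" using A by simp
      qed (use E e in auto)
      finally show "\<bar>2 * inner (energy_op j k (x t)) (lll_field k (x t))\<bar>
          \<le> E * (p * (1 + A * e * \<bar>t\<bar>) powr (p - 1) * (A * e))" by (simp add: mult_ac)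
    qed
    then show ?thesis by (simp add: \<psi>_def E_def e_def p_def)
  qed
  then show ?case using A(1) by blast
qed

section \<open>Rotations and radial integrals in the plane\<close>

lemma lborel_complex:
  "distr (lborel \<Otimes>\<^sub>M lborel) borel (\<lambda>(x, y). Complex x y) = (lborel :: complex measure)"
proof (rule lborel_eqI[symmetric])
  have [measurable]: "(\<lambda>(x, y). Complex x y) \<in> borel_measurable (lborel \<Otimes>\<^sub>M lborel)"
    unfolding lborel_prod by (simp add: case_prod_unfold, rule borel_measurable_continuous_onI)
      (auto intro!: continuous_intros simp: Complex_eq)
  fix l u :: complex assume lu: "\<And>b. b \<in> Basis \<Longrightarrow> l \<bullet> b \<le> u \<bullet> b"
  have le: "Re l \<le> Re u" "Im l \<le> Im u"
    using lu[of 1] lu[of \<i>] by (auto simp: Basis_complex_def)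
  have vim: "(\<lambda>(x, y). Complex x y) -` box l u \<inter> space (lborel \<Otimes>\<^sub>M lborel) = {Re l<..<Re u} \<times> {Im l<..<Im u}"
    by (auto simp: box_def Basis_complex_def space_pair_measure)
  have "emeasure (distr (lborel \<Otimes>\<^sub>M lborel) borel (\<lambda>(x, y). Complex x y)) (box l u)
     = emeasure lborel {Re l<..<Re u} * emeasure lborel {Im l<..<Im u}"
    by (subst emeasure_distr) (auto simp: vim lborel.emeasure_pair_measure_Times)
  also have "\<dots> = ennreal ((Re u - Re l) * (Im u - Im l))"
    using le by (simp add: ennreal_mult)
  finally show "emeasure (distr (lborel \<Otimes>\<^sub>M lborel) borel (\<lambda>(x, y). Complex x y)) (box l u)
      = (\<Prod>b\<in>Basis. (u - l) \<bullet> b)"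
    by (simp add: Basis_complex_def)
qed simp

lemma measurable_Complex [measurable]:
  "(\<lambda>p. Complex (fst p) (snd p)) \<in> borel_measurable (borel \<Otimes>\<^sub>M borel)"
  unfolding borel_prod by (rule borel_measurable_continuous_onI) (auto intro!: continuous_intros simp: Complex_eq)

lemma nn_integral_lborel_complex:
  fixes f :: "complex \<Rightarrow> ennreal"
  assumes [measurable]: "f \<in> borel_measurable borel"
  shows "(\<integral>\<^sup>+z. f z \<partial>lborel) = (\<integral>\<^sup>+x. \<integral>\<^sup>+y. f (Complex x y) \<partial>lborel \<partial>lborel)"
    and "(\<integral>\<^sup>+z. f z \<partial>lborel) = (\<integral>\<^sup>+y. \<integral>\<^sup>+x. f (Complex x y) \<partial>lborel \<partial>lborel)"
proof -
  have eq: "(\<integral>\<^sup>+z. f z \<partial>lborel) = (\<integral>\<^sup>+p. f (Complex (fst p) (snd p)) \<partial>(lborel \<Otimes>\<^sub>M lborel))"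
    by (subst lborel_complex[symmetric], subst nn_integral_distr) (auto simp: case_prod_unfold)
  show "(\<integral>\<^sup>+z. f z \<partial>lborel) = (\<integral>\<^sup>+x. \<integral>\<^sup>+y. f (Complex x y) \<partial>lborel \<partial>lborel)"
    unfolding eq by (subst lborel.nn_integral_fst[symmetric]) auto
  show "(\<integral>\<^sup>+z. f z \<partial>lborel) = (\<integral>\<^sup>+y. \<integral>\<^sup>+x. f (Complex x y) \<partial>lborel \<partial>lborel)"
    unfolding eq by (subst lborel_pair.nn_integral_snd[symmetric]) auto
qed

lemma nn_integral_shift_real:
  fixes f :: "real \<Rightarrow> ennreal"
  assumes [measurable]: "f \<in> borel_measurable borel"
  shows "(\<integral>\<^sup>+x. f (x + a) \<partial>lborel) = (\<integral>\<^sup>+x. f x \<partial>lborel)"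
  by (subst (2) lborel_distr_plus[of a, symmetric], subst nn_integral_distr) (auto simp: add.commute)

lemma nn_integral_shear:
  fixes f :: "complex \<Rightarrow> ennreal"
  assumes [measurable]: "f \<in> borel_measurable borel"
  shows "(\<integral>\<^sup>+z. f (z + of_real (a * Im z)) \<partial>lborel) = (\<integral>\<^sup>+z. f z \<partial>lborel)"
    and "(\<integral>\<^sup>+z. f (z + \<i> * of_real (a * Re z)) \<partial>lborel) = (\<integral>\<^sup>+z. f z \<partial>lborel)"
proof -
  have [measurable]: "(\<lambda>z. z + complex_of_real (a * Im z)) \<in> borel_measurable borel"
    "(\<lambda>z. z + \<i> * complex_of_real (a * Re z)) \<in> borel_measurable borel"
    by (intro borel_measurable_continuous_onI continuous_intros)+
  have Cm: "(\<lambda>x. Complex x y) \<in> borel_measurable borel" "(\<lambda>y. Complex x y) \<in> borel_measurable borel" for x y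
    by (intro borel_measurable_continuous_onI; auto intro!: continuous_intros simp: Complex_eq)+
  have e: "Complex x y + complex_of_real (a * y) = Complex (x + a * y) y" for x y
    by (simp add: complex_eq_iff)
  have "(\<integral>\<^sup>+z. f (z + of_real (a * Im z)) \<partial>lborel) = (\<integral>\<^sup>+y. \<integral>\<^sup>+x. f (Complex (x + a * y) y) \<partial>lborel \<partial>lborel)"
    by (subst nn_integral_lborel_complex(2), rule measurable_compose[OF _ assms], measurable, simp only: e complex.sel)
  also have "\<dots> = (\<integral>\<^sup>+y. \<integral>\<^sup>+x. f (Complex x y) \<partial>lborel \<partial>lborel)"
    by (intro nn_integral_cong nn_integral_shift_real measurable_compose[OF Cm(1) assms])
  also have "\<dots> = (\<integral>\<^sup>+z. f z \<partial>lborel)" by (rule nn_integral_lborel_complex(2)[OF assms, symmetric])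
  finally show "(\<integral>\<^sup>+z. f (z + of_real (a * Im z)) \<partial>lborel) = (\<integral>\<^sup>+z. f z \<partial>lborel)" .
  have e: "Complex x y + \<i> * complex_of_real (a * x) = Complex x (y + a * x)" for x y
    by (simp add: complex_eq_iff)
  have "(\<integral>\<^sup>+z. f (z + \<i> * of_real (a * Re z)) \<partial>lborel) = (\<integral>\<^sup>+x. \<integral>\<^sup>+y. f (Complex x (y + a * x)) \<partial>lborel \<partial>lborel)"
    by (subst nn_integral_lborel_complex(1), rule measurable_compose[OF _ assms], measurable, simp only: e complex.sel)
  also have "\<dots> = (\<integral>\<^sup>+x. \<integral>\<^sup>+y. f (Complex x y) \<partial>lborel \<partial>lborel)"
    by (intro nn_integral_cong nn_integral_shift_real measurable_compose[OF Cm(2) assms])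
  also have "\<dots> = (\<integral>\<^sup>+z. f z \<partial>lborel)" by (rule nn_integral_lborel_complex(1)[OF assms, symmetric])
  finally show "(\<integral>\<^sup>+z. f (z + \<i> * of_real (a * Re z)) \<partial>lborel) = (\<integral>\<^sup>+z. f z \<partial>lborel)" .
qed

text \<open>A rotation by an angle other than \<open>pi\<close> is the product of three shears, and shears preserve
  Lebesgue measure by Fubini's theorem and translation invariance.\<close>
lemma lborel_rotate:
  assumes w: "cmod w = 1" "w \<noteq> -1"
  shows "distr lborel borel (\<lambda>z. w * z) = (lborel :: complex measure)"
proof (rule measure_eqI)
  fix A :: "complex set" assume A: "A \<in> sets (distr lborel borel (\<lambda>z. w * z))"
  then have [measurable]: "A \<in> sets borel" by simp
  define c s where "c = Re w" and "s = Im w"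
  have cs: "c\<^sup>2 + s\<^sup>2 = 1" using w(1) by (simp add: cmod_def c_def s_def)
  have c1: "1 + c \<noteq> 0"
  proof
    assume "1 + c = 0"
    then have c: "c = -1" by simp
    then have "s = 0" using cs by simp
    then show False using w(2) c by (simp add: c_def s_def complex_eq_iff)
  qed
  \<comment> \<open>the tangent of half the angle\<close>
  define t where "t = s / (1 + c)"
  have ts: "t * s = 1 - c"
  proof -
    have "s\<^sup>2 = (1 - c) * (1 + c)" using cs by (simp add: power2_eq_square algebra_simps)
    then show ?thesis using c1 by (simp add: t_def divide_eq_eq power2_eq_square)
  qed
  have tc: "t * (1 + c) = s" using c1 by (simp add: t_def)
  let ?H = "\<lambda>z. z + complex_of_real ((- t) * Im z)" and ?V = "\<lambda>z. z + \<i> * complex_of_real (s * Re z)"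
  have [measurable]: "?H \<in> borel_measurable borel" "?V \<in> borel_measurable borel"
    by (intro borel_measurable_continuous_onI continuous_intros)+
  have rot: "?H (?V (?H z)) = w * z" for z
  proof (rule complex_eqI)
    have "Re (?H (?V (?H z))) = Re z * (1 - t * s) - Im z * (t * (1 + (1 - t * s)))"
      by (simp add: algebra_simps)
    then show "Re (?H (?V (?H z))) = Re (w * z)" unfolding ts using tc by (simp add: c_def[symmetric] s_def[symmetric] mult_ac)
    have "Im (?H (?V (?H z))) = Im z * (1 - t * s) + s * Re z" by (simp add: algebra_simps)
    then show "Im (?H (?V (?H z))) = Im (w * z)" unfolding ts by (simp add: c_def[symmetric] s_def[symmetric] mult_ac)
  qed
  let ?f = "indicator A :: complex \<Rightarrow> ennreal"
  have "emeasure (distr lborel borel (\<lambda>z. w * z)) A = (\<integral>\<^sup>+z. ?f z \<partial>distr lborel borel (\<lambda>z. w * z))" by simp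
  also have "\<dots> = (\<integral>\<^sup>+z. ?f (w * z) \<partial>lborel)" by (subst nn_integral_distr) auto
  also have "\<dots> = (\<integral>\<^sup>+z. ?f (?H (?V (?H z))) \<partial>lborel)" unfolding rot ..
  also have "\<dots> = (\<integral>\<^sup>+z. ?f (?H (?V z)) \<partial>lborel)"
    by (rule nn_integral_shear(1)[where f = "\<lambda>z. ?f (?H (?V z))"]) measurable
  also have "\<dots> = (\<integral>\<^sup>+z. ?f (?H z) \<partial>lborel)"
    by (rule nn_integral_shear(2)[where f = "\<lambda>z. ?f (?H z)"]) measurable
  also have "\<dots> = (\<integral>\<^sup>+z. ?f z \<partial>lborel)"
    by (rule nn_integral_shear(1)[where f = ?f]) measurable
  finally show "emeasure (distr lborel borel (\<lambda>z. w * z)) A = emeasure lborel A" by simp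
qed simp

text \<open>The image of Lebesgue measure under \<open>\<lambda>z. \<bar>z\<bar>\<^sup>2\<close> is \<open>pi\<close> times Lebesgue measure on the half line: this
  is the formula for the area of a disc. The proof works with \<open>- \<bar>z\<bar>\<^sup>2\<close>, for which the rays \<open>{x<..}\<close>
  have finite measure and determine the image measure.\<close>
lemma nn_integral_radial:
  fixes g :: "real \<Rightarrow> ennreal"
  assumes [measurable]: "g \<in> borel_measurable borel"
  shows "(\<integral>\<^sup>+z. g ((cmod z)\<^sup>2) \<partial>lborel) = ennreal pi * (\<integral>\<^sup>+r. g r * indicator {0..} r \<partial>lborel)"
proof -
  let ?M = "distr lborel borel (\<lambda>z::complex. - ((cmod z)\<^sup>2))"
  let ?N = "distr (density lborel (\<lambda>r. ennreal pi * indicator {0..} r)) borel (uminus :: real \<Rightarrow> real)"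
  have Mx: "emeasure ?M {x<..} = (if x \<ge> 0 then 0 else ennreal (pi * (- x)))" for x
  proof -
    have "emeasure ?M {x<..} = emeasure lborel {z::complex. x < - ((cmod z)\<^sup>2)}"
      by (subst emeasure_distr) (auto simp: vimage_def)
    also have "{z::complex. x < - ((cmod z)\<^sup>2)} = (if x \<ge> 0 then {} else ball 0 (sqrt (- x)))"
    proof (cases "x \<ge> 0")
      case True
      have "\<not> x < - ((cmod z)\<^sup>2)" for z using True zero_le_power2[of "cmod z"] by linarith
      then show ?thesis using True by simp
    next
      case False
      have "cmod z < sqrt (- x) \<longleftrightarrow> sqrt ((cmod z)\<^sup>2) < sqrt (- x)" for z :: complex by simp
      then have "x < - ((cmod z)\<^sup>2) \<longleftrightarrow> cmod z < sqrt (- x)" for z :: complex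
        unfolding real_sqrt_less_iff by (simp only: less_minus_iff[of x])
      then show ?thesis using False by (simp only: if_False set_eq_iff mem_Collect_eq mem_ball_0 simp_thms)
    qed
    also have "emeasure lborel \<dots> = (if x \<ge> 0 then 0 else ennreal (pi * (- x)))"
      using emeasure_ball[of "sqrt (- x)" "0::complex"] by (simp add: unit_ball_vol_2)
    finally show ?thesis .
  qed
  have Nx: "emeasure ?N {x<..} = (if x \<ge> 0 then 0 else ennreal (pi * (- x)))" for x
  proof -
    have "emeasure ?N {x<..} = emeasure (density lborel (\<lambda>r. ennreal pi * indicator {0..} r)) {..< - x}"
      by (subst emeasure_distr) (auto simp: vimage_def minus_less_iff lessThan_def less_minus_iff intro!: arg_cong2[where f = emeasure])
    also have "\<dots> = (\<integral>\<^sup>+r. ennreal pi * indicator {0..} r * indicator {..< - x} r \<partial>lborel)"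
      by (rule emeasure_density) auto
    also have "\<dots> = (\<integral>\<^sup>+r. ennreal pi * indicator {0..< - x} r \<partial>lborel)"
      by (intro nn_integral_cong) (auto split: split_indicator)
    also have "\<dots> = ennreal pi * emeasure lborel {0..< - x}" by (rule nn_integral_cmult_indicator) auto
    also have "\<dots> = (if x \<ge> 0 then 0 else ennreal (pi * (- x)))"
      using ennreal_mult[of pi "- x"] by auto
    finally show ?thesis .
  qed
  have eq: "?M = ?N"
    by (rule measure_eqI_lessThan) (auto simp: Mx Nx)
  have "(\<integral>\<^sup>+z. g ((cmod z)\<^sup>2) \<partial>lborel) = (\<integral>\<^sup>+x. g (- x) \<partial>?M)"
    by (subst nn_integral_distr) auto
  also have "\<dots> = (\<integral>\<^sup>+r. ennreal pi * indicator {0..} r * g r \<partial>lborel)"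
    unfolding eq by (subst nn_integral_distr, simp, simp, subst nn_integral_density) auto
  also have "\<dots> = ennreal pi * (\<integral>\<^sup>+r. g r * indicator {0..} r \<partial>lborel)"
    by (subst nn_integral_cmult[symmetric]) (auto simp: mult_ac)
  finally show ?thesis .
qed

lemma nn_integral_power_times_exp_scaled:
  assumes l: "l > 0"
  shows "(\<integral>\<^sup>+r. ennreal (r ^ n * exp (- l * r)) * indicator {0..} r \<partial>lborel) = ennreal (fact n / l ^ Suc n)"
proof -
  have "(\<integral>\<^sup>+r. ennreal (r ^ n * exp (- l * r)) * indicator {0..} r \<partial>lborel)
      = (\<integral>\<^sup>+r. ennreal (fact n / l ^ Suc n) * ennreal (erlang_density n l r * r ^ 0) \<partial>lborel)"
    using l by (intro nn_integral_cong)
      (auto simp: erlang_density_def ennreal_mult'[symmetric] simp del: fact_Suc split: split_indicator)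
  also have "\<dots> = ennreal (fact n / l ^ Suc n)"
    by (subst nn_integral_cmult) (auto simp: nn_integral_erlang_ith_moment[OF l, of n 0, simplified])
  finally show ?thesis .
qed

lemma gaussian_moment:
  assumes l: "l > 0"
  shows "(\<integral>\<^sup>+z. ennreal ((cmod z) ^ (2 * n) * exp (- l * (cmod z)\<^sup>2)) \<partial>lborel) = ennreal (pi * fact n / l ^ Suc n)"
proof -
  have "(\<integral>\<^sup>+z. ennreal ((cmod z) ^ (2 * n) * exp (- l * (cmod z)\<^sup>2)) \<partial>lborel)
      = (\<integral>\<^sup>+z. (\<lambda>r. ennreal (r ^ n * exp (- l * r))) ((cmod z)\<^sup>2) \<partial>lborel)"
    by (simp add: power_mult)
  also have "\<dots> = ennreal pi * ennreal (fact n / l ^ Suc n)"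
    using nn_integral_power_times_exp_scaled[OF l, of n] by (subst nn_integral_radial) auto
  also have "\<dots> = ennreal (pi * fact n / l ^ Suc n)"
    using l by (simp add: ennreal_mult'[symmetric])
  finally show ?thesis .
qed

lemma weighted_gaussian_moment:
  "(\<integral>\<^sup>+z. ennreal ((cmod z) ^ (2 * n) * ((1 + (cmod z)\<^sup>2) ^ k * exp (- (cmod z)\<^sup>2))) \<partial>lborel)
     = ennreal (pi * fact n * fock_weight k n)"
proof (induction k arbitrary: n)
  case 0
  show ?case using gaussian_moment[of 1 n] by simp
next
  case (Suc k)
  have "(\<integral>\<^sup>+z. ennreal ((cmod z) ^ (2 * n) * ((1 + (cmod z)\<^sup>2) ^ Suc k * exp (- (cmod z)\<^sup>2))) \<partial>lborel)
     = (\<integral>\<^sup>+z. ennreal ((cmod z) ^ (2 * n) * ((1 + (cmod z)\<^sup>2) ^ k * exp (- (cmod z)\<^sup>2)))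
         + ennreal ((cmod z) ^ (2 * Suc n) * ((1 + (cmod z)\<^sup>2) ^ k * exp (- (cmod z)\<^sup>2))) \<partial>lborel)"
    by (intro nn_integral_cong, subst ennreal_plus[symmetric]) (auto simp: algebra_simps power2_eq_square)
  also have "\<dots> = ennreal (pi * fact n * fock_weight k n) + ennreal (pi * fact (Suc n) * fock_weight k (Suc n))"
    by (subst nn_integral_add) (auto simp only: Suc, measurable)
  also have "\<dots> = ennreal (pi * fact n * fock_weight (Suc k) n)"
    by (subst ennreal_plus[symmetric]) (auto simp: algebra_simps)
  finally show ?case .
qed

section \<open>Parseval identities for entire functions\<close>

lemma integral_rotate:
  fixes f :: "complex \<Rightarrow> complex"
  assumes [measurable]: "f \<in> borel_measurable borel" and w: "cmod w = 1" "w \<noteq> -1"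
  shows "(LINT z|lborel. f (w * z)) = (LINT z|lborel. f z)"
  by (subst (2) lborel_rotate[OF w, symmetric], subst integral_distr) auto

lemma cball_borel [measurable]: "cball (0 :: complex) R \<in> sets borel"
  by (rule borel_closed[OF closed_cball])

lemma power_series_measurable:
  fixes f :: "complex \<Rightarrow> complex"
  assumes "\<And>z. (\<lambda>n. a n * z ^ n) sums f z"
  shows "f \<in> borel_measurable borel"
proof (rule borel_measurable_LIMSEQ_metric)
  show "(\<lambda>z. \<Sum>n<N. a n * z ^ n) \<in> borel_measurable borel" for N by measurable
  show "(\<lambda>N. \<Sum>n<N. a n * z ^ n) \<longlonglongrightarrow> f z" for z using assms by (simp add: sums_def)
qed

locale radial_weight =
  fixes \<rho> :: "real \<Rightarrow> real"
  assumes rho_cont: "continuous_on UNIV \<rho>" and rho_nonneg: "\<And>r. \<rho> r \<ge> 0"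
begin

lemma rho_comp_cont: "continuous_on A f \<Longrightarrow> continuous_on A (\<lambda>x. \<rho> (f x))"
  by (rule continuous_on_compose2[OF rho_cont]) auto

lemma rho_measurable [measurable]: "\<rho> \<in> borel_measurable borel"
  by (rule borel_measurable_continuous_onI[OF rho_cont])

lemma integrable_cball:
  fixes f :: "complex \<Rightarrow> 'a::{banach, second_countable_topology}"
  assumes "continuous_on UNIV f"
  shows "integrable lborel (\<lambda>z. indicator (cball 0 R) z *\<^sub>R f z)"
  by (rule borel_integrable_compact) (auto intro: continuous_on_subset[OF assms])

text \<open>A rotation by the angle \<open>\<theta>\<close> multiplies the integrand by \<open>cis ((n - m) * \<theta>)\<close>; the angle is chosen
  such that this factor is \<open>\<i>\<close> or \<open>- \<i>\<close>.\<close>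
lemma monomial_orthogonal:
  assumes "n \<noteq> m"
  shows "(LINT z|lborel. indicator (cball 0 R) z *\<^sub>R (of_real (\<rho> (cmod z)) * (z ^ n * cnj z ^ m))) = (0::complex)"
proof -
  let ?g = "\<lambda>z. indicator (cball 0 R) z *\<^sub>R (of_real (\<rho> (cmod z)) * (z ^ n * cnj z ^ m)) :: complex"
  define d where "d = real n - real m"
  have d: "\<bar>d\<bar> \<ge> 1" using assms by (auto simp: d_def)
  define \<theta> where "\<theta> = pi / (2 * \<bar>d\<bar>)"
  have th: "0 < \<theta>" "\<theta> < pi" using d pi_gt_zero by (auto simp: \<theta>_def divide_less_eq)
  define w where "w = cis \<theta>"
  have w1: "cmod w = 1" by (simp add: w_def)
  have w2: "w \<noteq> -1" using sin_gt_zero[OF th] by (auto simp: w_def complex_eq_iff)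
  have wcis: "w ^ n * cnj w ^ m = cis (d * \<theta>)"
    unfolding w_def cis_cnj by (simp add: Complex.DeMoivre cis_mult d_def algebra_simps)
  have "d * \<theta> = pi / 2 \<or> d * \<theta> = - (pi / 2)" using d by (auto simp: \<theta>_def abs_if)
  then have "sin (d * \<theta>) \<noteq> 0"
    by (elim disjE; simp only: sin_pi_half sin_minus; simp)
  then have "cis (d * \<theta>) \<noteq> 1" by (auto simp: complex_eq_iff)
  then have ne: "w ^ n * cnj w ^ m \<noteq> 1" unfolding wcis .
  have gw: "?g (w * z) = (w ^ n * cnj w ^ m) * ?g z" for z
    using w1 by (simp add: norm_mult power_mult_distrib indicator_def)
  have cm: "(\<lambda>z. cnj z ^ m) \<in> borel_measurable borel" 
    by (intro borel_measurable_continuous_onI continuous_intros)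
  have [measurable]: "?g \<in> borel_measurable borel"
    using cm by measurable
  have "(LINT z|lborel. ?g z) = (LINT z|lborel. ?g (w * z))"
    by (rule integral_rotate[symmetric, OF _ w1 w2]) measurable
  also have "\<dots> = (w ^ n * cnj w ^ m) * (LINT z|lborel. ?g z)"
    unfolding gw by (rule integral_mult_right_zero)
  finally have "(LINT z|lborel. ?g z) = (w ^ n * cnj w ^ m) * (LINT z|lborel. ?g z)" .
  moreover have "x = 0" if "x = c * x" "c \<noteq> 1" for x c :: complex
    using that by (metis mult_cancel_right1)
  ultimately show ?thesis using ne by blast
qed

definition disc_moment :: "real \<Rightarrow> nat \<Rightarrow> real" where
  "disc_moment R n = (LINT z|lborel. indicator (cball 0 R) z *\<^sub>R (\<rho> (cmod z) * cmod z ^ (2 * n)))"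

lemma disc_parseval_poly:
  "(LINT z|lborel. indicator (cball 0 R) z *\<^sub>R (\<rho> (cmod z) * (cmod (\<Sum>n<N. a n * z ^ n))\<^sup>2))
     = (\<Sum>n<N. (cmod (a n))\<^sup>2 * disc_moment R n)"
proof -
  let ?e = "\<lambda>n m z. indicator (cball 0 R) z *\<^sub>R (of_real (\<rho> (cmod z)) * (z ^ n * cnj z ^ m)) :: complex"
  have int: "integrable lborel (?e n m)" for n m
    by (rule integrable_cball) (intro continuous_intros rho_comp_cont)
  have diag: "(LINT z|lborel. ?e n n z) = of_real (disc_moment R n)" for n
  proof -
    have "?e n n z = of_real (indicator (cball 0 R) z *\<^sub>R (\<rho> (cmod z) * cmod z ^ (2 * n)))" for z
    proof -
      have "z ^ n * cnj z ^ n = (of_real ((cmod z)\<^sup>2)) ^ n"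
        by (simp only: power_mult_distrib[symmetric] complex_norm_square)
      then show ?thesis by (simp add: scaleR_conv_of_real power_mult)
    qed
    then show ?thesis unfolding disc_moment_def by (simp only: integral_complex_of_real)
  qed
  have expand: "of_real (indicator (cball 0 R) z *\<^sub>R (\<rho> (cmod z) * (cmod (\<Sum>n<N. a n * z ^ n))\<^sup>2))
      = (\<Sum>n<N. \<Sum>m<N. (a n * cnj (a m)) * ?e n m z)" for z
  proof -
    have "complex_of_real ((cmod (\<Sum>n<N. a n * z ^ n))\<^sup>2) = (\<Sum>n<N. \<Sum>m<N. (a n * z ^ n) * (cnj (a m) * cnj z ^ m))"
      unfolding complex_norm_square by (simp add: sum_product)
    then show ?thesis
      by (simp add: scaleR_conv_of_real sum_distrib_left mult_ac)
  qed
  have "complex_of_real (LINT z|lborel. indicator (cball 0 R) z *\<^sub>R (\<rho> (cmod z) * (cmod (\<Sum>n<N. a n * z ^ n))\<^sup>2))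
     = (LINT z|lborel. (\<Sum>n<N. \<Sum>m<N. (a n * cnj (a m)) * ?e n m z))"
    unfolding expand[symmetric] by (rule integral_complex_of_real[symmetric])
  also have "\<dots> = (\<Sum>n<N. \<Sum>m<N. (a n * cnj (a m)) * (LINT z|lborel. ?e n m z))"
    by (subst Bochner_Integration.integral_sum, intro Bochner_Integration.integrable_sum integrable_mult_right int)+
       (simp only: integral_mult_right_zero)
  also have "\<dots> = (\<Sum>n<N. \<Sum>m<N. if m = n then (a n * cnj (a n)) * of_real (disc_moment R n) else 0)"
    by (intro sum.cong refl) (simp add: monomial_orthogonal diag)
  also have "\<dots> = (\<Sum>n<N. (a n * cnj (a n)) * of_real (disc_moment R n))" by (simp add: sum.delta)
  also have "\<dots> = of_real (\<Sum>n<N. (cmod (a n))\<^sup>2 * disc_moment R n)"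
    by (simp flip: complex_norm_square)
  finally show ?thesis by (simp only: of_real_eq_iff)
qed

lemma disc_parseval:
  assumes f: "\<And>z. (\<lambda>n. a n * z ^ n) sums f z"
  shows "(\<lambda>n. (cmod (a n))\<^sup>2 * disc_moment R n) sums
      (LINT z|lborel. indicator (cball 0 R) z *\<^sub>R (\<rho> (cmod z) * (cmod (f z))\<^sup>2))"
    and "integrable lborel (\<lambda>z. indicator (cball 0 R) z *\<^sub>R (\<rho> (cmod z) * (cmod (f z))\<^sup>2))"
proof -
  have "summable (\<lambda>n. cmod (a n * of_real (\<bar>R\<bar> + 1) ^ n))"
  proof -
    have "summable (\<lambda>n. a n * of_real (\<bar>R\<bar> + 2) ^ n)" using f sums_summable by blast
    then show ?thesis by (rule powser_insidea) (simp add: norm_of_real)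
  qed
  then have sM: "summable (\<lambda>n. cmod (a n) * (\<bar>R\<bar> + 1) ^ n)" by (simp add: norm_mult norm_power)
  define M where "M = (\<Sum>n. cmod (a n) * (\<bar>R\<bar> + 1) ^ n)"
  have bound: "cmod (\<Sum>n<N. a n * z ^ n) \<le> M" if "z \<in> cball 0 R" for N z
  proof -
    have "cmod (\<Sum>n<N. a n * z ^ n) \<le> (\<Sum>n<N. cmod (a n) * cmod z ^ n)"
      by (rule order_trans[OF norm_sum]) (simp add: norm_mult norm_power)
    also have "\<dots> \<le> (\<Sum>n<N. cmod (a n) * (\<bar>R\<bar> + 1) ^ n)"
      using that by (intro sum_mono mult_left_mono power_mono) auto
    also have "\<dots> \<le> M" unfolding M_def by (rule sum_le_suminf[OF sM]) auto
    finally show ?thesis .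
  qed
  have [measurable]: "f \<in> borel_measurable borel" by (rule power_series_measurable[OF f])
  let ?F = "\<lambda>N z. indicator (cball 0 R) z *\<^sub>R (\<rho> (cmod z) * (cmod (\<Sum>n<N. a n * z ^ n))\<^sup>2)"
  let ?G = "\<lambda>z. indicator (cball 0 R) z *\<^sub>R (\<rho> (cmod z) * (cmod (f z))\<^sup>2)"
  let ?w = "\<lambda>z::complex. indicator (cball 0 R) z *\<^sub>R (\<rho> (cmod z) * M\<^sup>2)"
  have w: "integrable lborel ?w" by (rule integrable_cball) (intro continuous_intros rho_comp_cont)
  have lim: "AE z in lborel. (\<lambda>N. ?F N z) \<longlonglongrightarrow> ?G z"
    using f unfolding sums_def by (intro AE_I2 tendsto_intros) auto
  have dom: "AE z in lborel. norm (?F N z) \<le> ?w z" for N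
  proof (rule AE_I2)
    fix z :: complex
    show "norm (?F N z) \<le> ?w z"
    proof (cases "z \<in> cball 0 R")
      case True
      then show ?thesis using bound[OF True, of N] rho_nonneg[of "cmod z"]
        by (auto intro!: mult_left_mono power_mono)
    qed simp
  qed
  have "(\<lambda>N. LINT z|lborel. ?F N z) \<longlonglongrightarrow> (LINT z|lborel. ?G z)"
    by (rule integral_dominated_convergence[OF _ _ w lim dom]; measurable)
  then show "(\<lambda>n. (cmod (a n))\<^sup>2 * disc_moment R n) sums (LINT z|lborel. ?G z)"
    unfolding disc_parseval_poly sums_def .
  show "integrable lborel ?G"
    by (rule integrable_dominated_convergence[OF _ _ w lim dom]; measurable)
qed

lemma nn_integral_exhaust_discs:
  fixes h :: "complex \<Rightarrow> ennreal"
  assumes [measurable]: "h \<in> borel_measurable borel"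
  shows "(\<integral>\<^sup>+z. h z \<partial>lborel) = (SUP i::nat. \<integral>\<^sup>+z. h z * indicator (cball 0 (real i)) z \<partial>lborel)"
proof -
  have "(SUP i::nat. h z * indicator (cball 0 (real i)) z) = h z" for z
  proof (rule antisym)
    show "(SUP i::nat. h z * indicator (cball 0 (real i)) z) \<le> h z"
      by (rule SUP_least) (auto split: split_indicator)
    obtain i :: nat where "cmod z \<le> real i" using real_arch_simple by blast
    then show "h z \<le> (SUP i::nat. h z * indicator (cball 0 (real i)) z)"
      by (intro SUP_upper2[of i]) (auto split: split_indicator)
  qed
  then have "(\<integral>\<^sup>+z. h z \<partial>lborel) = (\<integral>\<^sup>+z. (SUP i::nat. h z * indicator (cball 0 (real i)) z) \<partial>lborel)" by simp
  also have "\<dots> = (SUP i::nat. \<integral>\<^sup>+z. h z * indicator (cball 0 (real i)) z \<partial>lborel)"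
  proof (rule nn_integral_monotone_convergence_SUP)
    show "incseq (\<lambda>(i::nat) z. h z * indicator (cball 0 (real i)) z)"
      by (auto simp: incseq_def le_fun_def split: split_indicator)
    show "(\<lambda>z. h z * indicator (cball 0 (real i)) z) \<in> borel_measurable lborel" for i :: nat by measurable
  qed
  finally show ?thesis .
qed

text \<open>On a disc the power series converges uniformly and the identity follows from the orthogonality
  of the monomials. Both sides are monotone in the radius of the disc, so it extends to
  the plane, where both sides may be infinite.\<close>
lemma parseval:
  assumes f: "\<And>z. (\<lambda>n. a n * z ^ n) sums f z"
  shows "(\<integral>\<^sup>+z. ennreal (\<rho> (cmod z) * (cmod (f z))\<^sup>2) \<partial>lborel)
    = (\<Sum>n. ennreal ((cmod (a n))\<^sup>2) * (\<integral>\<^sup>+z. ennreal (\<rho> (cmod z) * cmod z ^ (2 * n)) \<partial>lborel))"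
proof -
  have [measurable]: "f \<in> borel_measurable borel" by (rule power_series_measurable[OF f])
  let ?h = "\<lambda>z. \<Sum>n. ennreal ((cmod (a n))\<^sup>2) * ennreal (\<rho> (cmod z) * cmod z ^ (2 * n))"
  have dm0: "0 \<le> disc_moment R n" for R n
    unfolding disc_moment_def by (intro integral_nonneg_AE AE_I2) (auto simp: rho_nonneg)
  have disc_eq: "(\<integral>\<^sup>+z. ennreal (\<rho> (cmod z) * (cmod (f z))\<^sup>2) * indicator (cball 0 R) z \<partial>lborel)
      = (\<integral>\<^sup>+z. ?h z * indicator (cball 0 R) z \<partial>lborel)" for R
  proof -
    have "(\<integral>\<^sup>+z. ennreal (\<rho> (cmod z) * (cmod (f z))\<^sup>2) * indicator (cball 0 R) z \<partial>lborel)
        = (\<integral>\<^sup>+z. ennreal (indicator (cball 0 R) z *\<^sub>R (\<rho> (cmod z) * (cmod (f z))\<^sup>2)) \<partial>lborel)"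
      by (intro nn_integral_cong) (auto split: split_indicator)
    also have "\<dots> = ennreal (LINT z|lborel. indicator (cball 0 R) z *\<^sub>R (\<rho> (cmod z) * (cmod (f z))\<^sup>2))"
      by (rule nn_integral_eq_integral[OF disc_parseval(2)[OF f]]) (auto simp: rho_nonneg)
    also have "\<dots> = (\<Sum>n. ennreal ((cmod (a n))\<^sup>2 * disc_moment R n))"
      using sums_unique[OF disc_parseval(1)[OF f, of R]] sums_summable[OF disc_parseval(1)[OF f, of R]] dm0
      by (subst suminf_ennreal2) auto
    also have "\<dots> = (\<Sum>n. \<integral>\<^sup>+z. ennreal ((cmod (a n))\<^sup>2) * ennreal (\<rho> (cmod z) * cmod z ^ (2 * n)) * indicator (cball 0 R) z \<partial>lborel)"
    proof (intro suminf_cong)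
      fix n
      have "ennreal (disc_moment R n) = (\<integral>\<^sup>+z. ennreal (indicator (cball 0 R) z *\<^sub>R (\<rho> (cmod z) * cmod z ^ (2 * n))) \<partial>lborel)"
      proof -
        have "integrable lborel (\<lambda>z::complex. indicator (cball 0 R) z *\<^sub>R (\<rho> (cmod z) * cmod z ^ (2 * n)))"
          by (rule integrable_cball) (intro continuous_intros rho_comp_cont)
        then show ?thesis
          unfolding disc_moment_def by (rule nn_integral_eq_integral[symmetric]) (auto simp: rho_nonneg)
      qed
      also have "\<dots> = (\<integral>\<^sup>+z. ennreal (\<rho> (cmod z) * cmod z ^ (2 * n)) * indicator (cball 0 R) z \<partial>lborel)"
        by (intro nn_integral_cong) (auto split: split_indicator)
      finally have "ennreal ((cmod (a n))\<^sup>2 * disc_moment R n) = ennreal ((cmod (a n))\<^sup>2) *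
          (\<integral>\<^sup>+z. ennreal (\<rho> (cmod z) * cmod z ^ (2 * n)) * indicator (cball 0 R) z \<partial>lborel)"
        using dm0 by (simp add: ennreal_mult)
      also have "\<dots> = (\<integral>\<^sup>+z. ennreal ((cmod (a n))\<^sup>2) * (ennreal (\<rho> (cmod z) * cmod z ^ (2 * n)) * indicator (cball 0 R) z) \<partial>lborel)"
        by (rule nn_integral_cmult[symmetric]) measurable
      finally show "ennreal ((cmod (a n))\<^sup>2 * disc_moment R n)
        = (\<integral>\<^sup>+z. ennreal ((cmod (a n))\<^sup>2) * ennreal (\<rho> (cmod z) * cmod z ^ (2 * n)) * indicator (cball 0 R) z \<partial>lborel)"
        by (simp only: mult.assoc)
    qed
    also have "\<dots> = (\<integral>\<^sup>+z. (\<Sum>n. ennreal ((cmod (a n))\<^sup>2) * ennreal (\<rho> (cmod z) * cmod z ^ (2 * n)) * indicator (cball 0 R) z) \<partial>lborel)"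
      by (rule nn_integral_suminf[symmetric]) measurable
    also have "\<dots> = (\<integral>\<^sup>+z. ?h z * indicator (cball 0 R) z \<partial>lborel)"
      by (simp only: ennreal_suminf_multc)
    finally show ?thesis .
  qed
  have "(\<integral>\<^sup>+z. ennreal (\<rho> (cmod z) * (cmod (f z))\<^sup>2) \<partial>lborel) = (\<integral>\<^sup>+z. ?h z \<partial>lborel)"
    by (subst (1 2) nn_integral_exhaust_discs) (measurable, simp only: disc_eq)
  also have "\<dots> = (\<Sum>n. ennreal ((cmod (a n))\<^sup>2) * (\<integral>\<^sup>+z. ennreal (\<rho> (cmod z) * cmod z ^ (2 * n)) \<partial>lborel))"
    by (subst nn_integral_suminf) (auto simp: nn_integral_cmult)
  finally show ?thesis .
qed

end

context radial_weight
begin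

lemma parseval_integrable:
  assumes f: "\<And>z. (\<lambda>n. a n * z ^ n) sums f z"
    and I: "\<And>n. (\<integral>\<^sup>+z. ennreal (\<rho> (cmod z) * cmod z ^ (2 * n)) \<partial>lborel) = ennreal (I n)" "\<And>n. I n \<ge> 0"
    and sum: "summable (\<lambda>n. (cmod (a n))\<^sup>2 * I n)"
  shows "has_bochner_integral lborel (\<lambda>z. \<rho> (cmod z) * (cmod (f z))\<^sup>2) (\<Sum>n. (cmod (a n))\<^sup>2 * I n)"
proof (rule has_bochner_integral_nn_integral)
  have [measurable]: "f \<in> borel_measurable borel" by (rule power_series_measurable[OF f])
  show "(\<lambda>z. \<rho> (cmod z) * (cmod (f z))\<^sup>2) \<in> borel_measurable lborel" by measurable
  show "AE z in lborel. 0 \<le> \<rho> (cmod z) * (cmod (f z))\<^sup>2" by (simp add: rho_nonneg)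
  show "0 \<le> (\<Sum>n. (cmod (a n))\<^sup>2 * I n)" using I(2) by (intro suminf_nonneg sum) auto
  have "(\<integral>\<^sup>+z. ennreal (\<rho> (cmod z) * (cmod (f z))\<^sup>2) \<partial>lborel) = (\<Sum>n. ennreal ((cmod (a n))\<^sup>2 * I n))"
    unfolding parseval[OF f] I(1) using I(2) by (simp add: ennreal_mult)
  also have "\<dots> = ennreal (\<Sum>n. (cmod (a n))\<^sup>2 * I n)"
    using I(2) by (intro suminf_ennreal2 sum) auto
  finally show "(\<integral>\<^sup>+z. ennreal (\<rho> (cmod z) * (cmod (f z))\<^sup>2) \<partial>lborel) = ennreal (\<Sum>n. (cmod (a n))\<^sup>2 * I n)" .
qed

text \<open>From the quadratic identity for \<open>f + u * g\<close> with \<open>u\<close> a fourth root of unity.\<close>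
lemma parseval_polarized:
  assumes f: "\<And>z. (\<lambda>n. a n * z ^ n) sums f z" and g: "\<And>z. (\<lambda>n. b n * z ^ n) sums g z"
    and I: "\<And>n. (\<integral>\<^sup>+z. ennreal (\<rho> (cmod z) * cmod z ^ (2 * n)) \<partial>lborel) = ennreal (I n)" "\<And>n. I n \<ge> 0"
    and sum: "summable (\<lambda>n. (cmod (a n))\<^sup>2 * I n)" "summable (\<lambda>n. (cmod (b n))\<^sup>2 * I n)"
  shows "(\<lambda>n. of_real (I n) * (a n * cnj (b n))) sums (LINT z|lborel. of_real (\<rho> (cmod z)) * (f z * cnj (g z)))"
proof -
  define P where "P u = (\<lambda>z. \<rho> (cmod z) * (cmod (f z + u * g z))\<^sup>2)" for u
  define s where "s u = (\<lambda>n. (cmod (a n + u * b n))\<^sup>2 * I n)" for u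
  have summ: "summable (s u)" if u: "cmod u = 1" for u
  proof (rule summable_comparison_test)
    show "\<exists>N. \<forall>n\<ge>N. norm (s u n) \<le> 2 * ((cmod (a n))\<^sup>2 * I n) + 2 * ((cmod (b n))\<^sup>2 * I n)"
    proof (intro exI allI impI)
      fix n
      have "(cmod (a n + u * b n))\<^sup>2 \<le> 2 * (cmod (a n))\<^sup>2 + 2 * (cmod (u * b n))\<^sup>2" by (rule cmod_add_sq_le)
      then have "(cmod (a n + u * b n))\<^sup>2 * I n \<le> (2 * (cmod (a n))\<^sup>2 + 2 * (cmod (b n))\<^sup>2) * I n"
        using u I(2) by (intro mult_right_mono) (auto simp: norm_mult)
      then show "norm (s u n) \<le> 2 * ((cmod (a n))\<^sup>2 * I n) + 2 * ((cmod (b n))\<^sup>2 * I n)"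
        using I(2)[of n] by (simp add: s_def algebra_simps)
    qed
    show "summable (\<lambda>n. 2 * ((cmod (a n))\<^sup>2 * I n) + 2 * ((cmod (b n))\<^sup>2 * I n))"
      by (intro summable_add summable_mult sum)
  qed
  have B: "has_bochner_integral lborel (P u) (suminf (s u))" if "cmod u = 1" for u
    unfolding P_def s_def
  proof (rule parseval_integrable[OF _ I])
    show "(\<lambda>n. (a n + u * b n) * z ^ n) sums (f z + u * g z)" for z
      using sums_add[OF f[of z] sums_mult[OF g[of z], of u]] by (simp add: algebra_simps)
    show "summable (\<lambda>n. (cmod (a n + u * b n))\<^sup>2 * I n)" using summ[OF that] by (simp add: s_def)
  qed
  have pol: "x * cnj y = (of_real ((cmod (x + 1 * y))\<^sup>2) - of_real ((cmod (x + (-1) * y))\<^sup>2)) / 4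
     + \<i> * ((of_real ((cmod (x + \<i> * y))\<^sup>2) - of_real ((cmod (x + (- \<i>) * y))\<^sup>2)) / 4)" for x y :: complex
    unfolding complex_norm_square by (simp add: field_simps)
  have int: "has_bochner_integral lborel (\<lambda>z. complex_of_real (P u z)) (of_real (suminf (s u)))" if "cmod u = 1" for u
    using has_bochner_integral_bounded_linear[OF bounded_linear_of_real B[OF that]] .
  have "has_bochner_integral lborel
     (\<lambda>z. (of_real (P 1 z) - of_real (P (-1) z)) / 4 + \<i> * ((of_real (P \<i> z) - of_real (P (-\<i>) z)) / 4))
     ((of_real (suminf (s 1)) - of_real (suminf (s (-1)))) / 4 + \<i> * ((of_real (suminf (s \<i>)) - of_real (suminf (s (-\<i>)))) / 4))"
    by (intro has_bochner_integral_add has_bochner_integral_diff has_bochner_integral_mult_right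
        has_bochner_integral_divide_zero int) auto
  moreover have "(of_real (P 1 z) - of_real (P (-1) z)) / 4 + \<i> * ((of_real (P \<i> z) - of_real (P (-\<i>) z)) / 4)
     = of_real (\<rho> (cmod z)) * (f z * cnj (g z))" for z
    unfolding pol[of "f z" "g z"] P_def by (simp add: algebra_simps diff_divide_distrib)
  ultimately have "(LINT z|lborel. of_real (\<rho> (cmod z)) * (f z * cnj (g z)))
     = (of_real (suminf (s 1)) - of_real (suminf (s (-1)))) / 4 + \<i> * ((of_real (suminf (s \<i>)) - of_real (suminf (s (-\<i>)))) / 4)"
    by (simp add: has_bochner_integral_integral_eq)
  moreover have "(\<lambda>n. (of_real (s 1 n) - of_real (s (-1) n)) / 4 + \<i> * ((of_real (s \<i> n) - of_real (s (-\<i>) n)) / 4))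
     sums ((of_real (suminf (s 1)) - of_real (suminf (s (-1)))) / 4 + \<i> * ((of_real (suminf (s \<i>)) - of_real (suminf (s (-\<i>)))) / 4))"
    by (intro sums_add sums_diff sums_mult sums_divide sums_of_real summable_sums summ) auto
  moreover have "(of_real (s 1 n) - of_real (s (-1) n)) / 4 + \<i> * ((of_real (s \<i> n) - of_real (s (-\<i>) n)) / 4)
     = of_real (I n) * (a n * cnj (b n))" for n
    unfolding pol[of "a n" "b n"] s_def by (simp add: algebra_simps diff_divide_distrib)
  ultimately show ?thesis by simp
qed

end

section \<open>The Bargmann-Fock space in coefficients\<close>

definition fock_series :: "(nat \<Rightarrow> complex) \<Rightarrow> complex \<Rightarrow> complex" where
  "fock_series c z = (\<Sum>n. c n / of_real (sqrt (fact n)) * z ^ n)"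

lemma summable_exp_coeff: "summable (\<lambda>n. (cmod (z ^ n / of_real (sqrt (fact n))))\<^sup>2)"
proof -
  have "summable (\<lambda>n. inverse (fact n) * ((cmod z)\<^sup>2) ^ n)" by (rule summable_exp)
  moreover have "(cmod (z ^ n / of_real (sqrt (fact n))))\<^sup>2 = inverse (fact n) * ((cmod z)\<^sup>2) ^ n" for n
  proof -
    have "(cmod (z ^ n / of_real (sqrt (fact n))))\<^sup>2 = (cmod z ^ n)\<^sup>2 / (sqrt (fact n))\<^sup>2"
      by (simp add: norm_divide norm_power power_divide)
    also have "\<dots> = ((cmod z)\<^sup>2) ^ n / fact n" by (simp add: mult.commute flip: power_mult)
    finally show ?thesis by (simp add: divide_inverse mult.commute)
  qed
  ultimately show ?thesis by simp
qed

lemma fock_series_sums_norm: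
  assumes "summable (\<lambda>n. (cmod (c n))\<^sup>2)"
  shows "summable (\<lambda>n. cmod (c n / of_real (sqrt (fact n)) * z ^ n))"
proof -
  from summable_sq_prod[OF assms summable_exp_coeff] show ?thesis
    by (simp add: norm_mult norm_divide norm_power)
qed

lemma fock_series_sums:
  "summable (\<lambda>n. (cmod (c n))\<^sup>2) \<Longrightarrow> (\<lambda>n. c n / of_real (sqrt (fact n)) * z ^ n) sums fock_series c z"
  unfolding fock_series_def by (intro summable_sums summable_norm_cancel[OF fock_series_sums_norm])

lemma fock_series_holomorphic:
  assumes "summable (\<lambda>n. (cmod (c n))\<^sup>2)"
  shows "fock_series c holomorphic_on UNIV"
proof -
  have hol: "fock_series c holomorphic_on ball 0 (cmod z + 1)" for z
  proof (rule power_series_holomorphic)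
    show "(\<lambda>n. c n / of_real (sqrt (fact n)) * (w - 0) ^ n) sums fock_series c w" for w
      using fock_series_sums[OF assms, of w] by simp
  qed
  have "fock_series c field_differentiable (at z)" for z
    by (rule holomorphic_on_imp_differentiable_at[OF hol[of z]]) auto
  then show ?thesis by (simp add: holomorphic_on_def field_differentiable_at_within)
qed

text \<open>The element of \<open>weighted_fock k\<close> with the coordinates \<open>x\<close>; this map from \<open>ell2\<close> is an isometric bijection.\<close>
definition fock_fun :: "nat \<Rightarrow> ell2 \<Rightarrow> complex \<Rightarrow> complex" where
  "fock_fun k x z = of_real (exp (- (cmod z)\<^sup>2 / 2)) * (fock_series (fock_coeff k x) z / of_real (sqrt pi))"

lemma summable_fock_coeff: "summable (\<lambda>n. (cmod (fock_coeff k x n))\<^sup>2)"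
  using sums_summable[OF energy_sums[of 0 k x]] by simp

interpretation wgauss: radial_weight "\<lambda>r. (1 + r\<^sup>2) ^ k * exp (- r\<^sup>2)" for k
  by standard (auto intro!: continuous_intros add_nonneg_nonneg)

interpretation gauss2: radial_weight "\<lambda>r. exp (- 2 * r\<^sup>2)"
  by standard (auto intro!: continuous_intros)

lemma cmod_weighted_sq:
  "(cmod (weighted k (\<lambda>z. of_real (exp (- (cmod z)\<^sup>2 / 2)) * f z) z))\<^sup>2
     = (1 + (cmod z)\<^sup>2) ^ k * exp (- (cmod z)\<^sup>2) * (cmod (f z))\<^sup>2"
proof -
  have j: "(jbracket z ^ k)\<^sup>2 = (1 + (cmod z)\<^sup>2) ^ k"
  proof -
    have "(jbracket z)\<^sup>2 = 1 + (cmod z)\<^sup>2" by (simp add: jbracket_def add_nonneg_nonneg)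
    then show ?thesis by (metis power_mult mult.commute)
  qed
  have e: "(exp (- (cmod z)\<^sup>2 / 2))\<^sup>2 = exp (- (cmod z)\<^sup>2)" by (simp flip: exp_double)
  have "cmod (weighted k (\<lambda>z. of_real (exp (- (cmod z)\<^sup>2 / 2)) * f z) z) = jbracket z ^ k * (exp (- (cmod z)\<^sup>2 / 2) * cmod (f z))"
    by (simp add: weighted_def norm_mult norm_power jbracket_def)
  then show ?thesis by (simp only: power_mult_distrib j e mult.assoc)
qed

lemma fock_parseval:
  assumes f: "\<And>z. (\<lambda>n. a n * z ^ n) sums f z"
  shows "(\<integral>\<^sup>+z. ennreal ((cmod (weighted k (\<lambda>z. of_real (exp (- (cmod z)\<^sup>2 / 2)) * f z) z))\<^sup>2) \<partial>lborel)
     = (\<Sum>n. ennreal (fock_weight k n * (pi * fact n * (cmod (a n))\<^sup>2)))"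
proof -
  have I: "(\<integral>\<^sup>+z. ennreal ((1 + (cmod z)\<^sup>2) ^ k * exp (- (cmod z)\<^sup>2) * cmod z ^ (2 * n)) \<partial>lborel)
      = ennreal (pi * fact n * fock_weight k n)" for n
    unfolding weighted_gaussian_moment[of n k, symmetric] by (simp only: mult_ac)
  show ?thesis
    unfolding cmod_weighted_sq wgauss.parseval[OF f] I
    by (simp add: ennreal_mult'[symmetric] mult_ac)
qed

lemma fock_fun_eq: "fock_fun k x = (\<lambda>z. of_real (exp (- (cmod z)\<^sup>2 / 2)) * (fock_series (fock_coeff k x) z / of_real (sqrt pi)))"
  by (rule ext) (simp add: fock_fun_def)

lemma fock_fun_series: "(\<lambda>n. fock_coeff k x n / of_real (sqrt (fact n)) / of_real (sqrt pi) * z ^ n)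
   sums (fock_series (fock_coeff k x) z / of_real (sqrt pi))"
  using sums_divide[OF fock_series_sums[OF summable_fock_coeff]] by simp

lemma weighted_measurable:
  assumes "f holomorphic_on UNIV"
  shows "weighted k (\<lambda>z. of_real (exp (- (cmod z)\<^sup>2 / 2)) * f z) \<in> borel_measurable borel"
  unfolding weighted_def jbracket_def
  by (intro borel_measurable_continuous_onI continuous_intros holomorphic_on_imp_continuous_on assms) auto

lemma fock_fun_holomorphic: "(\<lambda>z. fock_series (fock_coeff k x) z / of_real (sqrt pi)) holomorphic_on UNIV"
  by (intro holomorphic_intros fock_series_holomorphic summable_fock_coeff) auto

lemma fock_fun_energy:
  assumes "j \<le> k"
  shows "square_integrable (weighted j (fock_fun k x))" "(L2_norm (weighted j (fock_fun k x)))\<^sup>2 = energy j k x"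
proof -
  have m: "weighted j (fock_fun k x) \<in> borel_measurable borel"
    unfolding fock_fun_eq by (rule weighted_measurable[OF fock_fun_holomorphic])
  have "(\<integral>\<^sup>+z. ennreal ((cmod (weighted j (fock_fun k x) z))\<^sup>2) \<partial>lborel)
     = (\<Sum>n. ennreal (fock_weight j n * (pi * fact n * (cmod (fock_coeff k x n / of_real (sqrt (fact n)) / of_real (sqrt pi)))\<^sup>2)))"
    unfolding fock_fun_eq by (rule fock_parseval[OF fock_fun_series])
  also have "\<dots> = (\<Sum>n. ennreal (fock_weight j n * (cmod (fock_coeff k x n))\<^sup>2))"
    by (intro suminf_cong arg_cong[where f = ennreal]) (simp add: norm_divide norm_mult power_divide power_mult_distrib)
  also have "\<dots> = ennreal (energy j k x)"
    unfolding sums_unique[OF energy_sums[OF assms]]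
    by (intro suminf_ennreal2 sums_summable[OF energy_sums[OF assms]]) auto
  finally have nn: "(\<integral>\<^sup>+z. ennreal ((cmod (weighted j (fock_fun k x) z))\<^sup>2) \<partial>lborel) = ennreal (energy j k x)" .
  have hb: "has_bochner_integral lborel (\<lambda>z. (cmod (weighted j (fock_fun k x) z))\<^sup>2) (energy j k x)"
    by (rule has_bochner_integral_nn_integral[OF _ _ energy_nonneg[OF assms] nn]) (use m in auto)
  show "square_integrable (weighted j (fock_fun k x))"
    unfolding square_integrable_def using m hb by (auto simp: has_bochner_integral_iff)
  show "(L2_norm (weighted j (fock_fun k x)))\<^sup>2 = energy j k x"
    unfolding L2_norm_def has_bochner_integral_integral_eq[OF hb] using energy_nonneg[OF assms] by simp
qed

lemma L2_norm_nonneg: "0 \<le> L2_norm f"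
  unfolding L2_norm_def by (intro real_sqrt_ge_zero integral_nonneg_AE AE_I2) simp

lemma L2_norm_fock_fun: "L2_norm (weighted k (fock_fun k x)) = norm x"
  using fock_fun_energy(2)[of k k x] L2_norm_nonneg[of "weighted k (fock_fun k x)"]
  by (simp add: energy_same power2_eq_iff_nonneg)

lemma weighted_0 [simp]: "weighted 0 u = u"
  by (simp add: weighted_def)

lemma fock_fun_in_weighted_fock: "fock_fun k x \<in> weighted_fock k"
  unfolding weighted_fock_def bargmann_fock_def
  using fock_fun_energy(1)[of 0 k x] fock_fun_energy(1)[of k k x] fock_fun_holomorphic[of k x]
  by (auto simp: fock_fun_eq)

lemma weighted_fock_obtain:
  assumes "u \<in> weighted_fock k"
  obtains x where "u = fock_fun k x"
proof -
  obtain f where f: "f holomorphic_on UNIV" "u = (\<lambda>z. of_real (exp (- (cmod z)\<^sup>2 / 2)) * f z)"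
    and si: "square_integrable (weighted k u)"
    using assms unfolding weighted_fock_def bargmann_fock_def by auto
  define a where "a n = (deriv ^^ n) f 0 / fact n" for n
  have s: "(\<lambda>n. a n * z ^ n) sums f z" for z
    using holomorphic_power_series[of f 0 "cmod z + 1" z] holomorphic_on_subset[OF f(1)] by (simp add: a_def)
  define c where "c n = a n * of_real (sqrt (pi * fact n))" for n
  define y where "y n = of_real (sqrt (fock_weight k n)) * c n" for n
  have y2: "(cmod (y n))\<^sup>2 = fock_weight k n * (pi * fact n * (cmod (a n))\<^sup>2)" for n
    by (simp add: y_def c_def norm_mult power_mult_distrib)
  have "(\<integral>\<^sup>+z. ennreal ((cmod (weighted k u z))\<^sup>2) \<partial>lborel) < \<infinity>"
    using si unfolding square_integrable_def by (auto simp: integrable_iff_bounded)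
  then have "(\<Sum>n. ennreal ((cmod (y n))\<^sup>2)) \<noteq> top"
    unfolding y2 fock_parseval[OF s, symmetric] f(2) by simp
  then have sy: "summable (\<lambda>n. (cmod (y n))\<^sup>2)"
    by (rule summable_suminf_not_top[rotated]) simp
  have fc: "fock_coeff k (Ell2 y) = c"
    by (rule ext) (simp add: fock_coeff_def coord_Ell2[OF sy] y_def)
  have "fock_series c z / of_real (sqrt pi) = f z" for z
  proof -
    have "(\<lambda>n. c n / of_real (sqrt (fact n)) / of_real (sqrt pi) * z ^ n) sums (fock_series c z / of_real (sqrt pi))"
      using fock_fun_series[of k "Ell2 y" z] unfolding fc .
    then have "(\<lambda>n. a n * z ^ n) sums (fock_series c z / of_real (sqrt pi))"
      by (simp add: c_def real_sqrt_mult)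
    then show ?thesis using sums_unique2[OF s] by simp
  qed
  then have "u = fock_fun k (Ell2 y)" unfolding fock_fun_eq fc f(2) by simp
  then show thesis by (rule that)
qed

lemma fock_fun_diff: "fock_fun k (x - y) z = fock_fun k x z - fock_fun k y z"
proof -
  have "fock_series (fock_coeff k (x - y)) z = fock_series (fock_coeff k x) z - fock_series (fock_coeff k y) z"
    unfolding fock_series_def
    by (subst suminf_diff[OF sums_summable[OF fock_series_sums[OF summable_fock_coeff]] sums_summable[OF fock_series_sums[OF summable_fock_coeff]]])
       (simp add: fock_coeff_def algebra_simps diff_divide_distrib)
  then show ?thesis by (simp only: fock_fun_def diff_divide_distrib right_diff_distrib)
qed

lemma fock_fun_scale: "fock_fun k y z = r * fock_fun k x z" if "\<And>n. coord y n = r * coord x n"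
proof -
  have "fock_series (fock_coeff k y) z = r * fock_series (fock_coeff k x) z"
    unfolding fock_series_def
    by (subst suminf_mult[OF sums_summable[OF fock_series_sums[OF summable_fock_coeff]], symmetric])
       (simp add: fock_coeff_def that algebra_simps)
  then show ?thesis by (simp add: fock_fun_def algebra_simps)
qed

lemma fock_fun_inject: "fock_fun k x = fock_fun k y \<longleftrightarrow> x = y"
proof
  assume eq: "fock_fun k x = fock_fun k y"
  have "fock_fun k (x - y) = (\<lambda>z. 0)" by (rule ext) (simp add: fock_fun_diff eq)
  then have "norm (x - y) = L2_norm (weighted k (\<lambda>z. 0))" using L2_norm_fock_fun[of k "x - y"] by simp
  then show "x = y" by (simp add: L2_norm_def weighted_def)
qed simp

lemma fock_fun_quotient:
  "(\<lambda>z. (fock_fun k x z - fock_fun k x' z) / of_real h - fock_fun k y z) = fock_fun k ((1 / h) *\<^sub>R (x - x') - y)"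
  by (rule ext, subst fock_fun_diff, subst fock_fun_scale[of "(1 / h) *\<^sub>R (x - x')" "of_real (1 / h)" "x - x'"])
     (simp_all add: fock_fun_diff)

lemma has_fock_derivative_iff:
  "has_fock_derivative k (\<lambda>s. fock_fun k (x s)) (fock_fun k y) t \<longleftrightarrow> (x has_vector_derivative y) (at t)"
proof -
  have "has_fock_derivative k (\<lambda>s. fock_fun k (x s)) (fock_fun k y) t \<longleftrightarrow>
      ((\<lambda>h. norm ((1 / h) *\<^sub>R (x (t + h) - x t) - y)) \<longlongrightarrow> 0) (at 0)"
    unfolding has_fock_derivative_def by (simp add: fock_fun_quotient fock_fun_in_weighted_fock L2_norm_fock_fun)
  also have "\<dots> \<longleftrightarrow> ((\<lambda>h. norm (x (t + h) - x t - h *\<^sub>R y) / norm h) \<longlongrightarrow> 0) (at 0)"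
  proof (rule tendsto_cong)
    show "\<forall>\<^sub>F h in at 0. norm ((1 / h) *\<^sub>R (x (t + h) - x t) - y) = norm (x (t + h) - x t - h *\<^sub>R y) / norm h"
      unfolding eventually_at_filter
    proof (rule always_eventually, intro allI impI)
      fix h :: real assume h: "h \<noteq> 0"
      have "(1 / h) *\<^sub>R (x (t + h) - x t) - y = (1 / h) *\<^sub>R (x (t + h) - x t - h *\<^sub>R y)"
        using h by (simp add: scaleR_diff_right)
      then show "norm ((1 / h) *\<^sub>R (x (t + h) - x t) - y) = norm (x (t + h) - x t - h *\<^sub>R y) / norm h"
        by (simp add: divide_inverse mult.commute)
    qed
  qed
  also have "\<dots> \<longleftrightarrow> (x has_vector_derivative y) (at t)"
    unfolding has_vector_derivative_def has_derivative_at by (simp add: bounded_linear_scaleR_left)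
  finally show ?thesis .
qed

lemma fock_series_mult:
  assumes c: "summable (\<lambda>n. (cmod (c n))\<^sup>2)" and d: "summable (\<lambda>n. (cmod (d n))\<^sup>2)"
  shows "(\<lambda>s. of_real (sqrt (2 ^ s / fact s)) * bsquare c d s * z ^ s) sums (fock_series c z * fock_series d z)"
proof -
  have "(\<lambda>s. \<Sum>i\<le>s. (c i / of_real (sqrt (fact i)) * z ^ i) * (d (s - i) / of_real (sqrt (fact (s - i))) * z ^ (s - i)))
      sums (fock_series c z * fock_series d z)"
    unfolding fock_series_def by (rule Cauchy_product_sums[OF fock_series_sums_norm[OF c] fock_series_sums_norm[OF d]])
  moreover have "(\<Sum>i\<le>s. (c i / of_real (sqrt (fact i)) * z ^ i) * (d (s - i) / of_real (sqrt (fact (s - i))) * z ^ (s - i)))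
     = of_real (sqrt (2 ^ s / fact s)) * bsquare c d s * z ^ s" for s
    unfolding bconv_def sum_distrib_left sum_distrib_right
  proof (rule sum.cong)
    fix i assume i: "i \<in> {..s}"
    have "sqrt (2 ^ s / fact s) * sqrt (binw s i) = 1 / (sqrt (fact i) * sqrt (fact (s - i)))"
      using i by (simp add: binw_def binomial_fact real_sqrt_mult real_sqrt_divide)
    from arg_cong[OF this, of complex_of_real]
    have e: "complex_of_real (sqrt (2 ^ s / fact s)) * of_real (sqrt (binw s i)) = 1 / (of_real (sqrt (fact i)) * of_real (sqrt (fact (s - i))))"
      by (simp only: of_real_mult of_real_divide of_real_1)
    have zz: "z ^ s = z ^ i * z ^ (s - i)" using i by (simp flip: power_add)
    have "of_real (sqrt (2 ^ s / fact s)) * (of_real (1 * sqrt (binw s i)) * (c i * d (s - i))) * z ^ s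
      = (complex_of_real (sqrt (2 ^ s / fact s)) * of_real (sqrt (binw s i))) * (c i * d (s - i)) * z ^ s"
      by (simp only: mult_1 mult.assoc)
    also have "\<dots> = (c i / of_real (sqrt (fact i)) * z ^ i) * (d (s - i) / of_real (sqrt (fact (s - i))) * z ^ (s - i))"
      unfolding e zz by simp
    finally show "(c i / of_real (sqrt (fact i)) * z ^ i) * (d (s - i) / of_real (sqrt (fact (s - i))) * z ^ (s - i))
       = of_real (sqrt (2 ^ s / fact s)) * (of_real (1 * sqrt (binw s i)) * (c i * d (s - i))) * z ^ s" by simp
  qed simp
  ultimately show ?thesis by simp
qed

interpretation one_kernel: bounded_kernel "\<lambda>_ _. 1" 1
  by standard simp

text \<open>The weight \<open>exp (- 2 * \<bar>w\<bar>\<^sup>2)\<close> is that of a product of four functions of the Bargmann-Fock space.\<close>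
lemma quartic_form:
  assumes c: "summable (\<lambda>n. (cmod (c n))\<^sup>2)" and d: "summable (\<lambda>n. (cmod (d n))\<^sup>2)"
  shows "(\<lambda>s. of_real (pi / 2) * (bsquare c c s * cnj (bsquare d c s))) sums
    (LINT w|lborel. of_real (exp (- 2 * (cmod w)\<^sup>2)) *
       (fock_series c w * fock_series c w * cnj (fock_series d w * fock_series c w)))"
proof -
  define I where "I s = pi * fact s / 2 ^ Suc s" for s
  have I: "(\<integral>\<^sup>+z. ennreal (exp (- 2 * (cmod z)\<^sup>2) * cmod z ^ (2 * n)) \<partial>lborel) = ennreal (I n)" for n
    using gaussian_moment[of 2 n] by (simp add: I_def mult.commute)
  have I0: "I n \<ge> 0" for n by (simp add: I_def)
  have prod: "I s * (2 ^ s / fact s) = pi / 2" for s by (simp add: I_def)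
  have sq: "(cmod (of_real (sqrt (2 ^ s / fact s)) * b))\<^sup>2 * I s = pi / 2 * (cmod b)\<^sup>2" for s b
  proof -
    have "(cmod (of_real (sqrt (2 ^ s / fact s)) * b))\<^sup>2 * I s = (I s * (2 ^ s / fact s)) * (cmod b)\<^sup>2"
      by (simp add: norm_mult power_mult_distrib)
    then show ?thesis unfolding prod .
  qed
  have "(\<lambda>s. of_real (I s) * (of_real (sqrt (2 ^ s / fact s)) * bsquare c c s * cnj (of_real (sqrt (2 ^ s / fact s)) * bsquare d c s))) sums
    (LINT w|lborel. of_real (exp (- 2 * (cmod w)\<^sup>2)) * (fock_series c w * fock_series c w * cnj (fock_series d w * fock_series c w)))"
    by (rule gauss2.parseval_polarized[OF fock_series_mult[OF c c] fock_series_mult[OF d c] I I0])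
       (unfold sq, (intro summable_mult one_kernel.summable_bconv c d)+)
  moreover have eq: "of_real (I s) * (of_real (sqrt (2 ^ s / fact s)) * b * cnj (of_real (sqrt (2 ^ s / fact s)) * b'))
      = of_real (pi / 2) * (b * cnj b')" for s b b'
  proof -
    have "complex_of_real (I s) * (of_real (sqrt (2 ^ s / fact s)) * b * cnj (of_real (sqrt (2 ^ s / fact s)) * b'))
       = of_real (I s * (sqrt (2 ^ s / fact s) * sqrt (2 ^ s / fact s))) * (b * cnj b')"
      by (simp only: of_real_mult complex_cnj_mult complex_cnj_complex_of_real mult_ac)
    also have "sqrt (2 ^ s / fact s) * sqrt (2 ^ s / fact s) = (2 ^ s / fact s :: real)" by simp
    finally show ?thesis unfolding prod .
  qed
  ultimately show ?thesis by (simp only: eq)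
qed

text \<open>With \<open>u = exp (- \<bar>w\<bar>\<^sup>2 / 2) * f\<close> the integrand of the projection at \<open>z\<close> is, up to a power of \<open>pi\<close>,
  \<open>exp (- 2 * \<bar>w\<bar>\<^sup>2) * f\<^sup>2 * cnj (f * g)\<close>, where \<open>g w = exp (cnj z * w)\<close> has the coefficients
  \<open>cnj z ^ n / sqrt (n!)\<close>. The integral is thus a pairing of two convolutions, and by duality it is
  the series in \<open>z\<close> whose coefficients are given by \<open>bcorr\<close>.\<close>
lemma fock_proj_cubic:
  "fock_proj (\<lambda>z. of_real ((cmod (fock_fun k x z))\<^sup>2) * fock_fun k x z) = (\<lambda>z. \<i> * fock_fun k (lll_field k x) z)"
proof
  fix z
  define c where "c = fock_coeff k x"
  define d where "d n = cnj z ^ n / of_real (sqrt (fact n))" for n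
  have c: "summable (\<lambda>n. (cmod (c n))\<^sup>2)" unfolding c_def by (rule summable_fock_coeff)
  have d: "summable (\<lambda>n. (cmod (d n))\<^sup>2)" unfolding d_def by (rule summable_exp_coeff)
  have Fd: "fock_series d w = exp (cnj z * w)" for w
  proof -
    have "(\<lambda>n. (cnj z * w) ^ n /\<^sub>R fact n) sums exp (cnj z * w)" by (rule exp_converges)
    moreover have "(cnj z * w) ^ n /\<^sub>R fact n = d n / of_real (sqrt (fact n)) * w ^ n" for n
    proof -
      have "complex_of_real (sqrt (fact n)) * of_real (sqrt (fact n)) = of_real (fact n)"
        by (simp flip: of_real_mult)
      then show ?thesis by (simp add: d_def scaleR_conv_of_real power_mult_distrib divide_inverse flip: inverse_mult_distrib)
    qed
    ultimately show ?thesis using fock_series_sums[OF d, of w] sums_unique2 by simp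
  qed
  have s: "summable (\<lambda>s. bsquare c c s * cnj (bsquare d c s))"
  proof (rule summable_norm_cancel)
    have "summable (\<lambda>s. cmod (bsquare c c s) * cmod (bsquare d c s))"
      by (intro summable_sq_prod one_kernel.summable_bconv c d)
    then show "summable (\<lambda>s. cmod (bsquare c c s * cnj (bsquare d c s)))" by (simp add: norm_mult)
  qed
  let ?Q = "LINT w|lborel. of_real (exp (- 2 * (cmod w)\<^sup>2)) * (fock_series c w * fock_series c w * cnj (fock_series d w * fock_series c w))"
  have integrand: "exp (cnj w * z - of_real ((cmod w)\<^sup>2 / 2)) * (of_real ((cmod (fock_fun k x w))\<^sup>2) * fock_fun k x w)
      = of_real (1 / (pi * sqrt pi)) * (of_real (exp (- 2 * (cmod w)\<^sup>2)) * (fock_series c w * fock_series c w * cnj (fock_series d w * fock_series c w)))" for w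
  proof -
    define E where "E = exp (- (cmod w)\<^sup>2 / 2)"
    define F where "F = fock_series c w"
    have u: "fock_fun k x w = of_real E * (F / of_real (sqrt pi))" by (simp add: fock_fun_def c_def E_def F_def)
    have E4: "exp (- 2 * (cmod w)\<^sup>2) = E * (E * E * E)" unfolding E_def by (simp flip: exp_add)
    have e1: "exp (cnj w * z - of_real ((cmod w)\<^sup>2 / 2)) = exp (cnj w * z) * of_real E"
    proof -
      have "exp (cnj w * z - of_real ((cmod w)\<^sup>2 / 2)) = exp (cnj w * z) * exp (of_real (- (cmod w)\<^sup>2 / 2))"
        using exp_add[of "cnj w * z" "of_real (- (cmod w)\<^sup>2 / 2)"] by simp
      then show ?thesis unfolding E_def exp_of_real .
    qed
    have e2: "cnj (fock_series d w) = exp (cnj w * z)" unfolding Fd by (simp add: exp_cnj mult.commute)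
    have pp: "complex_of_real (1 / (pi * sqrt pi)) = 1 / (of_real (sqrt pi) * of_real (sqrt pi) * of_real (sqrt pi))"
      by (simp flip: of_real_mult)
    show ?thesis
      unfolding complex_norm_square u E4 e1 complex_cnj_mult e2 F_def[symmetric] pp
      by (simp add: mult_ac)
  qed
  have "fock_proj (\<lambda>z. of_real ((cmod (fock_fun k x z))\<^sup>2) * fock_fun k x z) z
     = of_real (1 / pi * exp (- (cmod z)\<^sup>2 / 2)) * (of_real (1 / (pi * sqrt pi)) * ?Q)"
    unfolding fock_proj_def integrand by (simp only: integral_mult_right_zero)
  also have "?Q = of_real (pi / 2) * (\<Sum>s. bsquare c c s * cnj (bsquare d c s))"
  proof -
    have "?Q = (\<Sum>s. of_real (pi / 2) * (bsquare c c s * cnj (bsquare d c s)))"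
      by (rule sums_unique[OF quartic_form[OF c d]])
    also have "\<dots> = of_real (pi / 2) * (\<Sum>s. bsquare c c s * cnj (bsquare d c s))" by (rule suminf_mult[OF s])
    finally show ?thesis .
  qed
  finally have P: "fock_proj (\<lambda>z. of_real ((cmod (fock_fun k x z))\<^sup>2) * fock_fun k x z) z
    = of_real (1 / pi * exp (- (cmod z)\<^sup>2 / 2)) * (of_real (1 / (pi * sqrt pi)) * (of_real (pi / 2) * (\<Sum>s. bsquare c c s * cnj (bsquare d c s))))" .
  define y where "y = R.Bcorr k x (S.Bconv k x x)"
  \<comment> \<open>pairing with \<open>D\<close> evaluates the power series of \<open>y\<close> at \<open>z\<close>\<close>
  define D where "D = Ell2 (\<lambda>n. d n / of_real (sqrt (fock_weight k n)))"
  have sD: "summable (\<lambda>n. (cmod (d n / of_real (sqrt (fock_weight k n))))\<^sup>2)"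
  proof (rule summable_comparison_test'[OF d, of 0])
    fix n
    show "norm ((cmod (d n / of_real (sqrt (fock_weight k n))))\<^sup>2) \<le> (cmod (d n))\<^sup>2"
      using fock_weight_ge_1[of k n] by (simp add: norm_divide power_divide divide_le_eq mult_left_le mult_le_cancel_left1)
  qed
  have "bconv (R_kernel k) (coord D) (coord x) s = of_real (1 / (2 * pi * sqrt (fock_weight k s))) * bsquare d c s" for s
    unfolding bconv_def sum_distrib_left
  proof (rule sum.cong)
    fix n assume n: "n \<in> {..s}"
    show "of_real (R_kernel k n (s - n) * sqrt (binw s n)) * (coord D n * coord x (s - n))
      = of_real (1 / (2 * pi * sqrt (fock_weight k s))) * (of_real (1 * sqrt (binw s n)) * (d n * c (s - n)))"
      using n by (simp add: R_kernel_def D_def coord_Ell2[OF sD] c_def fock_coeff_def real_sqrt_divide real_sqrt_mult mult_ac)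
  qed simp
  then have term_eq: "coord (S.Bconv k x x) s * cnj (bconv (R_kernel k) (coord D) (coord x) s)
     = of_real (1 / (2 * pi)) * (bsquare c c s * cnj (bsquare d c s))" for s
    unfolding coord_S c_def[symmetric] by simp
  note dual = R.bconv_bcorr_duality[where \<sigma> = "S.Bconv k x x" and k = k and d = D and y = x]
  have "cnj (coord D n) * coord y n = fock_coeff k y n / of_real (sqrt (fact n)) * z ^ n" for n
    unfolding D_def coord_Ell2[OF sD] by (simp add: d_def fock_coeff_def mult.commute)
  moreover have "(\<lambda>n. cnj (coord D n) * coord y n) sums (of_real (1 / (2 * pi)) * (\<Sum>s. bsquare c c s * cnj (bsquare d c s)))"
    using dual(2) unfolding term_eq suminf_mult[OF s] y_def R.coord_Bcorr .
  ultimately have "(\<lambda>n. fock_coeff k y n / of_real (sqrt (fact n)) * z ^ n)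
      sums (of_real (1 / (2 * pi)) * (\<Sum>s. bsquare c c s * cnj (bsquare d c s)))"
    by (simp only:)
  from sums_unique2[OF fock_series_sums[OF summable_fock_coeff] this]
  have "fock_series (fock_coeff k y) z = of_real (1 / (2 * pi)) * (\<Sum>s. bsquare c c s * cnj (bsquare d c s))" .
  then have "fock_fun k y z = fock_proj (\<lambda>z. of_real ((cmod (fock_fun k x z))\<^sup>2) * fock_fun k x z) z"
    unfolding P fock_fun_def[of k y z] by simp
  moreover have "fock_fun k (lll_field k x) z = - \<i> * fock_fun k y z"
    by (rule fock_fun_scale) (simp add: lll_field_def y_def)
  ultimately show "fock_proj (\<lambda>z. of_real ((cmod (fock_fun k x z))\<^sup>2) * fock_fun k x z) z = \<i> * fock_fun k (lll_field k x) z"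
    by simp
qed

section \<open>Solutions of the Lowest Landau Level equation\<close>

lemma LLL_solution_iff:
  "LLL_solution k (fock_fun k x0) u \<longleftrightarrow> (\<exists>x. u = (\<lambda>t. fock_fun k (x t)) \<and> x 0 = x0 \<and> lll_flow k x)"
proof
  assume sol: "LLL_solution k (fock_fun k x0) u"
  have dv: "\<exists>v. has_fock_derivative k u v t \<and>
        (\<lambda>z. \<i> * v z) = fock_proj (\<lambda>z. of_real ((cmod (u t z))\<^sup>2) * u t z)" for t
    using sol by (simp add: LLL_solution_def)
  have "\<exists>y. u s = fock_fun k y" for s
    using dv[of 0] weighted_fock_obtain unfolding has_fock_derivative_def by metis
  then obtain x where x: "\<And>s. u s = fock_fun k (x s)" by metis
  have u: "u = (\<lambda>t. fock_fun k (x t))" by (rule ext) (rule x)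
  have "lll_flow k x"
    unfolding lll_flow_def
  proof
    fix t
    obtain v where v: "has_fock_derivative k u v t"
       "(\<lambda>z. \<i> * v z) = fock_proj (\<lambda>z. of_real ((cmod (u t z))\<^sup>2) * u t z)" using dv by blast
    obtain y where y: "v = fock_fun k y"
      using v(1) weighted_fock_obtain unfolding has_fock_derivative_def by metis
    have "(\<lambda>z. \<i> * v z) = (\<lambda>z. \<i> * fock_fun k (lll_field k (x t)) z)"
      using v(2) unfolding u fock_proj_cubic .
    then have "v = fock_fun k (lll_field k (x t))" by (simp add: fun_eq_iff)
    then have "y = lll_field k (x t)" using y by (simp add: fock_fun_inject)
    then show "(x has_vector_derivative lll_field k (x t)) (at t)"
      using v(1) unfolding u y has_fock_derivative_iff by simp
  qed
  moreover have "x 0 = x0" using sol x[of 0] by (simp add: LLL_solution_def fock_fun_inject)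
  ultimately show "\<exists>x. u = (\<lambda>t. fock_fun k (x t)) \<and> x 0 = x0 \<and> lll_flow k x" using u by blast
next
  assume "\<exists>x. u = (\<lambda>t. fock_fun k (x t)) \<and> x 0 = x0 \<and> lll_flow k x"
  then obtain x where u: "u = (\<lambda>t. fock_fun k (x t))" and x0: "x 0 = x0" and x: "lll_flow k x" by blast
  obtain V where V: "V 0 = x" "\<And>n t. (V n has_vector_derivative V (Suc n) t) (at t)"
    using lll_flow_smooth[of x k] x unfolding lll_flow_def by blast
  have "smooth_fock_curve k u"
    unfolding smooth_fock_curve_def
    by (rule exI[of _ "\<lambda>n t. fock_fun k (V n t)"]) (simp add: V has_fock_derivative_iff u)
  moreover have "has_fock_derivative k u (fock_fun k (lll_field k (x t))) t" for t
    unfolding u has_fock_derivative_iff using x by (simp add: lll_flow_def)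
  moreover have "(\<lambda>z. \<i> * fock_fun k (lll_field k (x t)) z) = fock_proj (\<lambda>z. of_real ((cmod (u t z))\<^sup>2) * u t z)" for t
    unfolding u fock_proj_cubic ..
  ultimately show "LLL_solution k (fock_fun k x0) u"
    unfolding LLL_solution_def using u x0 by blast
qed

lemma LLL_solution_ex1:
  assumes "u0 \<in> weighted_fock k"
  shows "\<exists>!u. LLL_solution k u0 u"
proof -
  obtain x0 where u0: "u0 = fock_fun k x0" using weighted_fock_obtain[OF assms] by blast
  obtain x where x: "x 0 = x0" "lll_flow k x" using lll_flow_exists[of x0 k] unfolding lll_flow_def by blast
  show ?thesis
  proof (rule ex1I[of _ "\<lambda>t. fock_fun k (x t)"])
    show "LLL_solution k u0 (\<lambda>t. fock_fun k (x t))" unfolding u0 LLL_solution_iff using x by blast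
    fix u assume "LLL_solution k u0 u"
    then obtain y where y: "u = (\<lambda>t. fock_fun k (y t))" "y 0 = x0" "lll_flow k y"
      unfolding u0 LLL_solution_iff by blast
    have "y t = x t" for t
      using lll_flow_unique[of y k x t] x y unfolding lll_flow_def by simp
    then show "u = (\<lambda>t. fock_fun k (x t))" using y(1) by simp
  qed
qed

lemma weighted_fock_antimono:
  assumes "j \<le> k" "u \<in> weighted_fock k"
  shows "u \<in> weighted_fock j" "L2_norm (weighted j u) \<le> L2_norm (weighted k u)"
proof -
  obtain x where u: "u = fock_fun k x" using weighted_fock_obtain[OF assms(2)] by blast
  show "u \<in> weighted_fock j"
    using assms fock_fun_energy(1)[OF assms(1), of x] by (simp add: weighted_fock_def u)
  have "(L2_norm (weighted j u))\<^sup>2 \<le> (L2_norm (weighted k u))\<^sup>2"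
    unfolding u fock_fun_energy(2)[OF assms(1)] fock_fun_energy(2)[OF order_refl]
    by (rule energy_mono[OF assms(1)]) simp
  then show "L2_norm (weighted j u) \<le> L2_norm (weighted k u)"
    by (rule power2_le_imp_le[OF _ L2_norm_nonneg])
qed

lemma has_fock_derivative_antimono:
  assumes j: "j \<le> k" and d: "has_fock_derivative k u v t"
  shows "has_fock_derivative j u v t"
proof -
  have u: "\<And>s. u s \<in> weighted_fock k" and v: "v \<in> weighted_fock k"
    and lim: "((\<lambda>h. L2_norm (weighted k (\<lambda>z. (u (t + h) z - u t z) / of_real h - v z))) \<longlongrightarrow> 0) (at 0)"
    using d unfolding has_fock_derivative_def by auto
  have "\<exists>y. u s = fock_fun k y" for s using u weighted_fock_obtain by metis
  then obtain x where x: "\<And>s. u s = fock_fun k (x s)" by metis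
  obtain y where y: "v = fock_fun k y" using v weighted_fock_obtain by metis
  have q: "(\<lambda>z. (u (t + h) z - u t z) / of_real h - v z) \<in> weighted_fock k" for h
    unfolding x y fock_fun_quotient by (rule fock_fun_in_weighted_fock)
  have "((\<lambda>h. L2_norm (weighted j (\<lambda>z. (u (t + h) z - u t z) / of_real h - v z))) \<longlongrightarrow> 0) (at 0)"
    by (rule tendsto_sandwich[OF _ _ tendsto_const lim])
       (auto intro!: always_eventually L2_norm_nonneg weighted_fock_antimono(2)[OF j q])
  then show ?thesis
    unfolding has_fock_derivative_def using weighted_fock_antimono(1)[OF j] u v by blast
qed

text \<open>Solutions in spaces of different order can be compared: a solution in the space of order three is
  one in the larger spaces, where it is unique.\<close>
lemma LLL_solution_antimono:
  assumes "j \<le> k" "LLL_solution k u0 u"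
  shows "LLL_solution j u0 u"
proof -
  obtain V where "V 0 = u" "\<And>n t. has_fock_derivative k (V n) (V (Suc n) t) t"
    using assms(2) unfolding LLL_solution_def smooth_fock_curve_def by blast
  then have "smooth_fock_curve j u"
    unfolding smooth_fock_curve_def
    by (intro exI[of _ V]) (simp add: has_fock_derivative_antimono[OF assms(1)])
  then show ?thesis
    using assms(2) has_fock_derivative_antimono[OF assms(1)] unfolding LLL_solution_def by blast
qed

lemma base_mono:
  fixes A B e t :: real
  assumes "0 \<le> A" "A \<le> B" "0 \<le> e" "0 \<le> p"
  shows "(1 + A * e * \<bar>t\<bar>) powr p \<le> (1 + B * e * \<bar>t\<bar>) powr p"
  using assms by (intro powr_mono2 add_left_mono mult_right_mono add_nonneg_nonneg mult_nonneg_nonneg) auto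

theorem theoremB1:
  "\<exists>(C::real) (Ck :: nat \<Rightarrow> real). C > 0 \<and> (\<forall>k. Ck k > 0) \<and>
     (\<forall>k\<ge>1. \<forall>u0\<in>weighted_fock k.
        (\<exists>!u. LLL_solution k u0 u) \<and>
        (\<forall>u. LLL_solution k u0 u \<longrightarrow>
           (k \<ge> 3 \<longrightarrow> (\<forall>t. L2_norm (weighted k (u t)) \<le>
              L2_norm (weighted k u0) *
              (1 + Ck k * (L2_norm (weighted 1 u0))\<^sup>2 * \<bar>t\<bar>) powr ((real k - 1) / 4))) \<and>
           (k = 2 \<longrightarrow> (\<forall>t. L2_norm (weighted 2 (u t)) \<le>
              L2_norm (weighted 2 u0) *
              (1 + C * (L2_norm u0)\<^sup>2 * \<bar>t\<bar>) powr (1 / 2))) \<and>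
           (square_integrable (weighted 3 u0) \<longrightarrow>
              (\<forall>t. square_integrable (weighted 2 (u t)) \<and>
                 L2_norm (weighted 2 (u t)) \<le>
                 L2_norm (weighted 3 u0) *
                 (1 + C * (L2_norm (weighted 1 u0))\<^sup>2 * \<bar>t\<bar>) powr (1 / 4)))))"
proof -
  obtain C2 where C2: "C2 \<ge> 0" "\<And>k x t. 2 \<le> k \<Longrightarrow> lll_flow k x \<Longrightarrow>
     energy 2 k (x t) \<le> energy 2 k (x 0) * (1 + C2 * energy 0 k (x 0) * \<bar>t\<bar>)"
    using growth_weight_two by blast
  have "\<exists>c. 3 \<le> j \<longrightarrow> c \<ge> 0 \<and> (\<forall>k x t. j \<le> k \<longrightarrow> lll_flow k x \<longrightarrow>
     energy j k (x t) \<le> energy j k (x 0) * (1 + c * energy 1 k (x 0) * \<bar>t\<bar>) powr ((real j - 1) / 2))" for j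
    using growth_weight_ge_three[of j] by blast
  then obtain G where G: "\<And>j. 3 \<le> j \<Longrightarrow> G j \<ge> 0" "\<And>j k x t. 3 \<le> j \<Longrightarrow> j \<le> k \<Longrightarrow> lll_flow k x \<Longrightarrow>
     energy j k (x t) \<le> energy j k (x 0) * (1 + G j * energy 1 k (x 0) * \<bar>t\<bar>) powr ((real j - 1) / 2)"
    by metis
  define C where "C = C2 + G 3 + 1"
  define Ck where "Ck k = (if k \<ge> 3 then G k + 1 else 1)" for k
  have C: "C > 0" "C2 \<le> C" "G 3 \<le> C" using C2(1) G(1)[of 3] by (auto simp: C_def)
  have Ck: "Ck k > 0" for k using G(1)[of k] by (auto simp: Ck_def)
  have high: "L2_norm (weighted k (u t)) \<le> L2_norm (weighted k u0) *
      (1 + Ck k * (L2_norm (weighted 1 u0))\<^sup>2 * \<bar>t\<bar>) powr ((real k - 1) / 4)"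
    if k: "3 \<le> k" and u0: "u0 \<in> weighted_fock k" and sol: "LLL_solution k u0 u" for k u0 u t
  proof (rule le_mult_powr_from_square[OF _ L2_norm_nonneg])
    have p: "2 * ((real k - 1) / 4) = (real k - 1) / 2" by simp
    obtain x0 where x0: "u0 = fock_fun k x0" using weighted_fock_obtain[OF u0] by blast
    obtain x where x: "u = (\<lambda>t. fock_fun k (x t))" "x 0 = x0" "lll_flow k x"
      using sol unfolding x0 LLL_solution_iff by blast
    have "energy k k (x t) \<le> energy k k x0 * (1 + G k * energy 1 k x0 * \<bar>t\<bar>) powr ((real k - 1) / 2)"
      using G(2)[OF k order_refl x(3), of t] unfolding x(2) .
    also have "\<dots> \<le> energy k k x0 * (1 + Ck k * energy 1 k x0 * \<bar>t\<bar>) powr ((real k - 1) / 2)"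
      using k G(1)[OF k] by (intro mult_left_mono base_mono energy_nonneg) (auto simp: Ck_def)
    finally show "(L2_norm (weighted k (u t)))\<^sup>2 \<le> (L2_norm (weighted k u0))\<^sup>2 *
      (1 + Ck k * (L2_norm (weighted 1 u0))\<^sup>2 * \<bar>t\<bar>) powr (2 * ((real k - 1) / 4))"
      unfolding p using k by (simp add: x(1) x0 fock_fun_energy(2))
  qed
  have two: "L2_norm (weighted 2 (u t)) \<le> L2_norm (weighted 2 u0) * (1 + C * (L2_norm u0)\<^sup>2 * \<bar>t\<bar>) powr (1 / 2)"
    if u0: "u0 \<in> weighted_fock 2" and sol: "LLL_solution 2 u0 u" for u0 u t
  proof (rule le_mult_powr_from_square[OF _ L2_norm_nonneg])
    obtain x0 where x0: "u0 = fock_fun 2 x0" using weighted_fock_obtain[OF u0] by blast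
    obtain x where x: "u = (\<lambda>t. fock_fun 2 (x t))" "x 0 = x0" "lll_flow 2 x"
      using sol unfolding x0 LLL_solution_iff by blast
    have e: "energy 0 2 x0 \<ge> 0" by (intro energy_nonneg) simp
    have "energy 2 2 (x t) \<le> energy 2 2 x0 * (1 + C2 * energy 0 2 x0 * \<bar>t\<bar>)"
      using C2(2)[OF order_refl x(3), of t] unfolding x(2) .
    also have "\<dots> \<le> energy 2 2 x0 * (1 + C * energy 0 2 x0 * \<bar>t\<bar>) powr 1"
    proof (rule mult_left_mono)
      have "1 + C2 * energy 0 2 x0 * \<bar>t\<bar> \<le> 1 + C * energy 0 2 x0 * \<bar>t\<bar>"
        using C e by (intro add_left_mono mult_right_mono) auto
      moreover have "0 \<le> 1 + C * energy 0 2 x0 * \<bar>t\<bar>" using C e by simp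
      ultimately show "1 + C2 * energy 0 2 x0 * \<bar>t\<bar> \<le> (1 + C * energy 0 2 x0 * \<bar>t\<bar>) powr 1" by simp
    qed (simp add: energy_nonneg)
    finally show "(L2_norm (weighted 2 (u t)))\<^sup>2 \<le> (L2_norm (weighted 2 u0))\<^sup>2 *
      (1 + C * (L2_norm u0)\<^sup>2 * \<bar>t\<bar>) powr (2 * (1 / 2))"
      using fock_fun_energy(2)[of 0 2 x0] by (simp add: x(1) x0 fock_fun_energy(2))
  qed
  have three: "square_integrable (weighted 2 (u t)) \<and> L2_norm (weighted 2 (u t)) \<le>
      L2_norm (weighted 3 u0) * (1 + C * (L2_norm (weighted 1 u0))\<^sup>2 * \<bar>t\<bar>) powr (1 / 4)"
    if u0: "u0 \<in> weighted_fock k" and si: "square_integrable (weighted 3 u0)" and sol: "LLL_solution k u0 u" for k u0 u t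
  proof -
    have u03: "u0 \<in> weighted_fock 3" using u0 si by (simp add: weighted_fock_def)
    have "LLL_solution 3 u0 u"
    proof (cases "3 \<le> k")
      case True then show ?thesis using LLL_solution_antimono sol by blast
    next
      case False
      obtain u' where u': "LLL_solution 3 u0 u'" using LLL_solution_ex1[OF u03] by blast
      have "LLL_solution k u0 u'" using LLL_solution_antimono[OF _ u', of k] False by simp
      then have "u' = u" using LLL_solution_ex1[OF u0] sol by blast
      then show ?thesis using u' by simp
    qed
    moreover obtain x0 where x0: "u0 = fock_fun 3 x0" using weighted_fock_obtain[OF u03] by blast
    ultimately obtain x where x: "u = (\<lambda>t. fock_fun 3 (x t))" "x 0 = x0" "lll_flow 3 x"
      unfolding x0 LLL_solution_iff by blast
    define a where "a = L2_norm (weighted 2 (u t))"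
    let ?B = "1 + C * energy 1 3 x0 * \<bar>t\<bar>"
    have e: "energy 1 3 x0 \<ge> 0" "energy 3 3 x0 \<ge> 0" by (simp_all add: energy_nonneg)
    have "energy 2 3 (x t) \<le> energy 3 3 x0 * ?B powr (1 / 2)"
    proof (rule le_mult_powr_from_square[OF _ e(2)])
      have "energy 3 3 (x t) \<le> energy 3 3 x0 * (1 + G 3 * energy 1 3 x0 * \<bar>t\<bar>) powr 1"
        using G(2)[OF order_refl order_refl x(3), of t] unfolding x(2) by simp
      also have "\<dots> \<le> energy 3 3 x0 * ?B powr 1"
        using C G(1)[of 3] e by (intro mult_left_mono base_mono) auto
      finally have g3: "energy 3 3 (x t) \<le> energy 3 3 x0 * ?B powr 1" .
      have "(energy 2 3 (x t))\<^sup>2 \<le> energy 1 3 (x t) * energy 3 3 (x t)" by (rule energy_interpolation) simp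
      also have "energy 1 3 (x t) = energy 1 3 x0" using lll_flow_energy_const[OF x(3), of 1 t] x(2) by simp
      also have "energy 1 3 x0 * energy 3 3 (x t) \<le> energy 3 3 x0 * (energy 3 3 x0 * ?B powr 1)"
        using g3 e by (intro mult_mono energy_mono) (auto simp: energy_nonneg)
      finally show "(energy 2 3 (x t))\<^sup>2 \<le> (energy 3 3 x0)\<^sup>2 * ?B powr (2 * (1 / 2))"
        by (simp add: power2_eq_square)
    qed
    then have "(L2_norm (weighted 2 (u t)))\<^sup>2 \<le> (L2_norm (weighted 3 u0))\<^sup>2 *
        (1 + C * (L2_norm (weighted 1 u0))\<^sup>2 * \<bar>t\<bar>) powr (2 * (1 / 4))"
      by (simp add: x(1) x0 fock_fun_energy(2))
    from le_mult_powr_from_square[OF this L2_norm_nonneg]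
    show ?thesis using fock_fun_energy(1)[of 2 3 "x t"] by (simp add: x(1))
  qed
  show ?thesis
    using C(1) Ck LLL_solution_ex1 high two three
    by (intro exI[of _ C] exI[of _ Ck] conjI allI impI ballI) blast+
qed

end
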